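(* Forget restricted to instances whose query is nonrecursive, connected, and whose rules contain no time points, is in PTIME in data complexity (i.e., when the query is fixed), with numbers encoded in unary.
   Context: Temporal Datalog. Constants are partitioned into objects and integer time points; variables into object variables and time variables. A time term is a time point, a time variable, or an expression $t+k$ with $t$ a time variable and $k\in\mathbb{Z}$. Each predicate is either extensional (EDB) or intensional (IDB) and has an arity $n\ge0$, each position being of object sort or time sort; a predicate is rigid if all its positions are of object sort, and temporal if its last position is of time sort and all others are of object sort. An atom $P(t_1,\dots,t_n)$ has terms of the required sorts. A rule is $\bigwedge_i\alpha_i\to\alpha$ with $\alpha$ and all $\alpha_i$ rigid or temporal atoms, $\alpha$ IDB whenever the body is nonempty, and every head variable occurring in the body. A program is a finite set of rules. A fact is a ground rigid or temporal atom without $+$ (identified with the rule $\top\to\alpha$); a dataset is a finite set of EDB facts. Rules are read as universally quantified first-order sentences with $+$ interpreted as integer addition; $\Pi\models\alpha$ denotes entailment. A query is $Q=\langle P_Q,\Pi_Q\rangle$ with $\Pi_Q$ a program and $P_Q$ an IDB predicate of $\Pi_Q$; it is temporal if $P_Q$ is temporal. For a temporal query $Q$, dataset $D$ and time point $\tau$, $Q(D,\tau)$ is the set of tuples of objects $\vec o$ with $\Pi_Q\cup D\models P_Q(\vec o,\tau)$. For a dataset $D$ and time point $\tau$, $D[\tau]$ is the set of all rigid facts of $D$ together with the temporal facts of $D$ whose time argument is $>\tau$. A $\tau_{in}$-history is a dataset consisting of rigid facts and temporal facts with time argument $\le\tau_{in}$; a $\tau_{in}$-update is a dataset consisting of temporal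 facts with time argument $>\tau_{in}$. Forget: an instance is $\langle Q,D,\tau_{in},\tau_{out},\tau_{mem}\rangle$ with $Q$ a temporal query, $D$ a $\tau_{in}$-history and $\tau_{mem}\le\tau_{out}\le\tau_{in}$; Forget holds for it iff $Q(D\cup U,\tau)=Q(D[\tau_{mem}]\cup U,\tau)$ for every $\tau_{in}$-update $U$ and every time point $\tau\ge\tau_{out}$. Predicate $P$ depends on $P'$ in $\Pi$ if some rule of $\Pi$ has $P$ in the head and $P'$ in the body; $\Pi$ (or a query with program $\Pi$) is nonrecursive if the graph of this dependency relation is acyclic. A rule is connected if it contains at most one time variable and, if a time variable occurs in the body, it also occurs in the head; a query is connected if all its rules are. *)

theory Defs
  imports Main
begin

text \<open>Objects are natural numbers (object names), time points are integers.
 Object variables and time variables are indexed by natural numbers (separate sorts).\<close>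

datatype oterm = OConst nat | OVar nat

datatype tterm = TPoint int | TVar nat | TPlus nat int

text \<open>A predicate: name, IDB flag (False = EDB), number of object positions,
 and whether it has a final time position (temporal) or not (rigid).
 Only rigid and temporal predicates can occur in rules and facts.\<close>
datatype pred = Pred (pname: nat) (pidb: bool) (parity: nat) (ptemp: bool)

datatype atom = Atom (apred: pred) (aobjs: "oterm list") (atime: "tterm option")

datatype rule = Rule (body: "atom list") (head: atom)

datatype gatom = GAtom (gpred: pred) (gobjs: "nat list") (gtime: "int option")

definition wf_atom :: "atom \<Rightarrow> bool" where
  "wf_atom a \<longleftrightarrow> length (aobjs a) = parity (apred a) \<and> (ptemp (apred a) \<longleftrightarrow> atime a \<noteq> None)"

definition wf_gatom :: "gatom \<Rightarrow> bool" where
  "wf_gatom g \<longleftrightarrow> length (gobjs g) = parity (gpred g) \<and> (ptemp (gpred g) \<longleftrightarrow> gtime g \<noteq> None)"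

fun ovars_oterm :: "oterm \<Rightarrow> nat set" where
  "ovars_oterm (OConst c) = {}" | "ovars_oterm (OVar x) = {x}"

fun tvars_tterm :: "tterm \<Rightarrow> nat set" where
  "tvars_tterm (TPoint k) = {}" | "tvars_tterm (TVar x) = {x}" | "tvars_tterm (TPlus x k) = {x}"

definition ovars :: "atom \<Rightarrow> nat set" where
  "ovars a = (\<Union>t\<in>set (aobjs a). ovars_oterm t)"

definition tvars :: "atom \<Rightarrow> nat set" where
  "tvars a = (case atime a of None \<Rightarrow> {} | Some t \<Rightarrow> tvars_tterm t)"

definition body_ovars :: "rule \<Rightarrow> nat set" where
  "body_ovars r = (\<Union>a\<in>set (body r). ovars a)"

definition body_tvars :: "rule \<Rightarrow> nat set" where
  "body_tvars r = (\<Union>a\<in>set (body r). tvars a)"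

definition rule_tvars :: "rule \<Rightarrow> nat set" where
  "rule_tvars r = body_tvars r \<union> tvars (head r)"

definition wf_rule :: "rule \<Rightarrow> bool" where
  "wf_rule r \<longleftrightarrow> wf_atom (head r) \<and> (\<forall>a\<in>set (body r). wf_atom a)
     \<and> (body r \<noteq> [] \<longrightarrow> pidb (apred (head r)))
     \<and> ovars (head r) \<subseteq> body_ovars r \<and> tvars (head r) \<subseteq> body_tvars r"

definition program :: "rule set \<Rightarrow> bool" where
  "program \<Pi> \<longleftrightarrow> finite \<Pi> \<and> (\<forall>r\<in>\<Pi>. wf_rule r)"

definition preds_of :: "rule set \<Rightarrow> pred set" where
  "preds_of \<Pi> = (\<Union>r\<in>\<Pi>. insert (apred (head r)) (apred ` set (body r)))"

fun inst_o :: "(nat \<Rightarrow> nat) \<Rightarrow> oterm \<Rightarrow> nat" where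
  "inst_o s (OConst c) = c" | "inst_o s (OVar x) = s x"

fun inst_t :: "(nat \<Rightarrow> int) \<Rightarrow> tterm \<Rightarrow> int" where
  "inst_t s (TPoint k) = k" | "inst_t s (TVar x) = s x" | "inst_t s (TPlus x k) = s x + k"

definition inst :: "(nat \<Rightarrow> nat) \<Rightarrow> (nat \<Rightarrow> int) \<Rightarrow> atom \<Rightarrow> gatom" where
  "inst so st a = GAtom (apred a) (map (inst_o so) (aobjs a)) (map_option (inst_t st) (atime a))"

definition sat_rule :: "gatom set \<Rightarrow> rule \<Rightarrow> bool" where
  "sat_rule I r \<longleftrightarrow> (\<forall>so st. (\<forall>a\<in>set (body r). inst so st a \<in> I) \<longrightarrow> inst so st (head r) \<in> I)"

definition entails :: "rule set \<Rightarrow> gatom set \<Rightarrow> gatom \<Rightarrow> bool" where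
  "entails \<Pi> D \<alpha> \<longleftrightarrow> (\<forall>I. D \<subseteq> I \<and> (\<forall>r\<in>\<Pi>. sat_rule I r) \<longrightarrow> \<alpha> \<in> I)"

type_synonym query = "pred \<times> rule set"

definition temporal_query :: "query \<Rightarrow> bool" where
  "temporal_query Q \<longleftrightarrow> program (snd Q) \<and> fst Q \<in> preds_of (snd Q) \<and> pidb (fst Q) \<and> ptemp (fst Q)"

definition answers :: "query \<Rightarrow> gatom set \<Rightarrow> int \<Rightarrow> nat list set" where
  "answers Q D \<tau> = {os. entails (snd Q) D (GAtom (fst Q) os (Some \<tau>))}"

definition dataset :: "gatom set \<Rightarrow> bool" where
  "dataset D \<longleftrightarrow> finite D \<and> (\<forall>g\<in>D. wf_gatom g \<and> \<not> pidb (gpred g))"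

definition restrict_after :: "gatom set \<Rightarrow> int \<Rightarrow> gatom set" where
  "restrict_after D \<tau> = {g\<in>D. gtime g = None \<or> (\<exists>t. gtime g = Some t \<and> t > \<tau>)}"

definition history :: "int \<Rightarrow> gatom set \<Rightarrow> bool" where
  "history \<tau>in D \<longleftrightarrow> dataset D \<and> (\<forall>g\<in>D. \<forall>t. gtime g = Some t \<longrightarrow> t \<le> \<tau>in)"

definition update :: "int \<Rightarrow> gatom set \<Rightarrow> bool" where
  "update \<tau>in U \<longleftrightarrow> dataset U \<and> (\<forall>g\<in>U. \<exists>t. gtime g = Some t \<and> t > \<tau>in)"

definition forget :: "query \<Rightarrow> gatom set \<Rightarrow> int \<Rightarrow> int \<Rightarrow> int \<Rightarrow> bool" where
  "forget Q D \<tau>in \<tau>out \<tau>mem \<longleftrightarrow>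
     (\<forall>U \<tau>. update \<tau>in U \<and> \<tau> \<ge> \<tau>out \<longrightarrow>
        answers Q (D \<union> U) \<tau> = answers Q (restrict_after D \<tau>mem \<union> U) \<tau>)"

definition dep :: "rule set \<Rightarrow> (pred \<times> pred) set" where
  "dep \<Pi> = {(apred (head r), apred a) | r a. r \<in> \<Pi> \<and> a \<in> set (body r)}"

definition nonrecursive :: "rule set \<Rightarrow> bool" where
  "nonrecursive \<Pi> \<longleftrightarrow> acyclic (dep \<Pi>)"

definition connected_rule :: "rule \<Rightarrow> bool" where
  "connected_rule r \<longleftrightarrow> card (rule_tvars r) \<le> 1 \<and> body_tvars r \<subseteq> tvars (head r)"

definition connected :: "rule set \<Rightarrow> bool" where
  "connected \<Pi> \<longleftrightarrow> (\<forall>r\<in>\<Pi>. connected_rule r)"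

fun no_tpoint :: "tterm \<Rightarrow> bool" where
  "no_tpoint (TPoint k) = False" | "no_tpoint _ = True"

definition atom_no_tpoint :: "atom \<Rightarrow> bool" where
  "atom_no_tpoint a \<longleftrightarrow> (\<forall>t. atime a = Some t \<longrightarrow> no_tpoint t)"

definition no_time_points :: "rule set \<Rightarrow> bool" where
  "no_time_points \<Pi> \<longleftrightarrow> (\<forall>r\<in>\<Pi>. atom_no_tpoint (head r) \<and> (\<forall>a\<in>set (body r). atom_no_tpoint a))"

text \<open>States and tape symbols are natural numbers; symbol 0 is the blank.
 A machine has finitely many states (< tm_nst) and symbols (< tm_nsym).\<close>
record tm =
  tm_delta :: "nat \<Rightarrow> nat \<Rightarrow> nat \<times> nat \<times> int"
  tm_start :: nat
  tm_acc :: nat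
  tm_rej :: nat
  tm_nst :: nat
  tm_nsym :: nat

definition wf_tm :: "tm \<Rightarrow> bool" where
  "wf_tm M \<longleftrightarrow> tm_start M < tm_nst M \<and> tm_acc M < tm_nst M \<and> tm_rej M < tm_nst M
     \<and> tm_acc M \<noteq> tm_rej M
     \<and> (\<forall>q < tm_nst M. \<forall>s < tm_nsym M. case tm_delta M q s of (q', s', d) \<Rightarrow>
           q' < tm_nst M \<and> s' < tm_nsym M \<and> d \<in> {-1, 0, 1})"

type_synonym conf = "nat \<times> (int \<Rightarrow> nat) \<times> int"

definition tm_step :: "tm \<Rightarrow> conf \<Rightarrow> conf" where
  "tm_step M c = (case c of (q, tape, p) \<Rightarrow>
     if q = tm_acc M \<or> q = tm_rej M then c
     else (case tm_delta M q (tape p) of (q', s', d) \<Rightarrow> (q', tape(p := s'), p + d)))"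

definition tm_init :: "tm \<Rightarrow> nat list \<Rightarrow> conf" where
  "tm_init M w = (tm_start M, (\<lambda>i. if 0 \<le> i \<and> nat i < length w then w ! nat i else 0), 0)"

definition decides_within :: "tm \<Rightarrow> nat list \<Rightarrow> nat \<Rightarrow> bool \<Rightarrow> bool" where
  "decides_within M w T P \<longleftrightarrow> (\<exists>n \<le> T. let q = fst ((tm_step M ^^ n) (tm_init M w)) in
      (q = tm_acc M \<or> q = tm_rej M) \<and> (q = tm_acc M \<longleftrightarrow> P))"

text \<open>Symbols: 1,2 = bits; 3 = separator; 4 = unary tick; 5 = minus sign;
 6 = object tag; 7 = time tag; 8 = end of fact.\<close>

fun bin :: "nat \<Rightarrow> nat list" where
  "bin n = (if n = 0 then [] else (if even n then 1 else 2) # bin (n div 2))"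

definition enc_int :: "int \<Rightarrow> nat list" where
  "enc_int i = (if i < 0 then [5] else []) @ replicate (nat \<bar>i\<bar>) 4"

definition enc_bool :: "bool \<Rightarrow> nat list" where
  "enc_bool b = [if b then 2 else 1]"

definition enc_pred :: "pred \<Rightarrow> nat list" where
  "enc_pred p = bin (pname p) @ [3] @ enc_bool (pidb p) @ [3] @ bin (parity p) @ [3]
                 @ enc_bool (ptemp p) @ [3]"

definition enc_fact :: "gatom \<Rightarrow> nat list" where
  "enc_fact g = enc_pred (gpred g) @ concat (map (\<lambda>c. 6 # bin c @ [3]) (gobjs g))
     @ (case gtime g of None \<Rightarrow> [] | Some t \<Rightarrow> 7 # enc_int t @ [3]) @ [8]"

definition enc_instance :: "gatom list \<Rightarrow> int \<Rightarrow> int \<Rightarrow> int \<Rightarrow> nat list" where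
  "enc_instance ds \<tau>in \<tau>out \<tau>mem = enc_int \<tau>in @ [3] @ enc_int \<tau>out @ [3] @ enc_int \<tau>mem @ [3]
     @ concat (map enc_fact ds)"

end

theory Submission
  imports Defs "HOL-Library.Nat_Bijection"
begin

text \<open>
  A violation of forgetting is a tuple derived from \<open>D \<union> U\<close> but not from the restricted history.
  Since the program is nonrecursive, a derivation of the query atom has bounded depth and uses
  boundedly many facts, and since it is connected and free of time points, the times of these facts
  are within a constant of the query time. One of them is a forgotten fact, so the query time
  is within a constant of a time mentioned in \<open>D\<close>; by genericity the objects of \<open>U\<close> may be
  taken among those of \<open>D\<close>, the constants of the program and boundedly many fresh ones.
  Hence a violation is a first-order property of the input word with addition on positions: objects
  are positions of object tags, time points are positions of unary numerals plus constant offsets,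
  and derivability unfolds along the bounded depth. A fixed number of heads on the input
  decides such a property by nested scans, and a single tape simulates the heads by marks on its
  cells.
\<close>

section \<open>Structured tape programs\<close>

text \<open>The obstacle is that a violation ranges over infinitely many updates, while the machine
  can only sweep over the cells of its input: each quantifier has to become one over positions, and
  then costs a factor of roughly the length of the word. Fresh objects are the hard case, since they
  do not occur in the input. The machine therefore first appends a fixed word \<open>suf\<close>
  that lists the program constants and writes each fresh object as a block of the digit 9, which no
  binary code contains; derivations only care which tokens are equal. All constants come from the
  query: a depth \<open>N\<close> from the dependency order, a branching \<open>b\<close>, a time
  shift \<open>K\<close> per rule, an arity \<open>A\<close>. A derivation then has at most
  \<open>b ^ N\<close> leaves, so its update facts mention at most \<open>b ^ N * A\<close> objects,
  and its times stay within \<open>K * N\<close> of the root. That leaves finitely many shapes of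
  updates, with only the objects and one reference numeral to be guessed by heads. The restricted
  history is never written down: one formula for membership in the data is used twice, the second
  time with an extra comparison against the forgetting time.\<close>

datatype tprog =
    Act "nat \<Rightarrow> nat" int
  | Seq tprog tprog (infixr ";;" 60)
  | Cond "nat \<Rightarrow> bool" tprog tprog
  | Loop "nat \<Rightarrow> bool" tprog

type_synonym tconf = "(int \<Rightarrow> nat) \<times> int"

text \<open>The number counts machine steps. A test is a machine state of its own, which writes back
  the symbol it reads and does not move, so each test costs 1.\<close>

inductive exec :: "tprog \<Rightarrow> tconf \<Rightarrow> nat \<Rightarrow> tconf \<Rightarrow> bool" where
  exec_Act: "exec (Act f d) (T, p) 1 (T(p := f (T p)), p + d)"
| exec_Seq: "exec a c t c' \<Longrightarrow> exec b c' t' c'' \<Longrightarrow> exec (a ;; b) c (t + t') c''"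
| exec_CondT: "P (T p) \<Longrightarrow> exec a (T, p) t c' \<Longrightarrow> exec (Cond P a b) (T, p) (1 + t) c'"
| exec_CondF: "\<not> P (T p) \<Longrightarrow> exec b (T, p) t c' \<Longrightarrow> exec (Cond P a b) (T, p) (1 + t) c'"
| exec_LoopF: "\<not> P (T p) \<Longrightarrow> exec (Loop P a) (T, p) 1 (T, p)"
| exec_LoopT: "P (T p) \<Longrightarrow> exec a (T, p) t c' \<Longrightarrow> exec (Loop P a) c' t' c''
    \<Longrightarrow> exec (Loop P a) (T, p) (1 + t + t') c''"

fun psize :: "tprog \<Rightarrow> nat" where
  "psize (Act f d) = 1"
| "psize (a ;; b) = psize a + psize b"
| "psize (Cond P a b) = 1 + psize a + psize b"
| "psize (Loop P a) = 1 + psize a"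

lemma psize_pos: "0 < psize p"
  by (induction p) auto

text \<open>The block of a program occupies the states from \<open>s\<close> to
  \<open>s + psize p - 1\<close> and is left through \<open>x\<close>. A loop is the block whose
  body has the test state \<open>s\<close> as its exit.\<close>

fun code :: "tprog \<Rightarrow> nat \<Rightarrow> nat \<Rightarrow> nat \<Rightarrow> nat \<Rightarrow> nat \<times> nat \<times> int" where
  "code (Act f d) s x q a = (x, f a, d)"
| "code (A ;; B) s x q a =
    (if q < s + psize A then code A s (s + psize A) q a else code B (s + psize A) x q a)"
| "code (Cond P A B) s x q a =
    (if q = s then (if P a then s + 1 else s + 1 + psize A, a, 0)
     else if q < s + 1 + psize A then code A (s + 1) x q a else code B (s + 1 + psize A) x q a)"
| "code (Loop P A) s x q a =
    (if q = s then (if P a then s + 1 else x, a, 0) else code A (s + 1) s q a)"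

fun bounded :: "nat \<Rightarrow> tprog \<Rightarrow> bool" where
  "bounded N (Act f d) \<longleftrightarrow> (\<forall>a<N. f a < N) \<and> d \<in> {-1, 0, 1}"
| "bounded N (A ;; B) \<longleftrightarrow> bounded N A \<and> bounded N B"
| "bounded N (Cond P A B) \<longleftrightarrow> bounded N A \<and> bounded N B"
| "bounded N (Loop P A) \<longleftrightarrow> bounded N A"

lemma code_bounded:
  assumes "bounded N p" "s \<le> q" "q < s + psize p" "a < N" "code p s x q a = (q', a', d)"
  shows "(q' = x \<or> s \<le> q' \<and> q' < s + psize p) \<and> a' < N \<and> d \<in> {-1, 0, 1}"
  using assms
proof (induction p arbitrary: s x q' a' d)
  case (Act f d)
  then show ?case by auto
next
  case (Seq A B)
  show ?case
  proof (cases "q < s + psize A")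
    case True
    with Seq.prems Seq.IH(1)[of s "s + psize A" q' a' d] psize_pos[of B] show ?thesis by auto
  next
    case False
    with Seq.prems Seq.IH(2)[of "s + psize A" x q' a' d] show ?thesis by auto
  qed
next
  case (Cond P A B)
  consider "q = s" | "q \<noteq> s" "q < s + 1 + psize A" | "q \<noteq> s" "\<not> q < s + 1 + psize A" by blast
  then show ?case
  proof cases
    case 1
    with Cond.prems psize_pos[of A] psize_pos[of B] show ?thesis by (auto split: if_splits)
  next
    case 2
    with Cond.prems Cond.IH(1)[of "s + 1" x q' a' d] show ?thesis by auto
  next
    case 3
    with Cond.prems Cond.IH(2)[of "s + 1 + psize A" x q' a' d] show ?thesis by auto
  qed
next
  case (Loop P A)
  show ?case
  proof (cases "q = s")
    case True
    with Loop.prems psize_pos[of A] show ?thesis by (auto split: if_splits)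
  next
    case False
    with Loop.prems Loop.IH[of "s + 1" s q' a' d] show ?thesis by auto
  qed
qed

lemma tm_step_delta:
  assumes "q \<noteq> tm_acc M" "q \<noteq> tm_rej M" "tm_delta M q (T p) = (q', a, d)"
  shows "tm_step M (q, (T, p)) = (q', (T(p := a), p + d))"
  using assms by (simp add: tm_step_def)

text \<open>The machine is constrained on the states of the block only, so the induction can pass to
  sub-blocks of one fixed machine. These states must not be halting, because \<open>tm_step\<close>
  freezes a halting configuration.\<close>

lemma code_sound:
  assumes "exec p c t c'"
    and "\<And>q a. s \<le> q \<Longrightarrow> q < s + psize p \<Longrightarrow> tm_delta M q a = code p s x q a"
    and "\<And>q. s \<le> q \<Longrightarrow> q < s + psize p \<Longrightarrow> q \<noteq> tm_acc M \<and> q \<noteq> tm_rej M"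
  shows "(tm_step M ^^ t) (s, c) = (x, c')"
  using assms
proof (induction arbitrary: s x rule: exec.induct)
  case (exec_Act f d T p)
  then show ?case by (simp add: tm_step_delta)
next
  case (exec_Seq a c t c' b t' c'')
  have "(tm_step M ^^ t) (s, c) = (s + psize a, c')"
    using exec_Seq.prems by (intro exec_Seq.IH(1)) auto
  moreover have "(tm_step M ^^ t') (s + psize a, c') = (x, c'')"
    using exec_Seq.prems by (intro exec_Seq.IH(2)) auto
  ultimately show ?case by (simp add: add.commute[of t] funpow_add)
next
  case (exec_CondT P T p a t c' b)
  have "tm_step M (s, (T, p)) = (s + 1, (T(p := T p), p + 0))"
    using exec_CondT.prems exec_CondT.hyps by (intro tm_step_delta) auto
  moreover have "(tm_step M ^^ t) (s + 1, (T, p)) = (x, c')"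
    using exec_CondT.prems by (intro exec_CondT.IH) auto
  ultimately show ?case by (simp add: funpow_swap1)
next
  case (exec_CondF P T p b t c' a)
  have "tm_step M (s, (T, p)) = (s + 1 + psize a, (T(p := T p), p + 0))"
    using exec_CondF.prems exec_CondF.hyps by (intro tm_step_delta) auto
  moreover have "(tm_step M ^^ t) (s + 1 + psize a, (T, p)) = (x, c')"
    using exec_CondF.prems by (intro exec_CondF.IH) auto
  ultimately show ?case by (simp add: funpow_swap1)
next
  case (exec_LoopF P T p a)
  then show ?case by (simp add: tm_step_delta)
next
  case (exec_LoopT P T p a t c' t' c'')
  have "tm_step M (s, (T, p)) = (s + 1, (T(p := T p), p + 0))"
    using exec_LoopT.prems exec_LoopT.hyps by (intro tm_step_delta) auto
  moreover have "(tm_step M ^^ t) (s + 1, (T, p)) = (s, c')"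
    using exec_LoopT.prems by (intro exec_LoopT.IH(1)) auto
  moreover have "(tm_step M ^^ t') (s, c') = (x, c'')"
    using exec_LoopT.prems by (intro exec_LoopT.IH(2)) auto
  ultimately show ?case by (simp add: add.commute[of t] funpow_add funpow_swap1)
qed

section \<open>Runs within a time budget\<close>

definition run :: "tprog \<Rightarrow> tconf \<Rightarrow> nat \<Rightarrow> tconf \<Rightarrow> bool" where
  "run p c B c' \<longleftrightarrow> (\<exists>t\<le>B. exec p c t c')"

lemma run_mono: "run p c B c' \<Longrightarrow> B \<le> B' \<Longrightarrow> run p c B' c'"
  unfolding run_def by (meson le_trans)

lemma run_Act: "T' = T(p := f (T p)) \<Longrightarrow> p' = p + d \<Longrightarrow> 1 \<le> B \<Longrightarrow> run (Act f d) (T, p) B (T', p')"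
  unfolding run_def using exec_Act by blast

lemma run_Seq: "run a c B c' \<Longrightarrow> run b c' B' c'' \<Longrightarrow> B + B' \<le> C \<Longrightarrow> run (a ;; b) c C c''"
  unfolding run_def by (meson add_mono exec_Seq le_trans)

lemma run_CondT: "P (T p) \<Longrightarrow> run a (T, p) B c' \<Longrightarrow> 1 + B \<le> C \<Longrightarrow> run (Cond P a b) (T, p) C c'"
  unfolding run_def by (meson add_left_mono exec_CondT le_trans)

lemma run_CondF: "\<not> P (T p) \<Longrightarrow> run b (T, p) B c' \<Longrightarrow> 1 + B \<le> C \<Longrightarrow> run (Cond P a b) (T, p) C c'"
  unfolding run_def by (meson add_left_mono exec_CondF le_trans)

lemma run_LoopF: "\<not> P (T p) \<Longrightarrow> 1 \<le> B \<Longrightarrow> run (Loop P a) (T, p) B (T, p)"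
  unfolding run_def using exec_LoopF by blast

lemma run_LoopT:
  assumes "P (T p)" "run a (T, p) B c'" "run (Loop P a) c' B' c''" "1 + B + B' \<le> C"
  shows "run (Loop P a) (T, p) C c''"
proof -
  obtain t t' where t: "t \<le> B" "exec a (T, p) t c'" "t' \<le> B'" "exec (Loop P a) c' t' c''"
    using assms(2,3) unfolding run_def by blast
  from exec_LoopT[of P, OF assms(1) t(2,4)] t(1,3) assms(4) show ?thesis
    unfolding run_def by (intro exI[of _ "1 + t + t'"]) simp
qed

text \<open>Two steps per cell, for test and move, and one for the last failing test.\<close>

lemma scan_right:
  assumes "p \<le> q" "\<And>i. p \<le> i \<Longrightarrow> i < q \<Longrightarrow> P (T i)" "\<not> P (T q)" "2 * nat (q - p) + 1 \<le> B"
  shows "run (Loop P (Act id 1)) (T, p) B (T, q)"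
  using assms
proof (induction "nat (q - p)" arbitrary: p B)
  case 0
  then show ?case by (simp add: run_LoopF)
next
  case (Suc k)
  have "run (Loop P (Act id 1)) (T, p + 1) (2 * nat (q - (p + 1)) + 1) (T, q)"
    using Suc.hyps(2) Suc.prems by (intro Suc.hyps(1)) auto
  moreover have "run (Act id 1) (T, p) 1 (T, p + 1)" by (rule run_Act) auto
  moreover have "P (T p)" using Suc.hyps(2) Suc.prems by auto
  ultimately show ?case
    using Suc.hyps(2) Suc.prems by (auto intro!: run_LoopT)
qed

lemma scan_left:
  assumes "q \<le> p" "\<And>i. q < i \<Longrightarrow> i \<le> p \<Longrightarrow> P (T i)" "\<not> P (T q)" "2 * nat (p - q) + 1 \<le> B"
  shows "run (Loop P (Act id (-1))) (T, p) B (T, q)"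
  using assms
proof (induction "nat (p - q)" arbitrary: p B)
  case 0
  then show ?case by (simp add: run_LoopF)
next
  case (Suc k)
  have "run (Loop P (Act id (-1))) (T, p - 1) (2 * nat ((p - 1) - q) + 1) (T, q)"
    using Suc.hyps(2) Suc.prems by (intro Suc.hyps(1)) auto
  moreover have "run (Act id (-1)) (T, p) 1 (T, p - 1)" by (rule run_Act) auto
  moreover have "P (T p)" using Suc.hyps(2) Suc.prems by auto
  ultimately show ?case
    using Suc.hyps(2) Suc.prems by (auto intro!: run_LoopT)
qed

text \<open>Symbol 10 in the cell left of the input is the answer yes.\<close>

definition machine :: "nat \<Rightarrow> tprog \<Rightarrow> tm" where
  "machine N p = \<lparr>tm_delta = (\<lambda>q a. if q < psize p then code p 0 (psize p) q a
       else (if q = psize p \<and> a = 10 then psize p + 1 else psize p + 2, a, 0)),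
     tm_start = 0, tm_acc = psize p + 1, tm_rej = psize p + 2, tm_nst = psize p + 3, tm_nsym = N\<rparr>"

lemma wf_machine: "bounded N p \<Longrightarrow> wf_tm (machine N p)"
proof -
  assume p: "bounded N p"
  have *: "q' < psize p + 3 \<and> a' < N \<and> d \<in> {-1, 0, 1}"
    if q: "a < N" "tm_delta (machine N p) q a = (q', a', d)" for q a q' a' d
  proof (cases "q < psize p")
    case True
    then have "code p 0 (psize p) q a = (q', a', d)" using q by (simp add: machine_def)
    from code_bounded[OF p _ _ q(1) this] True show ?thesis by auto
  next
    case False
    then show ?thesis using q by (auto simp: machine_def)
  qed
  have "case tm_delta (machine N p) q a of (q', a', d) \<Rightarrow>
      q' < tm_nst (machine N p) \<and> a' < tm_nsym (machine N p) \<and> d \<in> {-1, 0, 1}" if "a < N" for q a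
    using *[OF that] by (cases "tm_delta (machine N p) q a") (simp add: machine_def)
  then show ?thesis
    unfolding wf_tm_def by (simp add: machine_def)
qed

text \<open>The additional step is taken in state \<open>psize p\<close>, which reads the flag and
  turns it into acceptance or rejection.\<close>

lemma machine_decides:
  assumes "run p (snd (tm_init (machine N p) w)) B (T, -1)" "T (-1) = 10 \<longleftrightarrow> P"
  shows "decides_within (machine N p) w (B + 1) P"
proof -
  let ?M = "machine N p"
  obtain t where t: "t \<le> B" "exec p (snd (tm_init ?M w)) t (T, -1)"
    using assms(1) unfolding run_def by blast
  have init: "tm_init ?M w = (0, snd (tm_init ?M w))"
    by (simp add: tm_init_def machine_def)
  have "(tm_step ?M ^^ t) (0, snd (tm_init ?M w)) = (psize p, (T, -1))"
    by (rule code_sound[OF t(2)]) (auto simp: machine_def)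
  then have *: "(tm_step ?M ^^ t) (tm_init ?M w) = (psize p, (T, -1))"
    using init by simp
  have "(tm_step ?M ^^ Suc t) (tm_init ?M w) = (if P then psize p + 1 else psize p + 2, (T, -1))"
    using assms(2) unfolding funpow.simps o_apply * by (auto simp: tm_step_def machine_def)
  then show ?thesis
    unfolding decides_within_def using t(1)
    by (intro exI[of _ "Suc t"]) (auto simp: Let_def machine_def)
qed

text \<open>A symbol is \<open>b + 10 * set_encode A\<close> for a base symbol \<open>b < 10\<close> and the set \<open>A\<close> of the heads
  that stand on the cell.\<close>

definition cell :: "nat \<Rightarrow> nat set \<Rightarrow> nat" where
  "cell b A = b + 10 * set_encode A"

definition marked :: "nat \<Rightarrow> nat \<Rightarrow> bool" where
  "marked j s \<longleftrightarrow> j \<in> set_decode (s div 10)"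

definition mark :: "nat \<Rightarrow> nat \<Rightarrow> nat" where
  "mark j s = cell (s mod 10) (insert j (set_decode (s div 10)))"

definition unmark :: "nat \<Rightarrow> nat \<Rightarrow> nat" where
  "unmark j s = cell (s mod 10) (set_decode (s div 10) - {j})"

lemma cell_decode [simp]:
  "b < 10 \<Longrightarrow> cell b A mod 10 = b"
  "b < 10 \<Longrightarrow> finite A \<Longrightarrow> set_decode (cell b A div 10) = A"
  by (simp_all add: cell_def)

lemma cell_marks:
  "b < 10 \<Longrightarrow> finite A \<Longrightarrow> marked j (cell b A) \<longleftrightarrow> j \<in> A"
  "b < 10 \<Longrightarrow> finite A \<Longrightarrow> mark j (cell b A) = cell b (insert j A)"
  "b < 10 \<Longrightarrow> finite A \<Longrightarrow> unmark j (cell b A) = cell b (A - {j})"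
  by (simp_all add: marked_def mark_def unmark_def)

lemma set_encode_less: "A \<subseteq> {..<K} \<Longrightarrow> set_encode A < 2 ^ K"
proof -
  assume A: "A \<subseteq> {..<K}"
  have "set_encode A \<le> (\<Sum>j<K. 2 ^ j)"
    unfolding set_encode_def by (rule sum_mono2) (use A in auto)
  also have "\<dots> < 2 ^ K" by (induction K) auto
  finally show ?thesis .
qed

lemma set_decode_subset: "x < 2 ^ K \<Longrightarrow> set_decode x \<subseteq> {..<K}"
proof
  fix n assume x: "x < 2 ^ K" and "n \<in> set_decode x"
  then have "x div 2 ^ n \<noteq> 0" by (auto simp: set_decode_def intro: odd_pos)
  then have "2 ^ n \<le> x" by (simp add: div_eq_0_iff not_less)
  with x have "(2::nat) ^ n < 2 ^ K" by linarith
  then show "n \<in> {..<K}" by simp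
qed

text \<open>\<open>K\<close> heads lead to the finite alphabet below \<open>10 * 2 ^ K\<close>; mark
  and unmark stay inside it.\<close>

lemma cell_less: "b < 10 \<Longrightarrow> A \<subseteq> {..<K} \<Longrightarrow> cell b A < 10 * 2 ^ K"
  using set_encode_less[of A K] by (simp add: cell_def)

lemma bounded_mark: "j < K \<Longrightarrow> s < 10 * 2 ^ K \<Longrightarrow> mark j s < 10 * 2 ^ K"
  unfolding mark_def using set_decode_subset[of "s div 10" K]
  by (intro cell_less) (auto simp: less_mult_imp_div_less)

lemma bounded_unmark: "s < 10 * 2 ^ K \<Longrightarrow> unmark j s < 10 * 2 ^ K"
  unfolding unmark_def using set_decode_subset[of "s div 10" K]
  by (intro cell_less) (auto simp: less_mult_imp_div_less)

text \<open>Reading past the end yields the blank 0, which \<open>word\<close> excludes from the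
  input, so the end of the input is visible.\<close>

definition sy :: "nat list \<Rightarrow> nat \<Rightarrow> nat" where
  "sy w p = (if p < length w then w ! p else 0)"

definition word :: "nat list \<Rightarrow> bool" where
  "word w \<longleftrightarrow> (\<forall>a\<in>set w. 0 < a \<and> a < 10)"

lemma sy_word: "word w \<Longrightarrow> sy w p < 10" "word w \<Longrightarrow> sy w p = 0 \<longleftrightarrow> length w \<le> p"
  by (auto simp: sy_def word_def)

text \<open>The cells \<open>0..length w\<close> carry the input and one mark per head; head \<open>j\<close> stands on cell
  \<open>e j\<close>, where \<open>Suc (length w)\<close> encodes an absent mark. The cell \<open>-1\<close> holds the flag \<open>v\<close>.\<close>

definition tape :: "nat list \<Rightarrow> nat \<Rightarrow> (nat \<Rightarrow> nat) \<Rightarrow> nat \<Rightarrow> int \<Rightarrow> nat" where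
  "tape w K e v i = (if i = -1 then v
     else if 0 \<le> i \<and> i \<le> int (length w) then cell (sy w (nat i)) {j. j < K \<and> e j = nat i} else 0)"

abbreviation nb :: "nat \<Rightarrow> bool" where "nb s \<equiv> s mod 10 \<noteq> 0"

text \<open>The flag is always a multiple of 10 and hence looks blank, so the scan to the left stops
  on cell -1. The first move is made blindly because the start may be the blank cell behind the
  input.\<close>

definition home :: tprog where
  "home = Act id (-1) ;; Loop nb (Act id (-1))"

text \<open>The first move leaves cell -1, where the flag values 10 and 20 would be misread as
  marks.\<close>

definition goto :: "nat \<Rightarrow> tprog" where
  "goto j = Act id 1 ;; Loop (\<lambda>s. \<not> marked j s) (Act id 1)"

context
  fixes w :: "nat list"
  assumes w: "word w"
begin

lemma tape_pos: "p \<le> length w \<Longrightarrow> tape w K e v (int p) = cell (sy w p) {j. j < K \<and> e j = p}"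
  by (simp add: tape_def)

lemma nb_tape: "p \<le> length w \<Longrightarrow> nb (tape w K e v (int p)) \<longleftrightarrow> p < length w"
  using sy_word[OF w] by (auto simp: tape_pos le_less)

lemma base_tape: "p \<le> length w \<Longrightarrow> tape w K e v (int p) mod 10 = sy w p"
  using sy_word[OF w] by (simp add: tape_pos)

lemma marked_tape: "p \<le> length w \<Longrightarrow> marked j (tape w K e v (int p)) \<longleftrightarrow> j < K \<and> e j = p"
  using sy_word[OF w] by (simp add: tape_pos cell_marks)

lemma unmark_tape:
  assumes "e j \<le> length w"
  shows "(tape w K e v)(int (e j) := unmark j (tape w K e v (int (e j))))
    = tape w K (e(j := Suc (length w))) v"
proof
  fix i
  have "{k. k < K \<and> e k = e j} - {j} = {k. k < K \<and> (k \<noteq> j \<longrightarrow> e k = e j) \<and> k \<noteq> j}" by auto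
  then show "((tape w K e v)(int (e j) := unmark j (tape w K e v (int (e j))))) i
    = tape w K (e(j := Suc (length w))) v i"
    using assms sy_word[OF w]
    by (auto simp: tape_def cell_marks intro!: arg_cong[where f = "cell _"])
qed

lemma mark_tape:
  assumes "e j = Suc (length w)" "p \<le> length w" "j < K"
  shows "(tape w K e v)(int p := mark j (tape w K e v (int p))) = tape w K (e(j := p)) v"
proof
  fix i
  show "((tape w K e v)(int p := mark j (tape w K e v (int p)))) i = tape w K (e(j := p)) v i"
    using assms sy_word[OF w]
    by (auto simp: tape_def cell_marks intro!: arg_cong[where f = "cell _"])
qed

lemma run_home:
  assumes "p \<le> length w" "v mod 10 = 0" "2 * length w + 4 \<le> B"
  shows "run home (tape w K e v, int p) B (tape w K e v, -1)"
proof -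
  have "run (Act id (-1)) (tape w K e v, int p) 1 (tape w K e v, int p - 1)"
    by (rule run_Act) auto
  moreover have "run (Loop nb (Act id (-1))) (tape w K e v, int p - 1) (2 * length w + 3) (tape w K e v, -1)"
  proof (rule scan_left)
    fix i assume i: "-1 < i" "i \<le> int p - 1"
    then obtain k where "i = int k" using zero_le_imp_eq_int[of i] by auto
    with i assms(1) nb_tape[of k] show "nb (tape w K e v i)" by auto
  qed (use assms in \<open>auto simp: tape_def\<close>)
  ultimately show ?thesis
    unfolding home_def using assms(3) by (auto intro: run_Seq)
qed

lemma run_goto:
  assumes "e j \<le> length w" "j < K" "2 * length w + 4 \<le> B"
  shows "run (goto j) (tape w K e v, -1) B (tape w K e v, int (e j))"
proof -
  have "run (Act id 1) (tape w K e v, -1) 1 (tape w K e v, 0)"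
    by (rule run_Act) auto
  moreover have "run (Loop (\<lambda>s. \<not> marked j s) (Act id 1)) (tape w K e v, 0) (2 * length w + 3)
      (tape w K e v, int (e j))"
  proof (rule scan_right)
    fix i assume i: "0 \<le> i" "i < int (e j)"
    then obtain k where "i = int k" using zero_le_imp_eq_int[of i] by auto
    with i assms(1) marked_tape[of k] show "\<not> marked j (tape w K e v i)" by auto
  qed (use assms marked_tape[of "e j"] in auto)
  ultimately show ?thesis
    unfolding goto_def using assms(3) by (auto intro: run_Seq)
qed

end

lemma bounded_home: "bounded N home"
  by (simp add: home_def)

lemma bounded_goto: "bounded N (goto j)"
  by (simp add: goto_def)

section \<open>Resetting, advancing and copying a head\<close>

definition zero :: "nat \<Rightarrow> tprog" where
  "zero j = goto j ;; Act (unmark j) 0 ;; home ;; Act id 1 ;; Act (mark j) (-1)"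

definition inc :: "nat \<Rightarrow> tprog" where
  "inc j = goto j ;; Act (unmark j) 1 ;; Act (mark j) 0 ;; home"

text \<open>A position does not fit into the finite control, so \<open>b\<close> is walked from cell
  0 until it meets the mark of \<open>j\<close>. Each step returns home, which makes the cost
  quadratic.\<close>

definition copy :: "nat \<Rightarrow> nat \<Rightarrow> tprog" where
  "copy j b = zero b ;; goto b ;;
     Loop (\<lambda>s. \<not> marked j s) (home ;; inc b ;; goto b) ;; home"

lemma bounded_moves:
  assumes "j < K"
  shows "bounded (10 * 2 ^ K) (zero j)" "bounded (10 * 2 ^ K) (inc j)" "bounded (10 * 2 ^ K) (copy k j)"
  using assms by (auto simp: zero_def inc_def copy_def bounded_home bounded_goto bounded_mark bounded_unmark)

lemma run_zero:
  assumes w: "word w" and "e j \<le> length w" "j < K" "v mod 10 = 0" "4 * length w + 11 \<le> B"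
  shows "run (zero j) (tape w K e v, -1) B (tape w K (e(j := 0)) v, -1)"
proof -
  let ?e = "e(j := Suc (length w))"
  have 1: "run (goto j) (tape w K e v, -1) (2 * length w + 4) (tape w K e v, int (e j))"
    using assms by (intro run_goto) auto
  have 2: "run (Act (unmark j) 0) (tape w K e v, int (e j)) 1 (tape w K ?e v, int (e j))"
    using assms unmark_tape[OF w, of e j K v] by (intro run_Act) auto
  have 3: "run home (tape w K ?e v, int (e j)) (2 * length w + 4) (tape w K ?e v, -1)"
    using assms by (intro run_home) auto
  have 4: "run (Act id 1) (tape w K ?e v, -1) 1 (tape w K ?e v, 0)"
    by (rule run_Act) auto
  have 5: "run (Act (mark j) (-1)) (tape w K ?e v, 0) 1 (tape w K (e(j := 0)) v, -1)"
    using assms mark_tape[OF w, of ?e j 0 K v] by (intro run_Act) auto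
  show ?thesis
    unfolding zero_def using assms(5)
    by (auto intro!: run_Seq[OF 1] run_Seq[OF 2] run_Seq[OF 3] run_Seq[OF 4 5])
qed

lemma run_inc:
  assumes w: "word w" and "e j < length w" "j < K" "v mod 10 = 0" "4 * length w + 11 \<le> B"
  shows "run (inc j) (tape w K e v, -1) B (tape w K (e(j := Suc (e j))) v, -1)"
proof -
  let ?e = "e(j := Suc (length w))"
  have 1: "run (goto j) (tape w K e v, -1) (2 * length w + 4) (tape w K e v, int (e j))"
    using assms by (intro run_goto) auto
  have 2: "run (Act (unmark j) 1) (tape w K e v, int (e j)) 1 (tape w K ?e v, int (Suc (e j)))"
    using assms unmark_tape[OF w, of e j K v] by (intro run_Act) auto
  have 3: "run (Act (mark j) 0) (tape w K ?e v, int (Suc (e j))) 1 (tape w K (e(j := Suc (e j))) v, int (Suc (e j)))"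
    using assms mark_tape[OF w, of ?e j "Suc (e j)" K v] by (intro run_Act) auto
  have 4: "run home (tape w K (e(j := Suc (e j))) v, int (Suc (e j))) (2 * length w + 4) (tape w K (e(j := Suc (e j))) v, -1)"
    using assms by (intro run_home) auto
  show ?thesis
    unfolding inc_def using assms(5)
    by (auto intro!: run_Seq[OF 1] run_Seq[OF 2] run_Seq[OF 3 4])
qed

lemma run_copy:
  assumes w: "word w" and e: "e b \<le> length w" "e j \<le> length w" and "b < K" "j < K" "b \<noteq> j"
    and v: "v mod 10 = 0" and B: "(length w + 2) * (8 * length w + 24) \<le> B"
  shows "run (copy j b) (tape w K e v, -1) B (tape w K (e(b := e j)) v, -1)"
proof -
  let ?n = "length w"
  let ?L = "Loop (\<lambda>s. \<not> marked j s) (home ;; inc b ;; goto b)"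
  \<comment> \<open>Tests are made on the cell \<open>l\<close> of \<open>b\<close>. Starting below
    \<open>j\<close>, \<open>b\<close> cannot jump over it.\<close>
  have loop: "run ?L (tape w K (e(b := l)) v, int l) ((e j - l) * (8 * ?n + 20) + 1) (tape w K (e(b := e j)) v, int (e j))"
    if "l \<le> e j" for l
    using that
  proof (induction "e j - l" arbitrary: l)
    case 0
    then have l: "l = e j" by simp
    have "marked j (tape w K (e(b := e j)) v (int (e j)))"
      unfolding marked_tape[OF w e(2)] using assms by simp
    then have "run ?L (tape w K (e(b := e j)) v, int (e j)) ((e j - l) * (8 * ?n + 20) + 1)
        (tape w K (e(b := e j)) v, int (e j))"
      by (rule_tac run_LoopF) simp_all
    then show ?case by (simp only: l)
  next
    case (Suc k)
    let ?e = "e(b := l)"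
    have 1: "run home (tape w K ?e v, int l) (2 * ?n + 4) (tape w K ?e v, -1)"
      using assms Suc.hyps Suc.prems by (intro run_home) auto
    have 2: "run (inc b) (tape w K ?e v, -1) (4 * ?n + 11) (tape w K (e(b := Suc l)) v, -1)"
      using run_inc[OF w, of ?e b K v "4 * ?n + 11"] assms Suc.hyps Suc.prems by auto
    have 3: "run (goto b) (tape w K (e(b := Suc l)) v, -1) (2 * ?n + 4) (tape w K (e(b := Suc l)) v, int (Suc l))"
      using run_goto[OF w, of "e(b := Suc l)" b K _ v] assms Suc.hyps Suc.prems by auto
    have body: "run (home ;; inc b ;; goto b) (tape w K ?e v, int l) (8 * ?n + 19) (tape w K (e(b := Suc l)) v, int (Suc l))"
      by (rule run_Seq[OF 1 run_Seq[OF 2 3]]) auto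
    have rest: "run ?L (tape w K (e(b := Suc l)) v, int (Suc l)) ((e j - Suc l) * (8 * ?n + 20) + 1) (tape w K (e(b := e j)) v, int (e j))"
      using Suc.hyps Suc.prems by (intro Suc.hyps(1)) auto
    have "\<not> marked j (tape w K ?e v (int l))"
      using assms Suc.hyps Suc.prems marked_tape[OF w, of l j K ?e v] by auto
    moreover have "e j - l = Suc (e j - Suc l)" using Suc.hyps by simp
    ultimately show ?case by (intro run_LoopT[OF _ body rest]) auto
  qed
  have 1: "run (zero b) (tape w K e v, -1) (4 * ?n + 11) (tape w K (e(b := 0)) v, -1)"
    using assms by (intro run_zero) auto
  have 2: "run (goto b) (tape w K (e(b := 0)) v, -1) (2 * ?n + 4) (tape w K (e(b := 0)) v, int 0)"
    using run_goto[OF w, of "e(b := 0)" b K _ v] assms by auto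
  have 3: "run ?L (tape w K (e(b := 0)) v, int 0) (?n * (8 * ?n + 20) + 1) (tape w K (e(b := e j)) v, int (e j))"
    using loop[of 0] e by (auto elim!: run_mono)
  have 4: "run home (tape w K (e(b := e j)) v, int (e j)) (2 * ?n + 4) (tape w K (e(b := e j)) v, -1)"
    using assms by (intro run_home) auto
  show ?thesis
    unfolding copy_def by (rule run_Seq[OF 1 run_Seq[OF 2 run_Seq[OF 3 4]]]) (use B in \<open>auto simp: algebra_simps\<close>)
qed

section \<open>First-order properties of words\<close>

text \<open>Polynomially bounded. The base \<open>n + 1\<close> is at least 1, so that exponents can
  be raised when bounds are added.\<close>

definition pb :: "(nat \<Rightarrow> nat) \<Rightarrow> bool" where
  "pb T \<longleftrightarrow> (\<exists>c k. \<forall>n. T n \<le> c * (n + 1) ^ k)"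

lemma pb_const [intro]: "pb (\<lambda>n. c)"
  unfolding pb_def by (intro exI[of _ c] exI[of _ 0]) simp

lemma pb_id [intro]: "pb (\<lambda>n. n)"
  unfolding pb_def by (intro exI[of _ 1] exI[of _ 1]) simp

lemma pb_mult [intro]: "pb T \<Longrightarrow> pb T' \<Longrightarrow> pb (\<lambda>n. T n * T' n)"
proof -
  assume "pb T" "pb T'"
  then obtain c k c' k' where *: "T n \<le> c * (n + 1) ^ k" "T' n \<le> c' * (n + 1) ^ k'" for n
    unfolding pb_def by blast
  have "T n * T' n \<le> (c * c') * (n + 1) ^ (k + k')" for n
    using mult_mono[OF *(1) *(2), of n n] by (simp add: power_add algebra_simps)
  then show ?thesis unfolding pb_def by blast
qed

lemma pb_add [intro]: "pb T \<Longrightarrow> pb T' \<Longrightarrow> pb (\<lambda>n. T n + T' n)"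
proof -
  assume "pb T" "pb T'"
  then obtain c k c' k' where *: "T n \<le> c * (n + 1) ^ k" "T' n \<le> c' * (n + 1) ^ k'" for n
    unfolding pb_def by blast
  have "T n + T' n \<le> (c + c') * (n + 1) ^ (k + k')" for n
  proof -
    have "T n \<le> c * (n + 1) ^ (k + k')" "T' n \<le> c' * (n + 1) ^ (k + k')"
      using *[of n] by (meson le_add1 le_add2 le_trans mult_le_mono2 power_increasing)+
    then show ?thesis by (simp add: algebra_simps)
  qed
  then show ?thesis unfolding pb_def by blast
qed

section \<open>Definable properties and the programs that decide them\<close>

definition agree :: "nat \<Rightarrow> (nat \<Rightarrow> nat) \<Rightarrow> (nat \<Rightarrow> nat) \<Rightarrow> bool" where
  "agree m e e' \<longleftrightarrow> (\<forall>j<m. e j = e' j)"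

lemma agree_trans: "agree m e e' \<Longrightarrow> agree m e' e'' \<Longrightarrow> agree m e e''"
  and agree_mono: "agree m' e e' \<Longrightarrow> m \<le> m' \<Longrightarrow> agree m e e'"
  and agree_refl [simp]: "agree m e e"
  by (auto simp: agree_def)

lemma flag_tape: "(tape w K e v)(-1 := u) = tape w K e u"
  by (auto simp: tape_def)

lemma tape_flag: "tape w K e v (-1) = v"
  by (simp add: tape_def)

lemma run_flag: "1 \<le> B \<Longrightarrow> f v = u \<Longrightarrow> run (Act f 0) (tape w K e v, -1) B (tape w K e u, -1)"
  by (rule run_Act) (auto simp: flag_tape tape_flag)

text \<open>Properties are indexed by instances and not by words, so that a semantic property such
  as forgetting can itself be called definable.\<close>

locale words =
  fixes wd :: "'i \<Rightarrow> nat list" and I :: "'i set"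
  assumes word: "i \<in> I \<Longrightarrow> word (wd i)"
begin

abbreviation len :: "'i \<Rightarrow> nat" where "len i \<equiv> length (wd i)"

definition ok :: "'i \<Rightarrow> (nat \<Rightarrow> nat) \<Rightarrow> bool" where
  "ok i e \<longleftrightarrow> (\<forall>j. e j \<le> len i)"

lemma ok_le: "ok i e \<Longrightarrow> e j \<le> len i"
  by (simp add: ok_def)

lemma ok_upd [intro]: "ok i e \<Longrightarrow> x \<le> len i \<Longrightarrow> ok i (e(j := x))"
  by (simp add: ok_def)

definition ind :: "nat \<Rightarrow> ('i \<Rightarrow> (nat \<Rightarrow> nat) \<Rightarrow> bool) \<Rightarrow> bool" where
  "ind m \<phi> \<longleftrightarrow> (\<forall>i\<in>I. \<forall>e e'. ok i e \<longrightarrow> ok i e' \<longrightarrow> agree m e e' \<longrightarrow> \<phi> i e = \<phi> i e')"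

text \<open>Allowing every \<open>K \<ge> K0\<close> lets programs with different numbers of heads
  share one tape. The program must return the first \<open>m\<close> heads unchanged, and it leaves
  its answer as the flag in cell -1.\<close>

definition decides :: "nat \<Rightarrow> tprog \<Rightarrow> (nat \<Rightarrow> nat) \<Rightarrow> nat \<Rightarrow> ('i \<Rightarrow> (nat \<Rightarrow> nat) \<Rightarrow> bool) \<Rightarrow> bool" where
  "decides m p T K0 \<phi> \<longleftrightarrow> (\<forall>K\<ge>K0. bounded (10 * 2 ^ K) p \<and>
     (\<forall>i\<in>I. \<forall>e v. ok i e \<longrightarrow> v \<in> {0, 10} \<longrightarrow>
        (\<exists>e'. ok i e' \<and> agree m e e' \<and>
           run p (tape (wd i) K e v, -1) (T (len i)) (tape (wd i) K e' (if \<phi> i e then 10 else 0), -1))))"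

text \<open>The heads from \<open>m\<close> on are scratch space of the deciding program.\<close>

definition Def :: "nat \<Rightarrow> ('i \<Rightarrow> (nat \<Rightarrow> nat) \<Rightarrow> bool) \<Rightarrow> bool" where
  "Def m \<phi> \<longleftrightarrow> ind m \<phi> \<and> (\<exists>p T K0. pb T \<and> decides m p T K0 \<phi>)"

lemma decidesD:
  assumes "decides m p T K0 \<phi>" "K0 \<le> K" "i \<in> I" "ok i e" "v \<in> {0, 10}"
  obtains e' where "ok i e'" "agree m e e'"
    "run p (tape (wd i) K e v, -1) (T (len i)) (tape (wd i) K e' (if \<phi> i e then 10 else 0), -1)"
  using assms unfolding decides_def by blast

text \<open>Equality is required only for instances in \<open>I\<close> with all heads on the word,
  where facts about the encoding are available. This is how semantic properties become
  definable.\<close>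

lemma Def_cong:
  assumes "Def m \<phi>" "\<And>i e. i \<in> I \<Longrightarrow> ok i e \<Longrightarrow> \<psi> i e = \<phi> i e"
  shows "Def m \<psi>"
proof -
  obtain p T K0 where T: "pb T" and p: "decides m p T K0 \<phi>" and ind: "ind m \<phi>"
    using assms(1) unfolding Def_def by blast
  have "decides m p T K0 \<psi>"
    unfolding decides_def
  proof (intro allI impI conjI ballI)
    fix K assume K: "K0 \<le> K"
    with p show "bounded (10 * 2 ^ K) p" by (simp add: decides_def)
    fix i e and v :: nat assume i: "i \<in> I" "ok i e" "v \<in> {0, 10}"
    from decidesD[OF p K i] show "\<exists>e'. ok i e' \<and> agree m e e' \<and>
        run p (tape (wd i) K e v, -1) (T (len i)) (tape (wd i) K e' (if \<psi> i e then 10 else 0), -1)"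
      unfolding assms(2)[OF i(1,2)] by blast
  qed
  moreover have "ind m \<psi>"
    unfolding ind_def
  proof (intro ballI allI impI)
    fix i e e' assume "i \<in> I" "ok i e" "ok i e'" "agree m e e'"
    then show "\<psi> i e = \<psi> i e'"
      using ind assms(2)[of i e] assms(2)[of i e'] unfolding ind_def by blast
  qed
  ultimately show ?thesis unfolding Def_def using T by blast
qed

lemma Def_not:
  assumes "Def m \<phi>"
  shows "Def m (\<lambda>i e. \<not> \<phi> i e)"
proof -
  obtain p T K0 where T: "pb T" and p: "decides m p T K0 \<phi>"
    using assms unfolding Def_def by blast
  let ?p = "p ;; Act (\<lambda>s. if s = 10 then 0 else 10) 0"
  have "decides m ?p (\<lambda>n. T n + 1) (max K0 1) (\<lambda>i e. \<not> \<phi> i e)"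
    unfolding decides_def
  proof (intro allI impI conjI ballI)
    fix K assume K: "max K0 1 \<le> K"
    \<comment> \<open>Then the alphabet has at least 20 symbols and contains the flag value
      10.\<close>
    have "(2::nat) ^ 1 \<le> 2 ^ K" using K by (intro power_increasing) auto
    then show "bounded (10 * 2 ^ K) ?p"
      using p K by (auto simp: decides_def)
    fix i e and v :: nat assume i: "i \<in> I" "ok i e" "v \<in> {0, 10}"
    from decidesD[OF p _ i, of K] K obtain e' where e': "ok i e'" "agree m e e'" and
      r: "run p (tape (wd i) K e v, -1) (T (len i)) (tape (wd i) K e' (if \<phi> i e then 10 else 0), -1)"
      by auto
    have "run ?p (tape (wd i) K e v, -1) (T (len i) + 1) (tape (wd i) K e' (if \<not> \<phi> i e then 10 else 0), -1)"
      by (rule run_Seq[OF r run_flag]) auto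
    with e' show "\<exists>e'. ok i e' \<and> agree m e e' \<and> run ?p (tape (wd i) K e v, -1) (T (len i) + 1)
        (tape (wd i) K e' (if \<not> \<phi> i e then 10 else 0), -1)" by blast
  qed
  moreover have "ind m (\<lambda>i e. \<not> \<phi> i e)" using assms unfolding Def_def ind_def by blast
  ultimately show ?thesis unfolding Def_def using T by blast
qed

lemma Def_conj:
  assumes "Def m \<phi>" "Def m \<psi>"
  shows "Def m (\<lambda>i e. \<phi> i e \<and> \<psi> i e)"
proof -
  obtain p T K0 where T: "pb T" and p: "decides m p T K0 \<phi>"
    using assms(1) unfolding Def_def by blast
  obtain q S K1 where S: "pb S" and q: "decides m q S K1 \<psi>"
    using assms(2) unfolding Def_def by blast
  let ?p = "p ;; Cond (\<lambda>s. s = 10) q (Act id 0)"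
  have "decides m ?p (\<lambda>n. T n + (S n + 2)) (max K0 K1) (\<lambda>i e. \<phi> i e \<and> \<psi> i e)"
    unfolding decides_def
  proof (intro allI impI conjI ballI)
    fix K assume K: "max K0 K1 \<le> K"
    then show "bounded (10 * 2 ^ K) ?p"
      using p q by (auto simp: decides_def)
    fix i e and v :: nat assume i: "i \<in> I" "ok i e" "v \<in> {0, 10}"
    from decidesD[OF p _ i, of K] K obtain e1 where e1: "ok i e1" "agree m e e1" and
      r: "run p (tape (wd i) K e v, -1) (T (len i)) (tape (wd i) K e1 (if \<phi> i e then 10 else 0), -1)"
      by auto
    show "\<exists>e'. ok i e' \<and> agree m e e' \<and> run ?p (tape (wd i) K e v, -1) (T (len i) + (S (len i) + 2))
        (tape (wd i) K e' (if \<phi> i e \<and> \<psi> i e then 10 else 0), -1)"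
    proof (cases "\<phi> i e")
      case True
      from decidesD[OF q _ i(1) e1(1), of K 10] K obtain e2 where e2: "ok i e2" "agree m e1 e2" and
        r2: "run q (tape (wd i) K e1 10, -1) (S (len i)) (tape (wd i) K e2 (if \<psi> i e1 then 10 else 0), -1)"
        by auto
      \<comment> \<open>The first program may have displaced its scratch heads, which
        \<open>\<psi>\<close> does not read.\<close>
      have "\<psi> i e1 = \<psi> i e" using assms(2) i(1,2) e1 unfolding Def_def ind_def by blast
      moreover have "run (Cond (\<lambda>s. s = 10) q (Act id 0)) (tape (wd i) K e1 10, -1) (S (len i) + 2)
          (tape (wd i) K e2 (if \<psi> i e1 then 10 else 0), -1)"
        by (rule run_CondT[OF _ r2]) (auto simp: tape_flag)
      ultimately have "run ?p (tape (wd i) K e v, -1) (T (len i) + (S (len i) + 2))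
          (tape (wd i) K e2 (if \<psi> i e then 10 else 0), -1)"
        using True r by (auto intro: run_Seq)
      with True e1 e2 agree_trans[OF e1(2) e2(2)] show ?thesis by auto
    next
      case False
      have "run (Cond (\<lambda>s. s = 10) q (Act id 0)) (tape (wd i) K e1 0, -1) (S (len i) + 2) (tape (wd i) K e1 0, -1)"
        by (rule run_CondF[OF _ run_flag[OF order.refl]]) (auto simp: tape_flag)
      then have "run ?p (tape (wd i) K e v, -1) (T (len i) + (S (len i) + 2)) (tape (wd i) K e1 0, -1)"
        using False r by (auto intro: run_Seq)
      with False e1 show ?thesis by auto
    qed
  qed
  moreover have "ind m (\<lambda>i e. \<phi> i e \<and> \<psi> i e)" using assms unfolding Def_def ind_def by blast
  moreover have "pb (\<lambda>n. T n + (S n + 2))" using T S by (intro pb_add pb_const)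
  ultimately show ?thesis unfolding Def_def by blast
qed

text \<open>Both atomic formulas are visible on a single cell: the base symbol under head
  \<open>j\<close>, or the mark of another head there. \<open>K0\<close> ensures that this other
  head exists on the tape.\<close>

lemma Def_test:
  assumes "j < m" "ind m \<phi>"
    and t: "\<And>i e v K. i \<in> I \<Longrightarrow> ok i e \<Longrightarrow> K0 \<le> K \<Longrightarrow> \<phi> i e \<longleftrightarrow> t (tape (wd i) K e v (int (e j)))"
  shows "Def m \<phi>"
proof -
  let ?p = "goto j ;; Cond t (home ;; Act (\<lambda>_. 10) 0) (home ;; Act (\<lambda>_. 0) 0)"
  have "decides m ?p (\<lambda>n. 4 * n + 12) (max K0 (Suc j)) \<phi>"
    unfolding decides_def
  proof (intro allI impI conjI ballI)
    fix K assume K: "max K0 (Suc j) \<le> K"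
    have "(2::nat) ^ 1 \<le> 2 ^ K" using K by (intro power_increasing) auto
    then show "bounded (10 * 2 ^ K) ?p"
      by (auto simp: bounded_goto bounded_home)
    fix i e and v :: nat assume i: "i \<in> I" "ok i e" "v \<in> {0, 10}"
    have v: "v mod 10 = 0" using i(3) by auto
    have ej: "e j \<le> len i" using i(2) by (simp add: ok_def)
    have 1: "run (goto j) (tape (wd i) K e v, -1) (2 * len i + 4) (tape (wd i) K e v, int (e j))"
      using K ej by (intro run_goto word i) auto
    have 2: "run (home ;; Act (\<lambda>_. u) 0) (tape (wd i) K e v, int (e j)) (2 * len i + 5) (tape (wd i) K e u, -1)" for u
      using K ej v by (intro run_Seq[OF run_home[OF word] run_flag[OF order.refl]] i) auto
    have "run (Cond t (home ;; Act (\<lambda>_. 10) 0) (home ;; Act (\<lambda>_. 0) 0)) (tape (wd i) K e v, int (e j))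
       (2 * len i + 6) (tape (wd i) K e (if \<phi> i e then 10 else 0), -1)"
    proof (cases "\<phi> i e")
      case True
      then show ?thesis using t[OF i(1,2), of K v] K run_CondT[OF _ 2[of 10], of t] by auto
    next
      case False
      then show ?thesis using t[OF i(1,2), of K v] K run_CondF[OF _ 2[of 0], of t] by auto
    qed
    then have "run ?p (tape (wd i) K e v, -1) (4 * len i + 12) (tape (wd i) K e (if \<phi> i e then 10 else 0), -1)"
      by (rule run_Seq[OF 1]) auto
    with i show "\<exists>e'. ok i e' \<and> agree m e e' \<and> run ?p (tape (wd i) K e v, -1) (4 * len i + 12)
        (tape (wd i) K e' (if \<phi> i e then 10 else 0), -1)" by (intro exI[of _ e]) auto
  qed
  moreover have "pb (\<lambda>n. 4 * n + 12)" by (intro pb_add pb_const pb_id pb_mult)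
  ultimately show ?thesis unfolding Def_def using assms(2) by blast
qed

lemma Def_sym: "j < m \<Longrightarrow> Def m (\<lambda>i e. sy (wd i) (e j) = a)"
  by (rule Def_test[of j _ _ 0 "\<lambda>s. s mod 10 = a"])
     (auto simp: ind_def agree_def base_tape[OF word] ok_def)

lemma Def_eq: "j < m \<Longrightarrow> k < m \<Longrightarrow> Def m (\<lambda>i e. e j = e k)"
  by (rule Def_test[of j _ _ "Suc k" "marked k"])
     (auto simp: ind_def agree_def marked_tape[OF word] ok_def)

text \<open>The common pattern of quantification and addition. The heads below \<open>m'\<close> run
  through the environments \<open>G i e 0\<close>, ..., \<open>G i e (L i e)\<close>, and head
  \<open>y\<close> reaches the end of the word exactly in the last one. The flag is 10 for found, 0
  for not yet, 20 for exhausted. Only agreement on the first \<open>m'\<close> heads is maintained,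
  since the inner program disturbs its scratch heads.\<close>

lemma Def_loop:
  assumes \<phi>: "Def m' \<phi>" and y: "y < m'" and "m \<le> m'" and \<psi>: "ind m \<psi>" and S: "pb S"
    and bd: "\<And>K. Kb \<le> K \<Longrightarrow> bounded (10 * 2 ^ K) ini \<and> bounded (10 * 2 ^ K) step"
    and ini: "\<And>i e v K. i \<in> I \<Longrightarrow> ok i e \<Longrightarrow> v \<in> {0, 10} \<Longrightarrow> Kb \<le> K \<Longrightarrow>
      \<exists>e'. ok i e' \<and> agree m' (G i e 0) e' \<and> run ini (tape (wd i) K e v, -1) (S (len i)) (tape (wd i) K e' v, -1)"
    and step: "\<And>i e v K l e'. i \<in> I \<Longrightarrow> ok i e \<Longrightarrow> v \<in> {0, 10} \<Longrightarrow> Kb \<le> K \<Longrightarrow> l < L i e \<Longrightarrow>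
      ok i e' \<Longrightarrow> agree m' (G i e l) e' \<Longrightarrow>
      \<exists>e''. ok i e'' \<and> agree m' (G i e (Suc l)) e'' \<and> run step (tape (wd i) K e' v, -1) (S (len i)) (tape (wd i) K e'' v, -1)"
    and G: "\<And>i e l. i \<in> I \<Longrightarrow> ok i e \<Longrightarrow> l \<le> L i e \<Longrightarrow>
      ok i (G i e l) \<and> agree m e (G i e l) \<and> (G i e l y = len i \<longleftrightarrow> l = L i e)"
    and L: "\<And>i e. i \<in> I \<Longrightarrow> ok i e \<Longrightarrow> L i e \<le> len i"
    and \<psi>_eq: "\<And>i e. i \<in> I \<Longrightarrow> ok i e \<Longrightarrow> \<psi> i e \<longleftrightarrow> (\<exists>l\<le>L i e. \<phi> i (G i e l))"
  shows "Def m \<psi>"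
proof -
  obtain p T K0 where T: "pb T" and p: "decides m' p T K0 \<phi>" and ind\<phi>: "ind m' \<phi>"
    using \<phi> unfolding Def_def by blast
  let ?body = "goto y ;; Cond nb (home ;; step ;; p) (home ;; Act (\<lambda>_. 20) 0)"
  let ?loop = "Loop (\<lambda>s. s = 0) ?body"
  let ?p = "ini ;; p ;; ?loop ;; Act (\<lambda>s. if s = 20 then 0 else s) 0"
  \<comment> \<open>A bound for one round: the trip to head \<open>y\<close> and back, the step and
    the inner program. It also covers the initial stage.\<close>
  define C where "C n = T n + S n + 4 * n + 20" for n
  \<comment> \<open>Two heads already give 40 symbols, enough for the flag value 20.\<close>
  let ?K = "max (max K0 Kb) (max 2 (Suc y))"
  have "decides m ?p (\<lambda>n. (n + 3) * C n) ?K \<psi>"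
    unfolding decides_def
  proof (intro allI impI conjI ballI)
    fix K assume K: "?K \<le> K"
    have "(2::nat) ^ 2 \<le> 2 ^ K" using K by (intro power_increasing) auto
    then show "bounded (10 * 2 ^ K) ?p"
      using K p bd[of K] by (auto simp: bounded_goto bounded_home decides_def)
    fix i e and v :: nat assume i: "i \<in> I" "ok i e" "v \<in> {0, 10}"
    let ?n = "len i" and ?t = "tape (wd i) K" and ?G = "G i e" and ?L = "L i e"
    have loop: "\<exists>e2. ok i e2 \<and> agree m e e2 \<and>
        run ?loop (?t e1 (if \<phi> i (?G l) then 10 else 0), -1) ((?L - l) * C ?n + C ?n)
          (?t e2 (if \<exists>l'\<le>?L. l \<le> l' \<and> \<phi> i (?G l') then 10 else 20), -1)"
      if "l \<le> ?L" "ok i e1" "agree m' (?G l) e1" for l e1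
      using that
    proof (induction "?L - l" arbitrary: l e1)
      case (0 l e1)
      then have l: "l = ?L" by simp
      have ag: "agree m e e1"
        using G[OF i(1,2) 0(2)] agree_mono[OF 0(4) \<open>m \<le> m'\<close>] by (meson agree_trans)
      show ?case
      proof (cases "\<phi> i (?G l)")
        case True
        have "run ?loop (?t e1 10, -1) ((?L - l) * C ?n + C ?n) (?t e1 10, -1)"
          by (rule run_LoopF) (auto simp: C_def tape_flag)
        with True 0 ag l show ?thesis by auto
      next
        case False
        have ey: "e1 y = ?n" using G[OF i(1,2) 0(2)] 0(4) y l by (auto simp: agree_def)
        have 1: "run (goto y) (?t e1 0, -1) (2 * ?n + 4) (?t e1 0, int (e1 y))"
          using K ey by (intro run_goto word i) auto
        have 2: "run (home ;; Act (\<lambda>_. 20) 0) (?t e1 0, int (e1 y)) (2 * ?n + 5) (?t e1 20, -1)"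
          using K ey by (intro run_Seq[OF run_home[OF word] run_flag[OF order.refl]] i) auto
        have 3: "run (Cond nb (home ;; step ;; p) (home ;; Act (\<lambda>_. 20) 0)) (?t e1 0, int (e1 y)) (2 * ?n + 6) (?t e1 20, -1)"
          using nb_tape[OF word[OF i(1)], of "e1 y" K e1 0] ey by (intro run_CondF[OF _ 2]) auto
        have 4: "run ?body (?t e1 0, -1) (4 * ?n + 10) (?t e1 20, -1)"
          by (rule run_Seq[OF 1 3]) auto
        have 5: "run ?loop (?t e1 20, -1) 1 (?t e1 20, -1)"
          by (rule run_LoopF) (auto simp: tape_flag)
        have "run ?loop (?t e1 0, -1) ((?L - l) * C ?n + C ?n) (?t e1 20, -1)"
          by (rule run_LoopT[OF _ 4 5]) (auto simp: tape_flag C_def)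
        with False 0 ag l show ?thesis by auto
      qed
    next
      case (Suc d l e1)
      then have l: "l < ?L" by simp
      have ag: "agree m e e1"
        using G[OF i(1,2) Suc(3)] agree_mono[OF Suc(5) \<open>m \<le> m'\<close>] by (meson agree_trans)
      show ?case
      proof (cases "\<phi> i (?G l)")
        case True
        have "run ?loop (?t e1 10, -1) ((?L - l) * C ?n + C ?n) (?t e1 10, -1)"
          by (rule run_LoopF) (auto simp: C_def tape_flag)
        with True Suc ag l show ?thesis by auto
      next
        case False
        have eyn: "e1 y \<le> ?n" using Suc(4) by (simp add: ok_def)
        moreover have "e1 y \<noteq> ?n" using G[OF i(1,2) Suc(3)] Suc(5) y l by (auto simp: agree_def)
        ultimately have ey: "e1 y < ?n" by simp
        have 1: "run (goto y) (?t e1 0, -1) (2 * ?n + 4) (?t e1 0, int (e1 y))"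
          using K ey by (intro run_goto word i) auto
        have 2: "run home (?t e1 0, int (e1 y)) (2 * ?n + 4) (?t e1 0, -1)"
          using ey by (intro run_home word i) auto
        obtain e2 where e2: "ok i e2" "agree m' (?G (Suc l)) e2" and
          3: "run step (?t e1 0, -1) (S ?n) (?t e2 0, -1)"
          using step[OF i(1,2), of 0 K l e1] K l Suc(4,5) by auto
        obtain e3 where e3: "ok i e3" "agree m' e2 e3" and
          4: "run p (?t e2 0, -1) (T ?n) (?t e3 (if \<phi> i e2 then 10 else 0), -1)"
          using decidesD[OF p _ i(1) e2(1), of K 0] K by auto
        have "\<phi> i e2 = \<phi> i (?G (Suc l))"
          using ind\<phi> G[OF i(1,2), of "Suc l"] l e2 i(1) unfolding ind_def by (metis Suc_leI)
        note 4 = 4[unfolded this]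
        have e3': "agree m' (?G (Suc l)) e3" using e2(2) e3(2) by (rule agree_trans)
        have 5: "run (Cond nb (home ;; step ;; p) (home ;; Act (\<lambda>_. 20) 0)) (?t e1 0, int (e1 y))
            (2 * ?n + 5 + S ?n + T ?n) (?t e3 (if \<phi> i (?G (Suc l)) then 10 else 0), -1)"
          using nb_tape[OF word[OF i(1)], of "e1 y" K e1 0] ey
          by (intro run_CondT[OF _ run_Seq[OF 2 run_Seq[OF 3 4 order.refl] order.refl]]) auto
        have 6: "run ?body (?t e1 0, -1) (4 * ?n + 9 + S ?n + T ?n)
            (?t e3 (if \<phi> i (?G (Suc l)) then 10 else 0), -1)"
          by (rule run_Seq[OF 1 5]) auto
        have d: "d = ?L - Suc l" "Suc l \<le> ?L" using Suc(2) l by auto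
        obtain e4 where e4: "ok i e4" "agree m e e4" and
          7: "run ?loop (?t e3 (if \<phi> i (?G (Suc l)) then 10 else 0), -1) ((?L - Suc l) * C ?n + C ?n)
            (?t e4 (if \<exists>l'\<le>?L. Suc l \<le> l' \<and> \<phi> i (?G l') then 10 else 20), -1)"
          using Suc(1)[OF d e3(1) e3'] by blast
        have Ld: "?L - l = Suc (?L - Suc l)" using l by simp
        have "(\<exists>l'\<le>?L. Suc l \<le> l' \<and> \<phi> i (?G l')) = (\<exists>l'\<le>?L. l \<le> l' \<and> \<phi> i (?G l'))"
          using False by (metis Suc_leD Suc_leI le_neq_implies_less)
        note 7 = 7[unfolded this]
        have "run ?loop (?t e1 0, -1) ((?L - l) * C ?n + C ?n)
            (?t e4 (if \<exists>l'\<le>?L. l \<le> l' \<and> \<phi> i (?G l') then 10 else 20), -1)"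
          by (rule run_LoopT[OF _ 6 7]) (auto simp: tape_flag C_def Ld)
        with False e4 show ?thesis by (intro exI[of _ e4]) simp
      qed
    qed
    obtain e1 where e1: "ok i e1" "agree m' (?G 0) e1" and
      1: "run ini (?t e v, -1) (S ?n) (?t e1 v, -1)"
      using ini[OF i, of K] K by auto
    obtain e2 where e2: "ok i e2" "agree m' e1 e2" and
      2: "run p (?t e1 v, -1) (T ?n) (?t e2 (if \<phi> i e1 then 10 else 0), -1)"
      using decidesD[OF p _ i(1) e1(1) i(3), of K] K by auto
    have "\<phi> i e1 = \<phi> i (?G 0)"
      using ind\<phi> G[OF i(1,2), of 0] e1 i(1) unfolding ind_def by blast
    note 2 = 2[unfolded this]
    obtain e3 where e3: "ok i e3" "agree m e e3" and
      3: "run ?loop (?t e2 (if \<phi> i (?G 0) then 10 else 0), -1) (?L * C ?n + C ?n)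
        (?t e3 (if \<psi> i e then 10 else 20), -1)"
      using loop[OF le0 e2(1) agree_trans[OF e1(2) e2(2)]] \<psi>_eq[OF i(1,2)] by auto
    have 4: "run (Act (\<lambda>s. if s = 20 then 0 else s) 0) (?t e3 (if \<psi> i e then 10 else 20), -1) 1
        (?t e3 (if \<psi> i e then 10 else 0), -1)"
      by (rule run_flag) auto
    have "run ?p (?t e v, -1) (S ?n + (T ?n + (?L * C ?n + C ?n + 1))) (?t e3 (if \<psi> i e then 10 else 0), -1)"
      by (intro run_Seq[OF 1 run_Seq[OF 2 run_Seq[OF 3 4]]]) auto
    moreover have "S ?n + (T ?n + (?L * C ?n + C ?n + 1)) \<le> (?n + 3) * C ?n"
    proof -
      have "?L * C ?n \<le> ?n * C ?n" using L[OF i(1,2)] by (rule mult_le_mono1)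
      moreover have "S ?n + T ?n + 1 \<le> C ?n" by (simp add: C_def)
      ultimately show ?thesis unfolding add_mult_distrib by linarith
    qed
    ultimately have "run ?p (?t e v, -1) ((?n + 3) * C ?n) (?t e3 (if \<psi> i e then 10 else 0), -1)"
      by (rule run_mono)
    with e3 show "\<exists>e'. ok i e' \<and> agree m e e' \<and> run ?p (?t e v, -1) ((?n + 3) * C ?n)
        (?t e' (if \<psi> i e then 10 else 0), -1)" by blast
  qed
  moreover have "pb (\<lambda>n. (n + 3) * C n)"
    unfolding C_def using T S by (intro pb_add pb_const pb_id pb_mult)
  ultimately show ?thesis unfolding Def_def using \<psi> by blast
qed

text \<open>Head \<open>m\<close> is swept over all cells, the blank one behind the input included.
  \<open>indep\<close> says that \<open>\<phi>\<close> reads head \<open>m\<close> through its last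
  argument alone.\<close>

lemma Def_ex:
  assumes \<phi>: "Def (Suc m) (\<lambda>i e. \<phi> i e (e m))"
    and indep: "\<And>i e x. \<phi> i (e(m := x)) x = \<phi> i e x"
  shows "Def m (\<lambda>i e. \<exists>x\<le>len i. \<phi> i e x)"
proof (rule Def_loop[where m' = "Suc m" and y = m and ini = "zero m" and step = "inc m"
      and G = "\<lambda>i e l. e(m := l)" and L = "\<lambda>i e. len i" and S = "\<lambda>n. 4 * n + 11" and Kb = "Suc m",
      OF \<phi>])
  show "ind m (\<lambda>i e. \<exists>x\<le>len i. \<phi> i e x)"
    unfolding ind_def
  proof (intro ballI allI impI ex_cong1 conj_cong refl)
    fix i e e' x assume *: "i \<in> I" "ok i e" "ok i e'" "agree m e e'" "x \<le> len i"
    then have "ok i (e(m := x))" "ok i (e'(m := x))" "agree (Suc m) (e(m := x)) (e'(m := x))"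
      by (auto simp: agree_def less_Suc_eq)
    then have "\<phi> i (e(m := x)) ((e(m := x)) m) = \<phi> i (e'(m := x)) ((e'(m := x)) m)"
      using \<phi> *(1) unfolding Def_def ind_def by blast
    then show "\<phi> i e x = \<phi> i e' x"
      by (simp add: indep)
  qed
  show "\<exists>e'. ok i e' \<and> agree (Suc m) (e(m := 0)) e' \<and>
      run (zero m) (tape (wd i) K e v, -1) (4 * len i + 11) (tape (wd i) K e' v, -1)"
    if "i \<in> I" "ok i e" "v \<in> {0, 10}" "Suc m \<le> K" for i e v K
    using that ok_le[OF that(2), of m] run_zero[OF word[OF that(1)], of e m K v "4 * len i + 11"] ok_upd[OF that(2), of 0 m]
    by (intro exI[of _ "e(m := 0)"]) auto
  show "\<exists>e''. ok i e'' \<and> agree (Suc m) (e(m := Suc l)) e'' \<and>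
      run (inc m) (tape (wd i) K e' v, -1) (4 * len i + 11) (tape (wd i) K e'' v, -1)"
    if "i \<in> I" "ok i e" "v \<in> {0, 10}" "Suc m \<le> K" "l < len i" "ok i e'" "agree (Suc m) (e(m := l)) e'"
    for i e v K l e'
  proof -
    have "e' m = l" using that by (auto simp: agree_def)
    then show ?thesis using that run_inc[OF word[OF that(1)], of e' m K v "4 * len i + 11"]
      by (intro exI[of _ "e'(m := Suc l)"]) (auto simp: agree_def)
  qed
  show "pb (\<lambda>n. 4 * n + 11)" by (intro pb_add pb_mult pb_const pb_id)
qed (simp_all add: agree_def indep bounded_moves ok_upd)

lemma Def_disj:
  assumes "Def m \<phi>" "Def m \<psi>"
  shows "Def m (\<lambda>i e. \<phi> i e \<or> \<psi> i e)"
proof -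
  have "Def m (\<lambda>i e. \<not> (\<not> \<phi> i e \<and> \<not> \<psi> i e))"
    by (intro Def_not Def_conj assms)
  then show ?thesis by (rule Def_cong) blast
qed

lemma Def_imp:
  assumes "Def m \<phi>" "Def m \<psi>"
  shows "Def m (\<lambda>i e. \<phi> i e \<longrightarrow> \<psi> i e)"
  by (rule Def_cong[OF Def_disj[OF Def_not[OF assms(1)] assms(2)]]) blast

lemma Def_all:
  assumes "Def (Suc m) (\<lambda>i e. \<phi> i e (e m))" "\<And>i e x. \<phi> i (e(m := x)) x = \<phi> i e x"
  shows "Def m (\<lambda>i e. \<forall>x\<le>len i. \<phi> i e x)"
proof -
  have "Def m (\<lambda>i e. \<exists>x\<le>len i. \<not> \<phi> i e x)"
    by (intro Def_ex Def_not assms(1)) (simp add: assms(2))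
  from Def_not[OF this] show ?thesis by (rule Def_cong) blast
qed

text \<open>Two new heads advance together, from 0 and from \<open>e k\<close>. The sum is right iff
  at some moment the first is at \<open>e j\<close> and the second at \<open>e l\<close>. The second
  reaches the end after \<open>len i - e k\<close> rounds, which stops the loop.\<close>

lemma Def_plus:
  assumes "j < m" "k < m" "l < m"
  shows "Def m (\<lambda>i e. e j + e k = e l)"
proof (rule Def_loop[where m' = "Suc (Suc m)" and y = "Suc m" and ini = "zero m ;; copy k (Suc m)"
      and step = "inc m ;; inc (Suc m)" and G = "\<lambda>i e x. e(m := x, Suc m := e k + x)"
      and L = "\<lambda>i e. len i - e k" and S = "\<lambda>n. (n + 3) * (8 * n + 24)" and Kb = "Suc (Suc m)"])
  show "Def (Suc (Suc m)) (\<lambda>i e. e m = e j \<and> e (Suc m) = e l)"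
    using assms by (intro Def_conj Def_eq) auto
  show "\<exists>e'. ok i e' \<and> agree (Suc (Suc m)) (e(m := 0, Suc m := e k + 0)) e' \<and>
      run (zero m ;; copy k (Suc m)) (tape (wd i) K e v, -1) ((len i + 3) * (8 * len i + 24)) (tape (wd i) K e' v, -1)"
    if "i \<in> I" "ok i e" "v \<in> {0, 10}" "Suc (Suc m) \<le> K" for i e v K
  proof -
    have 1: "run (zero m) (tape (wd i) K e v, -1) (4 * len i + 11) (tape (wd i) K (e(m := 0)) v, -1)"
      using that by (intro run_zero word ok_le) auto
    have 2: "run (copy k (Suc m)) (tape (wd i) K (e(m := 0)) v, -1) ((len i + 2) * (8 * len i + 24))
        (tape (wd i) K ((e(m := 0))(Suc m := (e(m := 0)) k)) v, -1)"
      using that assms ok_le[OF that(2)] by (intro run_copy word) auto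
    have "run (zero m ;; copy k (Suc m)) (tape (wd i) K e v, -1) ((len i + 3) * (8 * len i + 24))
        (tape (wd i) K (e(m := 0, Suc m := e k)) v, -1)"
      using run_Seq[OF 1 2 order.refl] assms by (auto simp: algebra_simps elim!: run_mono)
    with that ok_le[OF that(2), of k] show ?thesis
      by (intro exI[of _ "e(m := 0, Suc m := e k)"]) (auto intro!: ok_upd)
  qed
  show "\<exists>e''. ok i e'' \<and> agree (Suc (Suc m)) (e(m := Suc x, Suc m := e k + Suc x)) e'' \<and>
      run (inc m ;; inc (Suc m)) (tape (wd i) K e' v, -1) ((len i + 3) * (8 * len i + 24)) (tape (wd i) K e'' v, -1)"
    if *: "i \<in> I" "ok i e" "v \<in> {0, 10}" "Suc (Suc m) \<le> K" "x < len i - e k" "ok i e'"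
      "agree (Suc (Suc m)) (e(m := x, Suc m := e k + x)) e'" for i e v K x e'
  proof -
    have e': "e' m = x" "e' (Suc m) = e k + x"
      using *(7)[unfolded agree_def, rule_format, of m] *(7)[unfolded agree_def, rule_format, of "Suc m"] by auto
    have 1: "run (inc m) (tape (wd i) K e' v, -1) (4 * len i + 11) (tape (wd i) K (e'(m := Suc x)) v, -1)"
      using * e' run_inc[OF word[OF *(1)], of e' m K v "4 * len i + 11"] by auto
    have 2: "run (inc (Suc m)) (tape (wd i) K (e'(m := Suc x)) v, -1) (4 * len i + 11)
        (tape (wd i) K (e'(m := Suc x, Suc m := e k + Suc x)) v, -1)"
      using * e' run_inc[OF word[OF *(1)], of "e'(m := Suc x)" "Suc m" K v "4 * len i + 11"] by auto
    have "run (inc m ;; inc (Suc m)) (tape (wd i) K e' v, -1) ((len i + 3) * (8 * len i + 24))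
        (tape (wd i) K (e'(m := Suc x, Suc m := e k + Suc x)) v, -1)"
      by (intro run_Seq[OF 1 2]) (auto simp: algebra_simps)
    with * show ?thesis
      by (intro exI[of _ "e'(m := Suc x, Suc m := e k + Suc x)"]) (auto simp: agree_def intro!: ok_upd)
  qed
  show "ok i (e(m := x, Suc m := e k + x)) \<and> agree m e (e(m := x, Suc m := e k + x)) \<and>
      ((e(m := x, Suc m := e k + x)) (Suc m) = len i \<longleftrightarrow> x = len i - e k)"
    if "i \<in> I" "ok i e" "x \<le> len i - e k" for i e x
    using that ok_le[OF that(2), of k] by (auto simp: agree_def intro!: ok_upd)
  show "e j + e k = e l \<longleftrightarrow> (\<exists>x\<le>len i - e k. (e(m := x, Suc m := e k + x)) m = (e(m := x, Suc m := e k + x)) j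
      \<and> (e(m := x, Suc m := e k + x)) (Suc m) = (e(m := x, Suc m := e k + x)) l)"
    if "i \<in> I" "ok i e" for i e
    using that assms ok_le[OF that(2), of k] ok_le[OF that(2), of l] by auto
  show "ind m (\<lambda>i e. e j + e k = e l)" using assms by (simp add: ind_def agree_def)
  show "pb (\<lambda>n. (n + 3) * (8 * n + 24))" by (intro pb_add pb_mult pb_const pb_id)
qed (simp_all add: bounded_moves)

lemma Def_const: "Def m (\<lambda>i e. b)"
proof -
  have "decides m (Act (\<lambda>_. if b then 10 else 0) 0) (\<lambda>n. 1) 1 (\<lambda>i e. b)"
    unfolding decides_def
  proof (intro allI impI conjI ballI)
    fix K :: nat assume K: "1 \<le> K"
    have "(2::nat) ^ 1 \<le> 2 ^ K" using K by (intro power_increasing) auto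
    then show "bounded (10 * 2 ^ K) (Act (\<lambda>_. if b then 10 else 0) 0)" by auto
  qed (auto intro!: run_flag exI)
  then show ?thesis unfolding Def_def by (auto simp: ind_def)
qed

lemma Def_bex: "finite F \<Longrightarrow> (\<And>x. x \<in> F \<Longrightarrow> Def m (\<phi> x)) \<Longrightarrow> Def m (\<lambda>i e. \<exists>x\<in>F. \<phi> x i e)"
  by (induction F rule: finite_induct) (auto simp: Def_const intro!: Def_disj)

lemma Def_ball: "finite F \<Longrightarrow> (\<And>x. x \<in> F \<Longrightarrow> Def m (\<phi> x)) \<Longrightarrow> Def m (\<lambda>i e. \<forall>x\<in>F. \<phi> x i e)"
  by (induction F rule: finite_induct) (auto simp: Def_const intro!: Def_conj)

end

section \<open>From a definable property to a polynomial-time machine\<close>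

fun append_word :: "nat list \<Rightarrow> tprog" where
  "append_word [] = Act id 0"
| "append_word (a # s) = Act (\<lambda>_. a) 1 ;; append_word s"

definition plain :: "nat list \<Rightarrow> int \<Rightarrow> nat" where
  "plain w i = (if 0 \<le> i then sy w (nat i) else 0)"

lemma plain_snoc: "(plain w)(int (length w) := a) = plain (w @ [a])"
  by (auto simp: plain_def sy_def nth_append fun_eq_iff)

lemma run_append_word: "run (append_word s) (plain w, int (length w)) (length s + 1) (plain (w @ s), int (length (w @ s)))"
proof (induction s arbitrary: w)
  case Nil
  then show ?case by (auto intro!: run_Act)
next
  case (Cons a s)
  have "run (Act (\<lambda>_. a) 1) (plain w, int (length w)) 1 (plain (w @ [a]), int (length (w @ [a])))"
    by (rule run_Act) (auto simp: plain_snoc)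
  from run_Seq[OF this Cons.IH[of "w @ [a]"]] show ?case by simp
qed

lemma bounded_append_word: "\<forall>a\<in>set s. a < N \<Longrightarrow> bounded N (append_word s)"
  by (induction s) auto

text \<open>Before any mark is set, all heads are absent; with this reading \<open>run_home\<close>
  applies to the raw input as well.\<close>

lemma plain_tape: "plain w = tape w K (\<lambda>_. Suc (length w)) 0"
proof
  fix x
  have "x \<le> int (length w) \<Longrightarrow> Suc (length w) \<noteq> nat x" by auto
  then show "plain w x = tape w K (\<lambda>_. Suc (length w)) 0 x"
    by (auto simp: plain_def tape_def sy_def cell_def)
qed

text \<open>The machine appends \<open>suf\<close>, puts all heads on cell 0 in a single write and
  runs the program of the closed formula. Since \<open>suf\<close> is fixed, a polynomial in the
  extended length is one in the input length.\<close>

theorem words_decidable: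
  fixes wd0 :: "'i \<Rightarrow> nat list" and \<phi> :: "'i \<Rightarrow> (nat \<Rightarrow> nat) \<Rightarrow> bool"
  assumes "words (\<lambda>i. wd0 i @ suf) I" and "words.Def (\<lambda>i. wd0 i @ suf) I 0 \<phi>"
  shows "\<exists>M c k. wf_tm M \<and> 9 \<le> tm_nsym M \<and>
    (\<forall>i\<in>I. decides_within M (wd0 i) (c * length (wd0 i) ^ k + c) (\<phi> i (\<lambda>_. 0)))"
proof -
  interpret words "\<lambda>i. wd0 i @ suf" I by fact
  obtain p T K0 where T: "pb T" and p: "decides 0 p T K0 \<phi>"
    using assms(2) unfolding Def_def by blast
  define K where "K = max K0 1"
  \<comment> \<open>Adding \<open>full\<close> to a base symbol places all \<open>K\<close> marks on
    that cell.\<close>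
  define full where "full = (10::nat) * set_encode {..<K}"
  have full: "full < 10 * 2 ^ K" unfolding full_def using set_encode_less[of "{..<K}" K] by simp
  let ?w = "\<lambda>i. wd0 i @ suf"
  let ?N = "10 * 2 ^ K :: nat"
  let ?p = "Loop nb (Act id 1) ;; append_word suf ;; home ;; Act id 1 ;; Act (\<lambda>s. s mod 10 + full) (-1) ;; p"
  let ?w = "\<lambda>i. wd0 i @ suf"
  have N: "20 \<le> ?N"
    using power_increasing[of 1 K "2::nat"] by (auto simp: K_def)
  show ?thesis
  proof (cases "I = {}")
    \<comment> \<open>Without an instance nothing is known about the symbols of \<open>suf\<close>;
      any well-formed machine will do.\<close>
    case True
    then show ?thesis
      using wf_machine[of 10 "Act id 0"] by (intro exI[of _ "machine 10 (Act id 0)"]) (auto simp: machine_def)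
  next
    case False
    then have suf: "\<forall>a\<in>set suf. a < 10" using word by (fastforce simp: word_def)
    have mark: "s mod 10 + full < ?N" for s
    proof -
      have "s mod 10 < 10" "set_encode {..<K} + 1 \<le> 2 ^ K"
        using set_encode_less[of "{..<K}" K] by auto
      then show ?thesis unfolding full_def by linarith
    qed
    have "bounded ?N ?p"
      using p suf N mark by (auto simp: bounded_home decides_def K_def intro!: bounded_append_word)
    define B where "B n = 2 * n + 1 + (length suf + 1) + (2 * (n + length suf) + 4) + 2 + T (n + length suf) + 1" for n
    have run: "decides_within (machine ?N ?p) (wd0 i) (B (length (wd0 i))) (\<phi> i (\<lambda>_. 0))" if i: "i \<in> I" for i
    proof -
      let ?n = "length (wd0 i)" and ?t = "tape (?w i) K"
      have wi: "word (?w i)" using word[OF i] .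
      have 1: "run (Loop nb (Act id 1)) (plain (wd0 i), 0) (2 * ?n + 1) (plain (wd0 i), int ?n)"
      proof (rule scan_right)
        fix j assume "0 \<le> j" "j < int ?n"
        then have "wd0 i ! nat j \<in> set (wd0 i)" "nat j < ?n" by auto
        then show "nb (plain (wd0 i) j)" using wi \<open>0 \<le> j\<close> by (auto simp: plain_def sy_def word_def)
      qed (auto simp: plain_def sy_def)
      have 2: "run home (plain (?w i), int (length (?w i))) (2 * length (?w i) + 4) (plain (?w i), -1)"
        unfolding plain_tape[of _ K] using wi by (intro run_home) auto
      have 3: "run (Act id 1) (plain (?w i), -1) 1 (plain (?w i), 0)"
        by (rule run_Act) auto
      have "(plain (?w i))(0 := plain (?w i) 0 mod 10 + full) = ?t (\<lambda>_. 0) 0"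
      proof
        fix x :: int
        have "sy (?w i) 0 < 10" using sy_word(1)[OF wi] .
        then show "((plain (?w i))(0 := plain (?w i) 0 mod 10 + full)) x = ?t (\<lambda>_. 0) 0 x"
          by (auto simp: plain_def tape_def cell_def full_def lessThan_def sy_def)
      qed
      then have 4: "run (Act (\<lambda>s. s mod 10 + full) (-1)) (plain (?w i), 0) 1 (?t (\<lambda>_. 0) 0, -1)"
        by (intro run_Act) auto
      obtain e' where 5: "run p (?t (\<lambda>_. 0) 0, -1) (T (length (?w i))) (?t e' (if \<phi> i (\<lambda>_. 0) then 10 else 0), -1)"
        using decidesD[OF p _ i, of K "\<lambda>_. 0" 0] by (auto simp: ok_def K_def)
      have init: "snd (tm_init (machine ?N ?p) (wd0 i)) = (plain (wd0 i), 0)"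
        by (auto simp: tm_init_def plain_def sy_def fun_eq_iff)
      have "run ?p (snd (tm_init (machine ?N ?p) (wd0 i))) (B ?n - 1) (?t e' (if \<phi> i (\<lambda>_. 0) then 10 else 0), -1)"
        unfolding init
        by (rule run_Seq[OF 1 run_Seq[OF run_append_word run_Seq[OF 2 run_Seq[OF 3 run_Seq[OF 4 5]]]]]) (auto simp: B_def)
      from machine_decides[OF this, of "\<phi> i (\<lambda>_. 0)"] show ?thesis
        by (simp add: tape_flag B_def)
    qed
    obtain c k where ck: "T n \<le> c * (n + 1) ^ k" for n using T unfolding pb_def by blast
    have "pb B"
    proof -
      have "T (n + length suf) \<le> c * (length suf + 1) ^ k * (n + 1) ^ k" for n
      proof -
        have "n + length suf + 1 \<le> (length suf + 1) * (n + 1)" by simp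
        then have "(n + length suf + 1) ^ k \<le> ((length suf + 1) * (n + 1)) ^ k" by (rule power_mono) simp
        with ck[of "n + length suf"] show ?thesis
          by (metis le_trans mult_le_mono2 power_mult_distrib mult.assoc)
      qed
      then have "pb (\<lambda>n. T (n + length suf))" unfolding pb_def by blast
      then show ?thesis unfolding B_def by (intro pb_add pb_const pb_id pb_mult)
    qed
    then obtain c' k' where c': "B n \<le> c' * (n + 1) ^ k'" for n unfolding pb_def by blast
    \<comment> \<open>From the base \<open>n + 1\<close> to the base \<open>n\<close>: for
      \<open>n \<ge> 1\<close> it is at most \<open>2 * n\<close>, and the additive constant takes
      care of \<open>n = 0\<close>.\<close>
    have "B n \<le> c' * 2 ^ k' * n ^ k' + c' * 2 ^ k'" for n
    proof (cases n)
      case 0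
      have "c' * 1 \<le> c' * 2 ^ k'" by (rule mult_le_mono2) simp
      moreover have "B n \<le> c' * 1" using c'[of 0] 0 by simp
      ultimately show ?thesis by linarith
    next
      case (Suc l)
      then have "(n + 1) ^ k' \<le> (2 * n) ^ k'" by (intro power_mono) auto
      with c'[of n] have "B n \<le> c' * (2 * n) ^ k'" by (meson le_trans mult_le_mono2)
      then show ?thesis by (simp add: power_mult_distrib mult.assoc)
    qed
    then have "decides_within (machine ?N ?p) (wd0 i) (c' * 2 ^ k' * length (wd0 i) ^ k' + c' * 2 ^ k') (\<phi> i (\<lambda>_. 0))"
      if "i \<in> I" for i
      using run[OF that] unfolding decides_within_def by (meson le_trans)
    moreover have "9 \<le> tm_nsym (machine ?N ?p)" using N by (simp add: machine_def)
    ultimately show ?thesis using wf_machine[OF \<open>bounded ?N ?p\<close>] by blast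
  qed
qed

section \<open>Bounded derivations and small updates\<close>

text \<open>Derivation trees of height at most \<open>d\<close>. Being recursive in
  \<open>d\<close>, this notion can be unfolded into a formula, which \<open>entails\<close> with
  its quantifier over all models cannot.\<close>

fun der :: "rule set \<Rightarrow> gatom set \<Rightarrow> nat \<Rightarrow> gatom \<Rightarrow> bool" where
  "der \<Pi> E 0 g \<longleftrightarrow> g \<in> E"
| "der \<Pi> E (Suc d) g \<longleftrightarrow> g \<in> E \<or>
     (\<exists>r\<in>\<Pi>. \<exists>so st. inst so st (head r) = g \<and> (\<forall>a\<in>set (body r). der \<Pi> E d (inst so st a)))"

lemma der_step:
  assumes "r \<in> \<Pi>" "inst so st (head r) = g" "\<And>a. a \<in> set (body r) \<Longrightarrow> der \<Pi> E d (inst so st a)"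
  shows "der \<Pi> E (Suc d) g"
  using assms unfolding der.simps by blast

lemma der_mono: "der \<Pi> E d g \<Longrightarrow> E \<subseteq> E' \<Longrightarrow> der \<Pi> E' d g"
  by (induction d arbitrary: g) (auto, blast)

lemma der_Suc: "der \<Pi> E d g \<Longrightarrow> der \<Pi> E (Suc d) g"
proof (induction d arbitrary: g)
  case 0
  then show ?case by simp
next
  case (Suc d)
  from Suc.prems consider "g \<in> E" | r so st where "r \<in> \<Pi>" "inst so st (head r) = g"
      "\<forall>a\<in>set (body r). der \<Pi> E d (inst so st a)" by auto
  then show ?case
  proof cases
    case 1
    then show ?thesis by simp
  next
    case 2
    then have "\<forall>a\<in>set (body r). der \<Pi> E (Suc d) (inst so st a)" using Suc.IH by blast
    with der_step[OF 2(1,2)] show ?thesis by blast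
  qed
qed

lemma der_le: "d \<le> d' \<Longrightarrow> der \<Pi> E d g \<Longrightarrow> der \<Pi> E d' g"
  by (induction rule: dec_induct) (auto intro: der_Suc simp del: der.simps)

lemma entails_der: "entails \<Pi> E g \<longleftrightarrow> (\<exists>d. der \<Pi> E d g)"
proof
  assume *: "entails \<Pi> E g"
  \<comment> \<open>The derivable atoms form a model that contains the data.\<close>
  let ?I = "{g. \<exists>d. der \<Pi> E d g}"
  have "sat_rule ?I r" if r: "r \<in> \<Pi>" for r
    unfolding sat_rule_def
  proof (intro allI impI)
    fix so st assume "\<forall>a\<in>set (body r). inst so st a \<in> ?I"
    then obtain f where f: "\<And>a. a \<in> set (body r) \<Longrightarrow> der \<Pi> E (f a) (inst so st a)" by simp metis
    \<comment> \<open>A common depth for all body atoms. For an empty body \<open>Max {}\<close> is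
      unspecified, and there is nothing to derive.\<close>
    have "der \<Pi> E (Max (f ` set (body r))) (inst so st a)" if "a \<in> set (body r)" for a
      using that by (intro der_le[OF _ f]) auto
    then have "der \<Pi> E (Suc (Max (f ` set (body r)))) (inst so st (head r))" using r by (intro der_step[of r]) auto
    then show "inst so st (head r) \<in> ?I" by blast
  qed
  moreover have "E \<subseteq> ?I" by (auto intro: exI[of _ 0])
  ultimately show "\<exists>d. der \<Pi> E d g" using * unfolding entails_def by blast
next
  assume "\<exists>d. der \<Pi> E d g"
  then obtain d where "der \<Pi> E d g" by blast
  then show "entails \<Pi> E g"
    unfolding entails_def
  proof (intro allI impI)
    fix I assume I: "E \<subseteq> I \<and> (\<forall>r\<in>\<Pi>. sat_rule I r)"
    assume "der \<Pi> E d g"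
    then show "g \<in> I"
    proof (induction d arbitrary: g)
      case (Suc d)
      then show ?case using I unfolding sat_rule_def der.simps by blast
    qed (use I in auto)
  qed
qed

text \<open>Well-founded induction from a predicate to those it depends on: one more than the
  maximal depth of the latter. The depth is chosen before the data \<open>E\<close>, so it depends
  on the program and \<open>P\<close> alone.\<close>

lemma nonrecursive_depth:
  assumes "finite \<Pi>" "nonrecursive \<Pi>"
  shows "\<exists>N. \<forall>E d g. gpred g = P \<longrightarrow> der \<Pi> E d g \<longrightarrow> der \<Pi> E N g"
proof -
  have dep: "dep \<Pi> = (\<Union>r\<in>\<Pi>. (\<lambda>a. (apred (head r), apred a)) ` set (body r))"
    by (auto simp: dep_def)
  have "finite (dep \<Pi>)" unfolding dep using assms(1) by blast
  then have "wf ((dep \<Pi>)\<inverse>)"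
    using assms(2) unfolding nonrecursive_def by (rule finite_acyclic_wf_converse)
  then show ?thesis
  proof (induction P rule: wf_induct_rule)
    case (less P)
    then have "\<forall>P'\<in>dep \<Pi> `` {P}. \<exists>N. \<forall>E d g. gpred g = P' \<longrightarrow> der \<Pi> E d g \<longrightarrow> der \<Pi> E N g" by auto
    then obtain f where f: "\<And>P' E d g. (P, P') \<in> dep \<Pi> \<Longrightarrow> gpred g = P' \<Longrightarrow> der \<Pi> E d g \<Longrightarrow> der \<Pi> E (f P') g"
      using bchoice[of "dep \<Pi> `` {P}"] by (metis Image_singleton_iff)
    have fin: "finite (dep \<Pi> `` {P})" using \<open>finite (dep \<Pi>)\<close> by (rule finite_Image)
    \<comment> \<open>If \<open>P\<close> depends on nothing, this is the unspecified
      \<open>Max {}\<close>, but then all rules for \<open>P\<close> have an empty body.\<close>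
    let ?M = "Max (f ` (dep \<Pi> `` {P}))"
    have M: "f P' \<le> ?M" if "(P, P') \<in> dep \<Pi>" for P'
      using that fin by (intro Max_ge) auto
    show ?case
    proof (intro exI[of _ "Suc ?M"] allI impI)
      fix E d g assume g: "gpred g = P" and d: "der \<Pi> E d g"
      from d consider "g \<in> E" | k r so st where "r \<in> \<Pi>" "inst so st (head r) = g"
        "\<forall>a\<in>set (body r). der \<Pi> E k (inst so st a)" by (cases d) auto
      then show "der \<Pi> E (Suc ?M) g"
      proof cases
        case 2
        have "der \<Pi> E ?M (inst so st a)" if a: "a \<in> set (body r)" for a
        proof -
          have "apred (head r) = P" using 2(2) g by (auto simp: inst_def)
          then have "(P, apred a) \<in> dep \<Pi>" using a 2(1) by (auto simp: dep_def)
          then show ?thesis using 2(3) a by (intro der_le[OF M f]) (auto simp: inst_def)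
        qed
        with 2(1,2) show ?thesis by (rule der_step)
      qed simp
    qed
  qed
qed

section \<open>Objects, renamings and times in a derivation\<close>

definition objs :: "gatom set \<Rightarrow> nat set" where
  "objs E = (\<Union>g\<in>E. set (gobjs g))"

definition consts_of :: "rule set \<Rightarrow> nat set" where
  "consts_of \<Pi> = {c. \<exists>r\<in>\<Pi>. \<exists>a\<in>insert (head r) (set (body r)). OConst c \<in> set (aobjs a)}"

lemma finite_consts_of:
  assumes "finite \<Pi>"
  shows "finite (consts_of \<Pi>)"
proof -
  have "consts_of \<Pi> \<subseteq> (\<Union>r\<in>\<Pi>. \<Union>a\<in>insert (head r) (set (body r)). inst_o (\<lambda>_. 0) ` set (aobjs a))"
    by (fastforce simp: consts_of_def image_iff)
  then show ?thesis by (rule finite_subset) (use assms in auto)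
qed

text \<open>Rules are safe: a head variable occurs in the body, so a rule creates no object beyond
  its own constants.\<close>

lemma der_objs:
  assumes "\<And>r. r \<in> \<Pi> \<Longrightarrow> wf_rule r"
  shows "der \<Pi> E d g \<Longrightarrow> set (gobjs g) \<subseteq> objs E \<union> consts_of \<Pi>"
proof (induction d arbitrary: g)
  case 0
  then show ?case by (auto simp: objs_def)
next
  case (Suc d)
  show ?case
  proof (cases "g \<in> E")
    case False
    then obtain r so st where r: "r \<in> \<Pi>" "inst so st (head r) = g"
      "\<forall>a\<in>set (body r). der \<Pi> E d (inst so st a)" using Suc.prems by auto
    have "inst_o so t \<in> objs E \<union> consts_of \<Pi>" if t: "t \<in> set (aobjs (head r))" for t
    proof (cases t)
      case (OConst c)
      then show ?thesis using t r(1) by (auto simp: consts_of_def)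
    next
      case (OVar x)
      then have "x \<in> ovars (head r)" using t by (force simp: ovars_def)
      then have "x \<in> body_ovars r" using assms[OF r(1)] by (auto simp: wf_rule_def)
      then obtain a t' where a: "a \<in> set (body r)" "t' \<in> set (aobjs a)" "x \<in> ovars_oterm t'"
        by (auto simp: body_ovars_def ovars_def)
      then have "t' = OVar x" by (cases t') auto
      then have "so x \<in> set (gobjs (inst so st a))"
        using a(2) image_eqI[of "so x" "inst_o so" "OVar x"] by (simp add: inst_def)
      then show ?thesis using Suc.IH[of "inst so st a"] r(3) a OVar by auto
    qed
    then have "inst_o so ` set (aobjs (head r)) \<subseteq> objs E \<union> consts_of \<Pi>" by (rule image_subsetI)
    then show ?thesis using r(2)[symmetric] by (simp add: inst_def)
  qed (auto simp: objs_def)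
qed

lemma wf_inst: "wf_atom a \<Longrightarrow> wf_gatom (inst so st a)"
  by (auto simp: wf_atom_def wf_gatom_def inst_def)

lemma der_wf:
  assumes "\<And>r. r \<in> \<Pi> \<Longrightarrow> wf_rule r" "\<And>f. f \<in> E \<Longrightarrow> wf_gatom f" "der \<Pi> E d g"
  shows "wf_gatom g"
proof -
  have "g \<in> E \<or> (\<exists>r\<in>\<Pi>. \<exists>so st. inst so st (head r) = g)"
    using assms(3) by (cases d) auto
  then show ?thesis
    using assms(1,2) wf_inst unfolding wf_rule_def by blast
qed

definition hom :: "(nat \<Rightarrow> nat) \<Rightarrow> gatom \<Rightarrow> gatom" where
  "hom \<sigma> g = GAtom (gpred g) (map \<sigma> (gobjs g)) (gtime g)"

lemma hom_simps [simp]: "gpred (hom \<sigma> g) = gpred g" "gobjs (hom \<sigma> g) = map \<sigma> (gobjs g)"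
  "gtime (hom \<sigma> g) = gtime g"
  by (auto simp: hom_def)

lemma hom_id: "(\<And>x. x \<in> set (gobjs g) \<Longrightarrow> \<sigma> x = x) \<Longrightarrow> hom \<sigma> g = g"
  by (cases g) (auto simp: hom_def map_idI)

lemma hom_hom: "hom \<sigma> (hom \<rho> g) = hom (\<sigma> \<circ> \<rho>) g"
  by (simp add: hom_def)

text \<open>Genericity: composing the object substitutions of a derivation with
  \<open>\<sigma>\<close> yields a derivation over the renamed facts, because the constants of the
  rules stay fixed.\<close>

lemma der_hom:
  assumes \<sigma>: "\<And>c. c \<in> consts_of \<Pi> \<Longrightarrow> \<sigma> c = c"
  shows "der \<Pi> E d g \<Longrightarrow> der \<Pi> (hom \<sigma> ` E) d (hom \<sigma> g)"
proof (induction d arbitrary: g)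
  case (Suc d)
  show ?case
  proof (cases "g \<in> E")
    case False
    then obtain r so st where r: "r \<in> \<Pi>" "inst so st (head r) = g"
      "\<forall>a\<in>set (body r). der \<Pi> E d (inst so st a)" using Suc.prems by auto
    have inst: "inst (\<sigma> \<circ> so) st a = hom \<sigma> (inst so st a)" if "a \<in> insert (head r) (set (body r))" for a
    proof -
      have "inst_o (\<sigma> \<circ> so) t = \<sigma> (inst_o so t)" if "t \<in> set (aobjs a)" for t
      proof (cases t)
        case (OConst c)
        then have "c \<in> consts_of \<Pi>" using that \<open>a \<in> _\<close> r(1) unfolding consts_of_def by blast
        with OConst \<sigma> show ?thesis by simp
      qed simp
      then show ?thesis by (simp add: inst_def hom_def)
    qed
    then have "inst (\<sigma> \<circ> so) st (head r) = hom \<sigma> g"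
      "\<forall>a\<in>set (body r). der \<Pi> (hom \<sigma> ` E) d (inst (\<sigma> \<circ> so) st a)"
      using r Suc.IH by auto
    with r(1) show ?thesis by (intro der_step) auto
  qed simp
qed simp

text \<open>The offset of a time point is junk; the rules considered here contain none.\<close>

fun toff :: "tterm \<Rightarrow> int" where
  "toff (TPoint k) = k" | "toff (TVar x) = 0" | "toff (TPlus x k) = k"

text \<open>By connectedness the time variable of the body atom recurs in the time term of the head,
  so it cancels in the difference and only the offsets remain.\<close>

lemma time_shift:
  assumes "connected_rule r" "no_tpoint t" "a \<in> set (body r)" "atime a = Some t"
    and "\<And>t. atime (head r) = Some t \<Longrightarrow> no_tpoint t"
  obtains t' where "atime (head r) = Some t'" "\<And>st. inst_t st t - inst_t st t' = toff t - toff t'"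
proof -
  obtain x where x: "tvars_tterm t = {x}" "\<And>st. inst_t st t = st x + toff t"
    using assms(2) by (cases t) auto
  then have "x \<in> body_tvars r" using assms(3,4) by (force simp: body_tvars_def tvars_def)
  then have "x \<in> tvars (head r)" using assms(1) by (auto simp: connected_rule_def)
  then obtain t' where t': "atime (head r) = Some t'" "x \<in> tvars_tterm t'"
    by (auto simp: tvars_def split: option.splits)
  then have "inst_t st t' = st x + toff t'" for st by (cases t') auto
  then show ?thesis using that[OF t'(1)] x(2) by simp
qed

definition shift_bound :: "rule set \<Rightarrow> nat \<Rightarrow> bool" where
  "shift_bound \<Pi> K \<longleftrightarrow> (\<forall>r\<in>\<Pi>. \<forall>a\<in>set (body r). \<forall>t t'. atime a = Some t \<longrightarrow> atime (head r) = Some t' \<longrightarrow>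
     \<bar>toff t - toff t'\<bar> \<le> int K)"

lemma shift_bound_ex:
  assumes "finite \<Pi>"
  shows "\<exists>K. shift_bound \<Pi> K"
proof -
  \<comment> \<open>For atoms without time \<open>the None\<close> contributes unspecified values,
    which can only enlarge the maximum.\<close>
  let ?f = "\<lambda>r a. nat \<bar>toff (the (atime a)) - toff (the (atime (head r)))\<bar>"
  let ?S = "\<Union>r\<in>\<Pi>. ?f r ` set (body r)"
  have fin: "finite ?S" using assms by auto
  have "\<bar>toff t - toff t'\<bar> \<le> int (Max ?S)"
    if "r \<in> \<Pi>" "a \<in> set (body r)" "atime a = Some t" "atime (head r) = Some t'" for r a t t'
  proof -
    have "nat \<bar>toff t - toff t'\<bar> \<in> ?S" using that by force
    then have "nat \<bar>toff t - toff t'\<bar> \<le> Max ?S" using fin by (rule Max_ge[rotated])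
    then show ?thesis by linarith
  qed
  then show ?thesis unfolding shift_bound_def by blast
qed

text \<open>\<open>1 \<le> b\<close> lets a derivation that consists of a single fact meet the bound
  \<open>b ^ d\<close> at every depth.\<close>

lemma body_bound_ex: "finite \<Pi> \<Longrightarrow> \<exists>b\<ge>1. \<forall>r\<in>\<Pi>. length (body r) \<le> b"
proof -
  assume "finite \<Pi>"
  then have "\<forall>r\<in>\<Pi>. length (body r) \<le> Max (insert 1 ((\<lambda>r. length (body r)) ` \<Pi>))" by auto
  then show ?thesis using \<open>finite \<Pi>\<close> by (intro exI[of _ "Max (insert 1 ((\<lambda>r. length (body r)) ` \<Pi>))"]) auto
qed

text \<open>A tree of height \<open>d\<close> and branching \<open>b\<close> has at most
  \<open>b ^ d\<close> leaves, and each edge moves the time by at most \<open>K\<close>. A temporal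
  body atom forces a temporal head, so a temporal leaf has a temporal root.\<close>

lemma der_leaves:
  assumes con: "connected \<Pi>" and ntp: "no_time_points \<Pi>" and K: "shift_bound \<Pi> K"
    and b: "1 \<le> b" "\<And>r. r \<in> \<Pi> \<Longrightarrow> length (body r) \<le> b"
  shows "der \<Pi> E d g \<Longrightarrow> \<exists>F\<subseteq>E. finite F \<and> card F \<le> b ^ d \<and> der \<Pi> F d g \<and>
    (\<forall>f\<in>F. gpred f \<in> insert (gpred g) (preds_of \<Pi>) \<and>
      (\<forall>t. gtime f = Some t \<longrightarrow> (\<exists>t'. gtime g = Some t' \<and> \<bar>t - t'\<bar> \<le> int (K * d))))"
proof (induction d arbitrary: g)
  case 0
  then show ?case by (intro exI[of _ "{g}"]) auto
next
  case (Suc d)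
  show ?case
  proof (cases "g \<in> E")
    case True
    then show ?thesis using b(1) by (intro exI[of _ "{g}"]) auto
  next
    case False
    then obtain r so st where r: "r \<in> \<Pi>" "inst so st (head r) = g"
      "\<forall>a\<in>set (body r). der \<Pi> E d (inst so st a)" using Suc.prems by auto
    let ?G = "\<lambda>a F. F \<subseteq> E \<and> finite F \<and> card F \<le> b ^ d \<and> der \<Pi> F d (inst so st a) \<and>
      (\<forall>f\<in>F. gpred f \<in> insert (apred a) (preds_of \<Pi>) \<and>
        (\<forall>t. gtime f = Some t \<longrightarrow> (\<exists>t'. gtime (inst so st a) = Some t' \<and> \<bar>t - t'\<bar> \<le> int (K * d))))"
    have "\<exists>F. ?G a F" if "a \<in> set (body r)" for a
      using Suc.IH[of "inst so st a"] r(3) that by (simp add: inst_def)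
    then obtain F where F: "\<And>a. a \<in> set (body r) \<Longrightarrow> ?G a (F a)" by metis
    let ?F = "\<Union>a\<in>set (body r). F a"
    have "card ?F \<le> (\<Sum>a\<in>set (body r). card (F a))" by (rule card_UN_le) simp
    also have "\<dots> \<le> (\<Sum>a\<in>set (body r). b ^ d)" by (rule sum_mono) (use F in blast)
    also have "\<dots> = card (set (body r)) * b ^ d" by simp
    also have "\<dots> \<le> b ^ Suc d"
      using b(2)[OF r(1)] card_length[of "body r"] by (simp add: mult_le_mono1)
    finally have card: "card ?F \<le> b ^ Suc d" .
    have "der \<Pi> ?F d (inst so st a)" if "a \<in> set (body r)" for a
      using F[OF that] that by (auto elim!: der_mono)
    with r(1,2) have "der \<Pi> ?F (Suc d) g" by (rule der_step)
    moreover have "gpred f \<in> insert (gpred g) (preds_of \<Pi>) \<and>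
      (\<forall>t. gtime f = Some t \<longrightarrow> (\<exists>t'. gtime g = Some t' \<and> \<bar>t - t'\<bar> \<le> int (K * Suc d)))" if "f \<in> ?F" for f
    proof -
      obtain a where a: "a \<in> set (body r)" "f \<in> F a" using \<open>f \<in> ?F\<close> by blast
      have "apred a \<in> preds_of \<Pi>" using a(1) r(1) by (auto simp: preds_of_def)
      then have "gpred f \<in> preds_of \<Pi>" using F[OF a(1)] a(2) by auto
      moreover have "\<exists>t'. gtime g = Some t' \<and> \<bar>t - t'\<bar> \<le> int (K * Suc d)" if t: "gtime f = Some t" for t
      proof -
        obtain u where u: "gtime (inst so st a) = Some u" "\<bar>t - u\<bar> \<le> int (K * d)"
          using F[OF a(1)] a(2) t by blast
        then obtain v where v: "atime a = Some v" "u = inst_t st v" by (auto simp: inst_def)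
        have "no_tpoint v" "\<And>t. atime (head r) = Some t \<Longrightarrow> no_tpoint t"
          using ntp r(1) a(1) v(1) by (auto simp: no_time_points_def atom_no_tpoint_def)
        moreover have "connected_rule r" using con r(1) by (simp add: connected_def)
        ultimately obtain v' where v': "atime (head r) = Some v'" "inst_t st v - inst_t st v' = toff v - toff v'"
          using a(1) v(1) time_shift by metis
        have "\<bar>toff v - toff v'\<bar> \<le> int K" using K r(1) a(1) v(1) v'(1) by (auto simp: shift_bound_def)
        moreover have "gtime g = Some (inst_t st v')" using r(2) v'(1) by (auto simp: inst_def)
        ultimately show ?thesis using u(2) v(2) v'(2) by (auto simp: algebra_simps)
      qed
      ultimately show ?thesis by blast
    qed
    moreover have "?F \<subseteq> E" "finite ?F" using F by auto
    ultimately show ?thesis using card by blast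
  qed
qed

text \<open>By genericity the objects of an update may be renamed into any sufficiently large set of
  objects that occur neither in the history nor in the program.\<close>

lemma renaming_ex:
  fixes S X Y :: "nat set"
  assumes "finite X" "card X \<le> card Y" "finite Y" "Y \<inter> S = {}"
  obtains \<rho> where "\<And>x. x \<in> S \<Longrightarrow> \<rho> x = x" "inj_on \<rho> (S \<union> X)" "\<rho> ` X \<subseteq> S \<union> Y"
proof -
  obtain h where h: "inj_on h X" "h ` X \<subseteq> Y" using card_le_inj[OF assms(1,3,2)] by blast
  define \<rho> where "\<rho> x = (if x \<in> S then x else h x)" for x
  have "inj_on \<rho> (S \<union> X)"
    using h assms(4) unfolding inj_on_def \<rho>_def by (auto; blast)
  then show ?thesis using h by (intro that[of \<rho>]) (auto simp: \<rho>_def)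
qed

definition arity_bound :: "rule set \<Rightarrow> nat \<Rightarrow> bool" where
  "arity_bound \<Pi> A \<longleftrightarrow> (\<forall>P\<in>preds_of \<Pi>. parity P \<le> A)"

lemma arity_bound_ex: "finite \<Pi> \<Longrightarrow> \<exists>A. arity_bound \<Pi> A"
proof -
  assume "finite \<Pi>"
  then have "finite (parity ` preds_of \<Pi>)" by (simp add: preds_of_def)
  then show ?thesis unfolding arity_bound_def by (meson Max_ge imageI)
qed

definition update_atom :: "rule set \<Rightarrow> nat set \<Rightarrow> int \<Rightarrow> int \<Rightarrow> nat \<Rightarrow> gatom \<Rightarrow> bool" where
  "update_atom \<Pi> Dom \<tau>in \<tau> K u \<longleftrightarrow> gpred u \<in> preds_of \<Pi> \<and> \<not> pidb (gpred u) \<and> wf_gatom u \<and>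
     set (gobjs u) \<subseteq> Dom \<and> (\<exists>t. gtime u = Some t \<and> t > \<tau>in \<and> \<bar>t - \<tau>\<bar> \<le> int K)"

text \<open>Only updates of bounded size near the query time matter: a violation of forgetting uses
  boundedly many facts, one of which is a forgotten fact.\<close>

theorem forget_witness:
  assumes Q: "temporal_query (P, \<Pi>)" and con: "connected \<Pi>" and ntp: "no_time_points \<Pi>"
    and N: "\<And>E d g. gpred g = P \<Longrightarrow> der \<Pi> E d g \<Longrightarrow> der \<Pi> E N g"
    and K: "shift_bound \<Pi> K" and b: "1 \<le> b" "\<And>r. r \<in> \<Pi> \<Longrightarrow> length (body r) \<le> b"
    and A: "arity_bound \<Pi> A"
    and D: "history \<tau>in D"
    and near: "\<And>f t \<tau>. f \<in> D \<Longrightarrow> gtime f = Some t \<Longrightarrow> \<bar>t - \<tau>\<bar> \<le> int (K * N) \<Longrightarrow> near \<tau>"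
    and Y: "finite Y" "b ^ N * A \<le> card Y" "Y \<inter> (objs D \<union> consts_of \<Pi>) = {}"
  shows "\<not> forget (P, \<Pi>) D \<tau>in \<tau>out \<tau>mem \<longleftrightarrow>
    (\<exists>\<tau> os us. \<tau>out \<le> \<tau> \<and> near \<tau> \<and>
      length us \<le> b ^ N \<and>
      (\<forall>u\<in>set us. update_atom \<Pi> (objs D \<union> consts_of \<Pi> \<union> Y) \<tau>in \<tau> (K * N) u) \<and>
      set os \<subseteq> objs D \<union> consts_of \<Pi> \<union> Y \<and> length os = parity P \<and>
      der \<Pi> (D \<union> set us) N (GAtom P os (Some \<tau>)) \<and>
      \<not> der \<Pi> (restrict_after D \<tau>mem \<union> set us) N (GAtom P os (Some \<tau>)))"
    (is "_ \<longleftrightarrow> (\<exists>\<tau> os us. ?W \<tau> os us)")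
proof -
  let ?R = "restrict_after D \<tau>mem" and ?S = "objs D \<union> consts_of \<Pi>"
  have RD: "?R \<subseteq> D" by (auto simp: restrict_after_def)
  have wfr: "\<And>r. r \<in> \<Pi> \<Longrightarrow> wf_rule r" and P: "pidb P"
    using Q by (auto simp: temporal_query_def program_def)
  have ans: "os \<in> answers (P, \<Pi>) E \<tau> \<longleftrightarrow> der \<Pi> E N (GAtom P os (Some \<tau>))" for E os \<tau>
    using N[of "GAtom P os (Some \<tau>)"] by (auto simp: answers_def entails_der)
  show ?thesis
  proof
    assume "\<exists>\<tau> os us. ?W \<tau> os us"
    then obtain \<tau> os us where W: "?W \<tau> os us" by blast
    have "update \<tau>in (set us)"
      using W by (auto simp: update_def dataset_def update_atom_def)
    then show "\<not> forget (P, \<Pi>) D \<tau>in \<tau>out \<tau>mem"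
      using W ans unfolding forget_def by blast
  next
    assume "\<not> forget (P, \<Pi>) D \<tau>in \<tau>out \<tau>mem"
    then obtain U \<tau> where U: "update \<tau>in U" "\<tau>out \<le> \<tau>"
      "answers (P, \<Pi>) (D \<union> U) \<tau> \<noteq> answers (P, \<Pi>) (?R \<union> U) \<tau>"
      unfolding forget_def by blast
    \<comment> \<open>By monotonicity only the other inclusion can fail.\<close>
    have "answers (P, \<Pi>) (?R \<union> U) \<tau> \<subseteq> answers (P, \<Pi>) (D \<union> U) \<tau>"
      using RD by (auto simp: ans elim!: der_mono)
    then obtain os where "os \<in> answers (P, \<Pi>) (D \<union> U) \<tau>" "os \<notin> answers (P, \<Pi>) (?R \<union> U) \<tau>"
      using U(3) by blast
    then have pos: "der \<Pi> (D \<union> U) N (GAtom P os (Some \<tau>))" and neg: "\<not> der \<Pi> (?R \<union> U) N (GAtom P os (Some \<tau>))"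
      by (auto simp: ans)
    obtain F where F: "F \<subseteq> D \<union> U" "finite F" "card F \<le> b ^ N" "der \<Pi> F N (GAtom P os (Some \<tau>))"
      and F': "\<And>f. f \<in> F \<Longrightarrow> gpred f \<in> insert P (preds_of \<Pi>)"
        "\<And>f t. f \<in> F \<Longrightarrow> gtime f = Some t \<Longrightarrow> \<bar>t - \<tau>\<bar> \<le> int (K * N)"
      using der_leaves[OF con ntp K b pos] by auto
    \<comment> \<open>Only the update is cut down to the facts used. Shrinking it preserves the
      failure on the restricted side.\<close>
    define V where "V = F \<inter> U"
    have V: "finite V" "card V \<le> b ^ N" "V \<subseteq> U"
      using F card_mono[of F V] by (auto simp: V_def)
    have posV: "der \<Pi> (D \<union> V) N (GAtom P os (Some \<tau>))"
      using F(1) by (intro der_mono[OF F(4)]) (auto simp: V_def)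
    have negV: "\<not> der \<Pi> (?R \<union> V) N (GAtom P os (Some \<tau>))"
      using neg V(3) der_mono[of \<Pi> "?R \<union> V" N _ "?R \<union> U"] by blast
    have old: "near \<tau>"
    proof -
      \<comment> \<open>Some leaf is a forgotten fact; it is temporal and ties the query time to a
        time of the history.\<close>
      have "\<not> F \<subseteq> ?R \<union> V" using negV der_mono[OF F(4)] by blast
      then obtain f where f: "f \<in> F" "f \<in> D" "f \<notin> ?R" using F(1) by (auto simp: V_def)
      then obtain t where "gtime f = Some t" by (auto simp: restrict_after_def)
      then show ?thesis using f F'(2) near by blast
    qed
    \<comment> \<open>Excludes the case, left open by \<open>der_leaves\<close>, that a leaf has the
      query predicate itself: \<open>P\<close> is intensional, while the facts are
      extensional.\<close>
    have edb: "gpred f \<noteq> P" if "f \<in> D \<union> U" for f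
      using that D U(1) P by (auto simp: history_def update_def dataset_def)
    have uV: "gpred u \<in> preds_of \<Pi>" "\<not> pidb (gpred u)" "wf_gatom u"
        "\<exists>t. gtime u = Some t \<and> t > \<tau>in \<and> \<bar>t - \<tau>\<bar> \<le> int (K * N)" if "u \<in> V" for u
      using that F'(1)[of u] F'(2)[of u] edb[of u] U(1) by (auto simp: V_def update_def dataset_def)
    have lenV: "length (gobjs u) \<le> A" if "u \<in> V" for u
      using uV(1,3)[OF that] A by (auto simp: wf_gatom_def arity_bound_def)
    \<comment> \<open>The origin of the size of \<open>Y\<close>: at most \<open>b ^ N\<close>
      update facts with at most \<open>A\<close> objects each.\<close>
    have "card (objs V) \<le> (\<Sum>u\<in>V. card (set (gobjs u)))"
      unfolding objs_def by (rule card_UN_le) (rule V(1))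
    also have "\<dots> \<le> (\<Sum>u\<in>V. A)" by (rule sum_mono) (use lenV card_length le_trans in blast)
    also have "\<dots> \<le> b ^ N * A" using V(2) by simp
    finally have card: "card (objs V) \<le> card Y" using Y(2) by simp
    have "finite (objs V)" using V(1) by (simp add: objs_def)
    then obtain \<rho> where \<rho>: "\<And>x. x \<in> ?S \<Longrightarrow> \<rho> x = x" "inj_on \<rho> (?S \<union> objs V)" "\<rho> ` objs V \<subseteq> ?S \<union> Y"
      using renaming_ex[OF _ card Y(1,3)] by blast
    \<comment> \<open>The inverse renaming carries a hypothetical derivation over the renamed facts
      back to the original ones; the negative half of the violation needs this direction.\<close>
    define \<sigma> where "\<sigma> = inv_into (?S \<union> objs V) \<rho>"
    have \<sigma>: "\<sigma> (\<rho> x) = x" if "x \<in> ?S \<union> objs V" for x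
      unfolding \<sigma>_def using \<rho>(2) that by (rule inv_into_f_f)
    have \<sigma>c: "\<sigma> c = c" if "c \<in> consts_of \<Pi>" for c
      using \<sigma>[of c] \<rho>(1)[of c] that by simp
    have idD: "hom \<rho> ` X = X" if "X \<subseteq> D" for X
    proof -
      have "hom \<rho> f = f" if "f \<in> X" for f
        using that \<open>X \<subseteq> D\<close> by (intro hom_id \<rho>(1)) (auto simp: objs_def)
      then show ?thesis by force
    qed
    have os: "set os \<subseteq> ?S \<union> objs V"
      using der_objs[OF wfr posV] by (auto simp: objs_def)
    obtain us where us: "set us = hom \<rho> ` V" "length us = card (hom \<rho> ` V)"
      using V(1) finite_distinct_list[of "hom \<rho> ` V"] distinct_card by (metis finite_imageI)
    have pos': "der \<Pi> (D \<union> set us) N (GAtom P (map \<rho> os) (Some \<tau>))"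
      using der_hom[of \<Pi> \<rho>, OF _ posV] \<rho>(1) idD[of D] by (simp add: image_Un us(1) hom_def)
    have neg': "\<not> der \<Pi> (?R \<union> set us) N (GAtom P (map \<rho> os) (Some \<tau>))"
    proof
      assume "der \<Pi> (?R \<union> set us) N (GAtom P (map \<rho> os) (Some \<tau>))"
      then have "der \<Pi> (hom \<rho> ` (?R \<union> V)) N (hom \<rho> (GAtom P os (Some \<tau>)))"
        using idD[OF RD] by (simp add: image_Un us(1) hom_def)
      from der_hom[of \<Pi> \<sigma>, OF \<sigma>c this]
      have *: "der \<Pi> (hom \<sigma> ` hom \<rho> ` (?R \<union> V)) N (hom \<sigma> (hom \<rho> (GAtom P os (Some \<tau>))))" .
      have "hom \<sigma> (hom \<rho> f) = f" if "set (gobjs f) \<subseteq> ?S \<union> objs V" for f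
        unfolding hom_hom using that \<sigma> by (intro hom_id) auto
      moreover have "set (gobjs f) \<subseteq> ?S \<union> objs V" if "f \<in> ?R \<union> V" for f
        using that RD by (auto simp: objs_def)
      ultimately have "hom \<sigma> ` hom \<rho> ` (?R \<union> V) = ?R \<union> V"
        "hom \<sigma> (hom \<rho> (GAtom P os (Some \<tau>))) = GAtom P os (Some \<tau>)"
        using os by (force simp: image_image)+
      with * negV show False by simp
    qed
    have "update_atom \<Pi> (?S \<union> Y) \<tau>in \<tau> (K * N) u" if "u \<in> set us" for u
    proof -
      obtain v where v: "v \<in> V" "u = hom \<rho> v" using \<open>u \<in> set us\<close> us(1) by blast
      have "set (gobjs u) \<subseteq> ?S \<union> Y" using v \<rho>(3) by (force simp: objs_def)
      then show ?thesis using uV[OF v(1)] v(2) by (auto simp: update_atom_def wf_gatom_def)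
    qed
    moreover have "length us \<le> b ^ N"
      using us(2) V card_image_le[of V "hom \<rho>"] by simp
    moreover have "set (map \<rho> os) \<subseteq> ?S \<union> Y" using os \<rho>(1,3) by force
    moreover have "length (map \<rho> os) = parity P"
    proof -
      have "\<And>f. f \<in> D \<union> V \<Longrightarrow> wf_gatom f"
        using D uV(3) by (auto simp: history_def dataset_def)
      from der_wf[OF wfr this posV] show ?thesis by (simp add: wf_gatom_def)
    qed
    ultimately have "?W \<tau> (map \<rho> os) us" using U(2) old pos' neg' by blast
    then show "\<exists>\<tau> os us. ?W \<tau> os us" by blast
  qed
qed

section \<open>Objects and times in a word\<close>

definition at :: "nat list \<Rightarrow> nat \<Rightarrow> nat list \<Rightarrow> bool" where
  "at w p s \<longleftrightarrow> (\<exists>r. drop p w = s @ r)"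

lemma at_Nil [simp]: "at w p []"
  by (simp add: at_def)

lemma sy_Suc: "0 < a \<Longrightarrow> sy w p = a \<longleftrightarrow> drop p w = a # drop (Suc p) w"
  by (cases "p < length w") (auto simp: sy_def Cons_nth_drop_Suc[symmetric])

lemma at_Cons: "0 < a \<Longrightarrow> at w p (a # s) \<longleftrightarrow> sy w p = a \<and> at w (Suc p) s"
  by (cases "p < length w") (auto simp: at_def sy_def Cons_nth_drop_Suc[symmetric])

lemma drop_sy: "drop p w = s @ r \<Longrightarrow> k < length s \<Longrightarrow> sy w (p + k) = s ! k"
proof -
  assume *: "drop p w = s @ r" "k < length s"
  then have "length s + length r = length w - p" by (metis length_append length_drop)
  with * have "p + k < length w" by linarith
  moreover have "drop p w ! k = s ! k" using * by (simp add: nth_append)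
  ultimately show ?thesis by (simp add: sy_def)
qed

lemma drop_length: "drop p w = s @ r \<Longrightarrow> s \<noteq> [] \<Longrightarrow> p + length s \<le> length w"
proof -
  assume *: "drop p w = s @ r" "s \<noteq> []"
  then have "length s + length r = length w - p" by (metis length_append length_drop)
  with * show ?thesis by (cases "length s") auto
qed

lemma drop_eqI:
  assumes "\<And>k. k < length s \<Longrightarrow> sy w (p + k) = s ! k" "0 \<notin> set s"
  shows "\<exists>r. drop p w = s @ r"
proof (cases "s = []")
  case False
  have len: "p + k < length w" if "k < length s" for k
    using assms(1)[OF that] assms(2) nth_mem[OF that] by (auto simp: sy_def split: if_splits)
  have "take (length s) (drop p w) = s"
  proof (rule nth_equalityI)
    have "length s \<le> length w - p" using len[of "length s - 1"] False by (cases s) auto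
    then show "length (take (length s) (drop p w)) = length s" by simp
    fix k assume "k < length (take (length s) (drop p w))"
    then have k: "k < length s" by simp
    show "take (length s) (drop p w) ! k = s ! k"
      using assms(1)[OF k] len[OF k] k by (simp add: sy_def)
  qed
  then show ?thesis by (metis append_take_drop_id)
qed auto

text \<open>The tokens that begin at \<open>p\<close> and at \<open>q\<close> are equal, and
  \<open>p'\<close> is the position behind the first one. One relation serves to compare objects
  and, with \<open>q = p\<close>, to skip a token.\<close>

definition tok :: "nat list \<Rightarrow> nat \<Rightarrow> nat \<Rightarrow> nat \<Rightarrow> bool" where
  "tok w p q p' \<longleftrightarrow> (\<exists>s r r'. 3 \<notin> set s \<and> drop p w = s @ 3 # r \<and> drop q w = s @ 3 # r' \<and>
     p' = p + length s + 1)"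

text \<open>A form with quantifiers over positions only. The sums receive names \<open>x\<close> and
  \<open>y\<close> because addition is available just as a relation between heads.\<close>

lemma tok_iff:
  assumes w: "word w"
  shows "tok w p q p' \<longleftrightarrow> (\<exists>d\<le>length w. p' = p + d + 1 \<and> (\<forall>k\<le>d.
    \<exists>x\<le>length w. \<exists>y\<le>length w. p + k = x \<and> q + k = y \<and> sy w x = sy w y \<and> (sy w x = 3 \<longleftrightarrow> k = d)))"
    (is "_ \<longleftrightarrow> (\<exists>d\<le>length w. ?P d)")
proof
  assume "tok w p q p'"
  then obtain s r r' where s: "3 \<notin> set s" "drop p w = (s @ [3]) @ r" "drop q w = (s @ [3]) @ r'"
    "p' = p + length s + 1" by (auto simp: tok_def)
  have no3: "s ! k \<noteq> 3" if "k < length s" for k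
    using nth_mem[OF that] s(1) by metis
  have *: "p + k \<le> length w \<and> q + k \<le> length w \<and> sy w (p + k) = sy w (q + k) \<and> (sy w (p + k) = 3 \<longleftrightarrow> k = length s)"
    if "k \<le> length s" for k
    using drop_sy[OF s(2), of k] drop_sy[OF s(3), of k] drop_length[OF s(2)] drop_length[OF s(3)] that no3
    by (auto simp: nth_append less_Suc_eq_le)
  have "?P (length s)"
  proof (intro conjI allI impI)
    show "p' = p + length s + 1" by (rule s(4))
    fix k assume "k \<le> length s"
    from *[OF this] show "\<exists>x\<le>length w. \<exists>y\<le>length w. p + k = x \<and> q + k = y \<and> sy w x = sy w y \<and>
        (sy w x = 3 \<longleftrightarrow> k = length s)" by blast
  qed
  moreover have "length s \<le> length w" using drop_length[OF s(2)] by simp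
  ultimately show "\<exists>d\<le>length w. ?P d" by blast
next
  assume "\<exists>d\<le>length w. ?P d"
  then obtain d where d: "p' = p + d + 1"
    and *: "\<And>k. k \<le> d \<Longrightarrow> sy w (p + k) = sy w (q + k) \<and> (sy w (p + k) = 3 \<longleftrightarrow> k = d)" by blast
  let ?s = "map (\<lambda>k. sy w (p + k)) [0..<Suc d]"
  have pd: "p + d < length w" using *[of d] by (auto simp: sy_def split: if_splits)
  have nz: "0 \<notin> set ?s"
  proof -
    have nz: "sy w (p + k) \<noteq> 0" if "k < Suc d" for k using sy_word(2)[OF w, of "p + k"] that pd by auto
    show ?thesis
    proof
      assume "0 \<in> set ?s"
      then obtain k where "k < Suc d" "sy w (p + k) = 0" by (auto simp del: upt_Suc)
      with nz show False by blast
    qed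
  qed
  obtain r where r: "drop p w = ?s @ r"
    using drop_eqI[OF _ nz, of w p] by (auto simp del: upt_Suc)
  have "sy w (q + k) = ?s ! k" if "k < length ?s" for k
    using *[of k] that by (simp del: upt_Suc)
  from drop_eqI[OF this nz] obtain r' where r': "drop q w = ?s @ r'" by blast
  have "3 \<notin> set (map (\<lambda>k. sy w (p + k)) [0..<d])"
  proof
    assume "3 \<in> set (map (\<lambda>k. sy w (p + k)) [0..<d])"
    then obtain k where "k < d" "sy w (p + k) = 3" by auto
    with *[of k] show False by simp
  qed
  moreover have "?s = map (\<lambda>k. sy w (p + k)) [0..<d] @ [3]" using *[of d] by simp
  ultimately show "tok w p q p'"
    unfolding tok_def using r r' d by (intro exI[of _ "map (\<lambda>k. sy w (p + k)) [0..<d]"] exI[of _ r] exI[of _ r']) auto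
qed

definition unary :: "nat list \<Rightarrow> nat \<Rightarrow> nat \<Rightarrow> bool" where
  "unary w p a \<longleftrightarrow> (\<exists>r. drop p w = replicate a 4 @ 3 # r)"

lemma unary_iff: "unary w p a \<longleftrightarrow> (\<forall>d\<le>a. \<exists>x\<le>length w. p + d = x \<and> sy w x = (if d = a then 3 else 4))"
proof
  assume "unary w p a"
  then obtain r where r: "drop p w = (replicate a 4 @ [3]) @ r" by (auto simp: unary_def)
  show "\<forall>d\<le>a. \<exists>x\<le>length w. p + d = x \<and> sy w x = (if d = a then 3 else 4)"
    using drop_sy[OF r] drop_length[OF r] by (auto simp: nth_append)
next
  assume *: "\<forall>d\<le>a. \<exists>x\<le>length w. p + d = x \<and> sy w x = (if d = a then 3 else 4)"
  have "\<exists>r. drop p w = (replicate a 4 @ [3]) @ r"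
    by (rule drop_eqI) (use * in \<open>auto simp: nth_append\<close>)
  then show "unary w p a" by (simp add: unary_def)
qed

lemma unary_le: "unary w p a \<Longrightarrow> a \<le> length w"
proof -
  assume "unary w p a"
  then obtain r where r: "drop p w = (replicate a 4 @ [3]) @ r" by (auto simp: unary_def)
  from drop_length[OF r] show ?thesis by simp
qed

definition time_at :: "nat list \<Rightarrow> nat \<Rightarrow> int \<Rightarrow> bool" where
  "time_at w p z \<longleftrightarrow> (\<exists>r. drop p w = enc_int z @ 3 # r)"

text \<open>The sign is split off as a Boolean so that the magnitude can be held by a head.
  \<open>a \<noteq> 0\<close> rules out a negative zero, which \<open>enc_int\<close> never
  produces.\<close>

definition signed_at :: "nat list \<Rightarrow> bool \<Rightarrow> nat \<Rightarrow> nat \<Rightarrow> bool" where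
  "signed_at w neg p a \<longleftrightarrow> (if neg then sy w p = 5 \<and> a \<noteq> 0 \<and> unary w (Suc p) a else unary w p a)"

definition signed :: "bool \<Rightarrow> nat \<Rightarrow> int" where
  "signed neg a = (if neg then - int a else int a)"

lemma time_at_signed: "time_at w p z \<longleftrightarrow> (\<exists>neg a. signed_at w neg p a \<and> z = signed neg a)"
proof
  assume z: "time_at w p z"
  show "\<exists>neg a. signed_at w neg p a \<and> z = signed neg a"
  proof (cases "z < 0")
    case True
    then obtain r where r: "drop p w = 5 # (replicate (nat (- z)) 4 @ 3 # r)"
      using z by (auto simp: time_at_def enc_int_def)
    then have "sy w p = 5" "drop (Suc p) w = replicate (nat (- z)) 4 @ 3 # r"
      using drop_sy[of p w "[5]" _ 0] by (auto simp: drop_Suc tl_drop[symmetric])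
    then show ?thesis using True
      by (intro exI[of _ True] exI[of _ "nat (- z)"]) (auto simp: signed_at_def unary_def signed_def)
  next
    case False
    then show ?thesis using z
      by (intro exI[of _ False] exI[of _ "nat z"]) (auto simp: time_at_def enc_int_def signed_at_def unary_def signed_def)
  qed
next
  assume "\<exists>neg a. signed_at w neg p a \<and> z = signed neg a"
  then obtain neg a where *: "signed_at w neg p a" "z = signed neg a" by blast
  show "time_at w p z"
  proof (cases neg)
    case True
    with * show ?thesis
      using sy_Suc[of 5 w p] by (auto simp: signed_at_def signed_def time_at_def enc_int_def unary_def)
  next
    case False
    with * show ?thesis
      by (auto simp: signed_at_def signed_def time_at_def enc_int_def unary_def)
  qed
qed

text \<open>The only comparison of times on the word. Equality up to an offset is two instances of
  it, a strict inequality a negated one.\<close>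

definition time_le :: "int \<Rightarrow> nat list \<Rightarrow> nat \<Rightarrow> nat \<Rightarrow> bool" where
  "time_le c w p q \<longleftrightarrow> (\<exists>z z'. time_at w p z \<and> time_at w q z' \<and> z \<le> z' + c)"

lemma replicate_separator: "replicate a (4::nat) @ 3 # r = replicate b 4 @ 3 # r' \<Longrightarrow> a = b"
proof (induction a arbitrary: b)
  case 0
  then show ?case by (cases b) auto
next
  case (Suc a)
  then show ?case by (cases b) auto
qed

lemma time_at_unique: "time_at w p z \<Longrightarrow> time_at w p z' \<Longrightarrow> z = z'"
proof -
  assume "time_at w p z" "time_at w p z'"
  then obtain r r' where eq: "enc_int z @ 3 # r = enc_int z' @ 3 # r'"
    unfolding time_at_def by metis
  have 54: "(5::nat) # x \<noteq> replicate a 4 @ 3 # y" for x a y by (cases a) auto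
  consider "z < 0" "z' < 0" | "z < 0" "\<not> z' < 0" | "\<not> z < 0" "z' < 0" | "\<not> z < 0" "\<not> z' < 0" by blast
  then show ?thesis
  proof cases
    case 1
    then have "replicate (nat (- z)) 4 @ 3 # r = replicate (nat (- z')) 4 @ 3 # r'"
      using eq by (simp add: enc_int_def)
    from replicate_separator[OF this] 1 show ?thesis by linarith
  next
    case 2
    then show ?thesis using eq 54 by (simp add: enc_int_def)
  next
    case 3
    then show ?thesis using eq[symmetric] 54 by (simp add: enc_int_def)
  next
    case 4
    then have "replicate (nat z) 4 @ 3 # r = replicate (nat z') 4 @ 3 # r'"
      using eq by (simp add: enc_int_def)
    from replicate_separator[OF this] 4 show ?thesis by linarith
  qed
qed

section \<open>Definability of arithmetic, tokens and times\<close>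

context words
begin

lemma Def_zero: "j < m \<Longrightarrow> Def m (\<lambda>i e. e j = 0)"
  by (rule Def_cong[OF Def_plus[of j m j j]]) auto

lemma Def_le: "j < m \<Longrightarrow> k < m \<Longrightarrow> Def m (\<lambda>i e. e j \<le> e k)"
proof -
  assume *: "j < m" "k < m"
  have "Def m (\<lambda>i e. \<exists>x\<le>len i. e j + x = e k)"
    by (rule Def_ex, rule Def_plus) (use * in auto)
  then show ?thesis
  proof (rule Def_cong)
    fix i e assume "ok i e"
    then have "e k \<le> len i" by (rule ok_le)
    then show "(e j \<le> e k) = (\<exists>x\<le>len i. e j + x = e k)"
      by (auto intro!: exI[of _ "e k - e j"])
  qed
qed

lemma Def_less: "j < m \<Longrightarrow> k < m \<Longrightarrow> Def m (\<lambda>i e. e j < e k)"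
  by (rule Def_cong[OF Def_not[OF Def_le[of k m j]]]) auto

lemma Def_Suc: "j < m \<Longrightarrow> k < m \<Longrightarrow> Def m (\<lambda>i e. e k = Suc (e j))"
proof -
  assume *: "j < m" "k < m"
  have "Def m (\<lambda>i e. e j < e k \<and> (\<forall>x\<le>len i. x \<le> e j \<or> e k \<le> x))"
    by (intro Def_conj Def_less Def_all Def_disj Def_le) (use * in auto)
  then show ?thesis
  proof (rule Def_cong)
    fix i e assume "ok i e"
    then have "e k \<le> len i" by (rule ok_le)
    then show "(e k = Suc (e j)) = (e j < e k \<and> (\<forall>x\<le>len i. x \<le> e j \<or> e k \<le> x))"
      by (auto dest!: spec[of _ "Suc (e j)"])
  qed
qed

lemma Def_is: "j < m \<Longrightarrow> Def m (\<lambda>i e. e j = c)"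
proof (induction c arbitrary: j m)
  case 0
  then show ?case by (rule Def_zero)
next
  case (Suc c)
  have "Def m (\<lambda>i e. \<exists>x\<le>len i. x = c \<and> e j = Suc x)"
    by (rule Def_ex, intro Def_conj Suc.IH Def_Suc) (use Suc.prems in auto)
  then show ?case
  proof (rule Def_cong)
    fix i e assume "ok i e"
    then have "e j \<le> len i" by (rule ok_le)
    then show "(e j = Suc c) = (\<exists>x\<le>len i. x = c \<and> e j = Suc x)" by auto
  qed
qed

lemma Def_plus_const: "j < m \<Longrightarrow> k < m \<Longrightarrow> Def m (\<lambda>i e. e k = e j + c)"
proof -
  assume *: "j < m" "k < m"
  have "Def m (\<lambda>i e. \<exists>x\<le>len i. x = c \<and> e j + x = e k)"
    by (rule Def_ex, intro Def_conj Def_is Def_plus) (use * in auto)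
  then show ?thesis
  proof (rule Def_cong)
    fix i e assume "ok i e"
    then have "e k \<le> len i" by (rule ok_le)
    then show "(e k = e j + c) = (\<exists>x\<le>len i. x = c \<and> e j + x = e k)" by auto
  qed
qed

text \<open>For \<open>c \<ge> 0\<close> the sum \<open>e k + c\<close> may lie beyond the word and
  is not formed; if \<open>e j\<close> exceeds \<open>e k\<close> at all, the excess is one of
  finitely many values. For negative \<open>c\<close> the constant is moved to the other side, where
  the sum has to be a position.\<close>

lemma Def_diff_le: "j < m \<Longrightarrow> k < m \<Longrightarrow> Def m (\<lambda>i e. int (e j) \<le> int (e k) + c)"
proof -
  assume *: "j < m" "k < m"
  show ?thesis
  proof (cases "0 \<le> c")
    case True
    have "Def m (\<lambda>i e. e j \<le> e k \<or> (\<exists>r\<in>{..nat c}. e j = e k + r))"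
      by (intro Def_disj Def_le Def_bex Def_plus_const) (use * in auto)
    then show ?thesis
    proof (rule Def_cong)
      fix i and e :: "nat \<Rightarrow> nat"
      show "(int (e j) \<le> int (e k) + c) = (e j \<le> e k \<or> (\<exists>r\<in>{..nat c}. e j = e k + r))"
        using True by (auto intro!: bexI[of _ "e j - e k"])
    qed
  next
    case False
    have "Def m (\<lambda>i e. \<exists>x\<le>len i. x = e j + nat (- c) \<and> x \<le> e k)"
      by (rule Def_ex, intro Def_conj Def_plus_const Def_le) (use * in auto)
    then show ?thesis
    proof (rule Def_cong)
      fix i e assume "ok i e"
      then have "e k \<le> len i" by (rule ok_le)
      then show "(int (e j) \<le> int (e k) + c) = (\<exists>x\<le>len i. x = e j + nat (- c) \<and> x \<le> e k)"
        using False by auto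
    qed
  qed
qed

text \<open>Arises from comparing numerals of opposite sign. Two positions whose sum is at most a
  constant take finitely many values, which are listed.\<close>

lemma Def_sum_le: "j < m \<Longrightarrow> k < m \<Longrightarrow> Def m (\<lambda>i e. int (e j) + int (e k) \<le> c)"
proof -
  assume *: "j < m" "k < m"
  have "Def m (\<lambda>i e. 0 \<le> c \<and> (\<exists>a\<in>{..nat c}. \<exists>b\<in>{..nat c - a}. e j = a \<and> e k = b))"
    by (intro Def_conj Def_const Def_bex Def_is) (use * in auto)
  then show ?thesis by (rule Def_cong) auto
qed

lemma Def_at: "0 \<notin> set s \<Longrightarrow> j < m \<Longrightarrow> Def m (\<lambda>i e. at (wd i) (e j) s)"
proof (induction s arbitrary: j m)
  case Nil
  then show ?case by (simp add: Def_const)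
next
  case (Cons a s)
  have "Def m (\<lambda>i e. sy (wd i) (e j) = a \<and> (\<exists>x\<le>len i. x = Suc (e j) \<and> at (wd i) x s))"
    by (intro Def_conj Def_sym Def_ex Def_Suc Cons.IH) (use Cons.prems in auto)
  then show ?case
  proof (rule Def_cong)
    fix i e assume "i \<in> I"
    have "Suc (e j) \<le> len i" if "sy (wd i) (e j) = a"
      using that Cons.prems sy_word(2)[OF word[OF \<open>i \<in> I\<close>], of "e j"] by auto
    then show "at (wd i) (e j) (a # s) = (sy (wd i) (e j) = a \<and> (\<exists>x\<le>len i. x = Suc (e j) \<and> at (wd i) x s))"
      using Cons.prems at_Cons[of a "wd i" "e j" s] by auto
  qed
qed

lemma Def_sym_eq: "j < m \<Longrightarrow> k < m \<Longrightarrow> Def m (\<lambda>i e. sy (wd i) (e j) = sy (wd i) (e k))"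
proof -
  assume *: "j < m" "k < m"
  have "Def m (\<lambda>i e. \<exists>a\<in>{..<10}. sy (wd i) (e j) = a \<and> sy (wd i) (e k) = a)"
    by (intro Def_bex Def_conj Def_sym) (use * in auto)
  then show ?thesis
    by (rule Def_cong) (use sy_word(1)[OF word] in auto)
qed

lemma Def_iff: "Def m \<phi> \<Longrightarrow> Def m \<psi> \<Longrightarrow> Def m (\<lambda>i e. \<phi> i e \<longleftrightarrow> \<psi> i e)"
proof -
  assume "Def m \<phi>" "Def m \<psi>"
  then have "Def m (\<lambda>i e. (\<phi> i e \<longrightarrow> \<psi> i e) \<and> (\<psi> i e \<longrightarrow> \<phi> i e))" by (intro Def_conj Def_imp)
  then show ?thesis by (rule Def_cong) blast
qed

lemma Def_tok: "j < m \<Longrightarrow> k < m \<Longrightarrow> l < m \<Longrightarrow> Def m (\<lambda>i e. tok (wd i) (e j) (e k) (e l))"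
proof -
  assume *: "j < m" "k < m" "l < m"
  have "Def m (\<lambda>i e. \<exists>d\<le>len i. (\<exists>z\<le>len i. z = e j + d \<and> e l = Suc z) \<and> (\<forall>c\<le>len i. c \<le> d \<longrightarrow>
    (\<exists>x\<le>len i. \<exists>y\<le>len i. e j + c = x \<and> e k + c = y \<and> sy (wd i) x = sy (wd i) y \<and> (sy (wd i) x = 3 \<longleftrightarrow> c = d))))"
    apply (rule Def_ex)
     apply (rule Def_conj)
      apply (rule Def_ex)
       apply (rule Def_conj)
        apply (rule Def_cong[OF Def_plus[of j _ m "Suc m"]])
           apply (use * in auto)[4]
       apply (rule Def_Suc)
        apply (use * in auto)[3]
     apply (rule Def_all)
      apply (rule Def_imp)
       apply (rule Def_le)
        apply (use * in auto)[2]
      apply (rule Def_ex)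
       apply (rule Def_ex)
        apply (intro Def_conj Def_plus Def_sym_eq Def_iff Def_sym Def_eq)
               apply (use * in auto)
    done
  then show ?thesis
  proof (rule Def_cong)
    fix i e assume i: "i \<in> I" and e: "ok i e"
    have el: "e l \<le> len i" using e by (rule ok_le)
    then have 1: "(e l = e j + d + 1) = (\<exists>z\<le>len i. z = e j + d \<and> e l = Suc z)" for d by auto
    have 2: "(\<forall>k\<le>d. Q k) = (\<forall>k\<le>len i. k \<le> d \<longrightarrow> Q k)" if "d \<le> len i" for d Q
      using that by (meson le_trans)
    show "tok (wd i) (e j) (e k) (e l) = (\<exists>d\<le>len i. (\<exists>z\<le>len i. z = e j + d \<and> e l = Suc z) \<and> (\<forall>c\<le>len i. c \<le> d \<longrightarrow>
      (\<exists>x\<le>len i. \<exists>y\<le>len i. e j + c = x \<and> e k + c = y \<and> sy (wd i) x = sy (wd i) y \<and> (sy (wd i) x = 3 \<longleftrightarrow> c = d))))"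
      unfolding tok_iff[OF word[OF i]]
    proof (intro ex_cong1 conj_cong)
      fix d assume d: "d \<le> len i"
      show "(e l = e j + d + 1) = (\<exists>z\<le>len i. z = e j + d \<and> e l = Suc z)" by (rule 1)
      show "(\<forall>c\<le>d. \<exists>x\<le>len i. \<exists>y\<le>len i. e j + c = x \<and> e k + c = y \<and> sy (wd i) x = sy (wd i) y \<and>
            (sy (wd i) x = 3 \<longleftrightarrow> c = d)) =
          (\<forall>c\<le>len i. c \<le> d \<longrightarrow> (\<exists>x\<le>len i. \<exists>y\<le>len i. e j + c = x \<and> e k + c = y \<and> sy (wd i) x = sy (wd i) y \<and>
            (sy (wd i) x = 3 \<longleftrightarrow> c = d)))"
        by (rule 2[OF d])
    qed (rule refl)
  qed
qed

lemma Def_unary: "j < m \<Longrightarrow> k < m \<Longrightarrow> Def m (\<lambda>i e. unary (wd i) (e j) (e k))"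
proof -
  assume *: "j < m" "k < m"
  have "Def m (\<lambda>i e. \<forall>d\<le>len i. d \<le> e k \<longrightarrow> (\<exists>x\<le>len i. e j + d = x \<and>
      (d = e k \<longrightarrow> sy (wd i) x = 3) \<and> (\<not> d = e k \<longrightarrow> sy (wd i) x = 4)))"
    apply (rule Def_all)
     apply (rule Def_imp)
      apply (rule Def_le)
       apply (use * in auto)[2]
     apply (rule Def_ex)
      apply (intro Def_conj Def_plus Def_imp Def_eq Def_sym Def_not)
               apply (use * in auto)
    done
  then show ?thesis
  proof (rule Def_cong)
    fix i e assume "ok i e"
    then have "e k \<le> len i" by (rule ok_le)
    then have *: "(\<forall>d\<le>e k. Q d) = (\<forall>d\<le>len i. d \<le> e k \<longrightarrow> Q d)" for Q
      by (meson le_trans)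
    have if_eq: "(s = (if b then 3 else 4)) = ((b \<longrightarrow> s = 3) \<and> (\<not> b \<longrightarrow> s = 4))" for s :: nat and b by simp
    show "unary (wd i) (e j) (e k) = (\<forall>d\<le>len i. d \<le> e k \<longrightarrow> (\<exists>x\<le>len i. e j + d = x \<and>
      (d = e k \<longrightarrow> sy (wd i) x = 3) \<and> (\<not> d = e k \<longrightarrow> sy (wd i) x = 4)))"
      unfolding unary_iff if_eq by (rule *)
  qed
qed

lemma Def_signed_at: "j < m \<Longrightarrow> k < m \<Longrightarrow> Def m (\<lambda>i e. signed_at (wd i) neg (e j) (e k))"
proof (cases neg)
  case True
  assume *: "j < m" "k < m"
  have "Def m (\<lambda>i e. sy (wd i) (e j) = 5 \<and> \<not> e k = 0 \<and> (\<exists>x\<le>len i. x = Suc (e j) \<and> unary (wd i) x (e k)))"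
    by (intro Def_conj Def_sym Def_not Def_zero Def_ex Def_Suc Def_unary) (use * in auto)
  then show ?thesis
  proof (rule Def_cong)
    fix i and e :: "nat \<Rightarrow> nat"
    have "Suc (e j) \<le> len i" if "sy (wd i) (e j) = 5"
      using that by (auto simp: sy_def split: if_splits)
    then show "signed_at (wd i) neg (e j) (e k) = (sy (wd i) (e j) = 5 \<and> \<not> e k = 0 \<and>
        (\<exists>x\<le>len i. x = Suc (e j) \<and> unary (wd i) x (e k)))"
      using True by (auto simp: signed_at_def)
  qed
next
  case False
  assume "j < m" "k < m"
  with False show ?thesis by (simp add: signed_at_def Def_unary)
qed

lemma signed_at_le: "signed_at w neg p a \<Longrightarrow> a \<le> length w"
  by (auto simp: signed_at_def unary_le split: if_splits)

lemma Def_signed_le: "j < m \<Longrightarrow> k < m \<Longrightarrow> Def m (\<lambda>i e. signed b (e j) \<le> signed b' (e k) + c)"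
proof -
  assume *: "j < m" "k < m"
  consider "\<not> b" "\<not> b'" | "\<not> b" b' | b "\<not> b'" | b b' by blast
  then show ?thesis
  proof cases
    case 1
    then show ?thesis using Def_diff_le[OF *] by (simp add: signed_def)
  next
    case 2
    show ?thesis by (rule Def_cong[OF Def_sum_le[OF *, of c]]) (use 2 in \<open>auto simp: signed_def\<close>)
  next
    case 3
    \<comment> \<open>Over the integers \<open>- x \<le> y + c\<close> is the negation of
      \<open>x + y \<le> - c - 1\<close>.\<close>
    show ?thesis by (rule Def_cong[OF Def_not[OF Def_sum_le[OF *, of "- c - 1"]]]) (use 3 in \<open>auto simp: signed_def\<close>)
  next
    case 4
    show ?thesis by (rule Def_cong[OF Def_diff_le[OF *(2,1), of c]]) (use 4 in \<open>auto simp: signed_def\<close>)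
  qed
qed

text \<open>The unary encoding enters here: the magnitude of a numeral is at most the length of the
  word, so a head can hold it. The signs are guessed from a finite set.\<close>

lemma Def_time_le: "j < m \<Longrightarrow> k < m \<Longrightarrow> Def m (\<lambda>i e. time_le c (wd i) (e j) (e k))"
proof -
  assume *: "j < m" "k < m"
  have "Def m (\<lambda>i e. \<exists>b\<in>{True, False}. \<exists>b'\<in>{True, False}. \<exists>a\<le>len i. \<exists>a'\<le>len i.
      signed_at (wd i) b (e j) a \<and> signed_at (wd i) b' (e k) a' \<and> signed b a \<le> signed b' a' + c)"
    apply (intro Def_bex)
       apply (use * in auto)[2]
    apply (rule Def_ex)
     apply (rule Def_ex)
      apply (intro Def_conj Def_signed_at Def_signed_le)
           apply (use * in auto)
    done
  then show ?thesis
  proof (rule Def_cong)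
    fix i and e :: "nat \<Rightarrow> nat"
    show "time_le c (wd i) (e j) (e k) = (\<exists>b\<in>{True, False}. \<exists>b'\<in>{True, False}. \<exists>a\<le>len i. \<exists>a'\<le>len i.
      signed_at (wd i) b (e j) a \<and> signed_at (wd i) b' (e k) a' \<and> signed b a \<le> signed b' a' + c)"
      (is "?L = ?R")
    proof
      assume ?L
      then obtain b a b' a' where "signed_at (wd i) b (e j) a" "signed_at (wd i) b' (e k) a'"
        "signed b a \<le> signed b' a' + c"
        unfolding time_le_def time_at_signed by blast
      then show ?R
        using signed_at_le by (intro bexI[of _ b] bexI[of _ b'] exI[of _ a] conjI exI[of _ a']) auto
    next
      assume ?R
      then show ?L unfolding time_le_def time_at_signed by blast
    qed
  qed
qed

text \<open>A tuple of fixed length lives on consecutive new heads; its last entry is quantified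
  innermost.\<close>

lemma Def_exs:
  assumes "Def (m + l) (\<lambda>i e. \<phi> i e (map e [m..<m + l]))"
    and "\<And>i e e' ys. agree m e e' \<Longrightarrow> \<phi> i e ys = \<phi> i e' ys"
  shows "Def m (\<lambda>i e. \<exists>ys. length ys = l \<and> (\<forall>y\<in>set ys. y \<le> len i) \<and> \<phi> i e ys)"
  using assms
proof (induction l arbitrary: \<phi>)
  case 0
  then show ?case by simp
next
  case (Suc l)
  let ?\<psi> = "\<lambda>i e ys. \<exists>x\<le>len i. \<phi> i e (ys @ [x])"
  have "Def (m + l) (\<lambda>i e. ?\<psi> i e (map e [m..<m + l]))"
  proof (rule Def_ex)
    show "Def (Suc (m + l)) (\<lambda>i e. \<phi> i e (map e [m..<m + l] @ [e (m + l)]))"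
      using Suc.prems(1) by simp
    fix i x and e :: "nat \<Rightarrow> nat"
    have "map (e(m + l := x)) [m..<m + l] = map e [m..<m + l]" by (rule map_cong) auto
    moreover have "agree m (e(m + l := x)) e" by (simp add: agree_def)
    ultimately show "\<phi> i (e(m + l := x)) (map (e(m + l := x)) [m..<m + l] @ [x]) = \<phi> i e (map e [m..<m + l] @ [x])"
      using Suc.prems(2) by metis
  qed
  moreover have "?\<psi> i e ys = ?\<psi> i e' ys" if "agree m e e'" for i e e' ys
    using Suc.prems(2)[OF that] by simp
  ultimately have "Def m (\<lambda>i e. \<exists>ys. length ys = l \<and> (\<forall>y\<in>set ys. y \<le> len i) \<and> ?\<psi> i e ys)"
    by (rule Suc.IH)
  then show ?case
  proof (rule Def_cong)
    fix i e
    show "(\<exists>ys. length ys = Suc l \<and> (\<forall>y\<in>set ys. y \<le> len i) \<and> \<phi> i e ys) =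
      (\<exists>ys. length ys = l \<and> (\<forall>y\<in>set ys. y \<le> len i) \<and> ?\<psi> i e ys)" (is "?A = ?B")
    proof
      assume ?A
      then obtain ys where ys: "length ys = Suc l" "\<forall>y\<in>set ys. y \<le> len i" "\<phi> i e ys" by blast
      then obtain zs x where "ys = zs @ [x]" by (metis length_Suc_conv_rev)
      with ys show ?B by auto
    next
      assume ?B
      then obtain ys x where "length ys = l" "\<forall>y\<in>set ys. y \<le> len i" "x \<le> len i" "\<phi> i e (ys @ [x])" by blast
      then show ?A by (intro exI[of _ "ys @ [x]"]) auto
    qed
  qed
qed

end

section \<open>Definability of derivations\<close>

text \<open>Constants receive a head just like variables, so that an instance of a rule is an
  assignment of positions to these terms.\<close>

definition terms_of :: "rule \<Rightarrow> oterm list" where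
  "terms_of r = remdups (concat (map aobjs (head r # body r)))"

definition idx :: "'a list \<Rightarrow> 'a \<Rightarrow> nat" where
  "idx L t = (LEAST k. k < length L \<and> L ! k = t)"

lemma idx: "t \<in> set L \<Longrightarrow> idx L t < length L \<and> L ! idx L t = t"
  unfolding idx_def by (rule LeastI_ex) (auto simp: in_set_conv_nth)

lemma terms_of_head: "t \<in> set (aobjs (head r)) \<Longrightarrow> t \<in> set (terms_of r)"
  and terms_of_body: "a \<in> set (body r) \<Longrightarrow> t \<in> set (aobjs a) \<Longrightarrow> t \<in> set (terms_of r)"
  by (auto simp: terms_of_def)

text \<open>The offset from the base time that a body atom acquires when the head has offset
  \<open>off\<close>. For a temporal body atom connectedness makes the head temporal too, so both
  uses of \<open>the\<close> then see a value.\<close>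

definition body_off :: "rule \<Rightarrow> int option \<Rightarrow> atom \<Rightarrow> int option" where
  "body_off r off a = map_option (\<lambda>t. the off + toff t - toff (the (atime (head r)))) (atime a)"

lemma inst_t_const: "no_tpoint t \<Longrightarrow> inst_t (\<lambda>_. x) t = x + toff t"
  by (cases t) auto

lemma bex_restrict:
  assumes "\<And>r. r \<in> A \<Longrightarrow> X r \<longleftrightarrow> r \<in> B \<and> Y r" "B \<subseteq> A"
  shows "(\<exists>r\<in>A. X r) \<longleftrightarrow> (\<exists>r\<in>B. Y r)"
  using assms by blast

text \<open>The propositional regrouping between the shape delivered by \<open>der_rule_iff\<close>
  and that of the formula in \<open>Def_der\<close>, isolated so that automation sees only
  propositional atoms.\<close>

lemma rearrange:
  assumes pre al "r \<in> \<Pi>"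
  shows "(a \<and> n \<and> (\<exists>ys. l ys \<and> (s1 ys \<and> s2 ys) \<and> C ys \<and> (len \<and> N ys) \<and> B ys)) \<longleftrightarrow>
    (r \<in> \<Pi> \<and> a \<and> n \<and> len) \<and>
    (\<exists>ys. l ys \<and> s1 ys \<and> pre \<and> al \<and> s2 ys \<and> C ys \<and> N ys \<and> B ys)"
  using assms by blast

text \<open>One rule application, with the rule terms evaluated at positions and the times relative to
  the base time \<open>\<tau>\<close>.\<close>

lemma der_rule_iff:
  assumes wf: "wf_rule r" and con: "connected_rule r"
    and ntp: "atom_no_tpoint (head r)" "\<And>a. a \<in> set (body r) \<Longrightarrow> atom_no_tpoint a"
    and cD: "\<And>c a. a \<in> insert (head r) (set (body r)) \<Longrightarrow> OConst c \<in> set (aobjs a) \<Longrightarrow> c \<in> val ` S"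
    and objs: "\<And>g. der \<Pi> E d g \<Longrightarrow> set (gobjs g) \<subseteq> val ` S"
  shows "(\<exists>so st. inst so st (head r) = GAtom P os (map_option (\<lambda>k. \<tau> + k) off) \<and>
        (\<forall>a\<in>set (body r). der \<Pi> E d (inst so st a))) \<longleftrightarrow>
     apred (head r) = P \<and> (atime (head r) = None \<longleftrightarrow> off = None) \<and>
     (\<exists>ys. length ys = length (terms_of r) \<and> set ys \<subseteq> S \<and>
       (\<forall>c. OConst c \<in> set (terms_of r) \<longrightarrow> val (ys ! idx (terms_of r) (OConst c)) = c) \<and>
       map (\<lambda>t. val (ys ! idx (terms_of r) t)) (aobjs (head r)) = os \<and>
       (\<forall>a\<in>set (body r). der \<Pi> E d (GAtom (apred a) (map (\<lambda>t. val (ys ! idx (terms_of r) t)) (aobjs a))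
          (map_option (\<lambda>k. \<tau> + k) (body_off r off a)))))"
    (is "?L \<longleftrightarrow> ?R")
proof
  assume ?L
  then obtain so st where h: "inst so st (head r) = GAtom P os (map_option (\<lambda>k. \<tau> + k) off)"
    and b: "\<And>a. a \<in> set (body r) \<Longrightarrow> der \<Pi> E d (inst so st a)" by blast
  have inS: "inst_o so t \<in> val ` S" if t: "t \<in> set (terms_of r)" for t
  proof -
    have var: "so x \<in> val ` S" if "a \<in> set (body r)" "OVar x \<in> set (aobjs a)" for a x
      using objs[OF b[OF that(1)]] image_eqI[of "so x" "inst_o so" "OVar x"] that(2)
      by (auto simp: inst_def)
    obtain a where a: "a \<in> insert (head r) (set (body r))" "t \<in> set (aobjs a)"
      using t by (auto simp: terms_of_def)
    show ?thesis
    proof (cases t)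
      case (OConst c)
      then show ?thesis using cD[OF a(1)] a(2) by simp
    next
      case (OVar x)
      have "x \<in> body_ovars r"
      proof (cases "a \<in> set (body r)")
        case True
        then show ?thesis using a(2) OVar by (force simp: body_ovars_def ovars_def)
      next
        case False
        then have "x \<in> ovars (head r)" using a OVar by (force simp: ovars_def)
        then show ?thesis using wf by (auto simp: wf_rule_def)
      qed
      then obtain a' t' where a': "a' \<in> set (body r)" "t' \<in> set (aobjs a')" "x \<in> ovars_oterm t'"
        by (auto simp: body_ovars_def ovars_def)
      then have "t' = OVar x" by (cases t') auto
      with a' var OVar show ?thesis by simp
    qed
  qed
  \<comment> \<open>Every term value has a position in \<open>S\<close>: constants by
    \<open>cD\<close>, variables because they occur in a derivable body atom.\<close>
  define pick where "pick t = (SOME y. y \<in> S \<and> val y = inst_o so t)" for t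
  have pick: "pick t \<in> S \<and> val (pick t) = inst_o so t" if "t \<in> set (terms_of r)" for t
    unfolding pick_def by (rule someI_ex) (use inS[OF that] in auto)
  define ys where "ys = map pick (terms_of r)"
  have val: "val (ys ! idx (terms_of r) t) = inst_o so t" if "t \<in> set (terms_of r)" for t
    using idx[OF that] pick[OF that] by (simp add: ys_def)
  have time: "map_option (inst_t st) (atime a) = map_option (\<lambda>k. \<tau> + k) (body_off r off a)" if a: "a \<in> set (body r)" for a
  proof (cases "atime a")
    case None
    then show ?thesis by (simp add: body_off_def)
  next
    case (Some t)
    have "no_tpoint t" "\<And>t. atime (head r) = Some t \<Longrightarrow> no_tpoint t"
      using ntp(1) ntp(2)[OF a] Some by (auto simp: atom_no_tpoint_def)
    then obtain t' where t': "atime (head r) = Some t'" "\<And>st. inst_t st t - inst_t st t' = toff t - toff t'"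
      using time_shift[OF con _ a Some] by metis
    obtain k where "off = Some k" "inst_t st t' = \<tau> + k" using h t'(1) by (cases off) (auto simp: inst_def)
    then show ?thesis using Some t' t'(2)[of st] by (simp add: body_off_def)
  qed
  have "map (\<lambda>t. val (ys ! idx (terms_of r) t)) (aobjs (head r)) = os"
    using h val[OF terms_of_head] by (auto simp: inst_def)
  moreover have "der \<Pi> E d (GAtom (apred a) (map (\<lambda>t. val (ys ! idx (terms_of r) t)) (aobjs a))
          (map_option (\<lambda>k. \<tau> + k) (body_off r off a)))" if "a \<in> set (body r)" for a
  proof -
    have "map (\<lambda>t. val (ys ! idx (terms_of r) t)) (aobjs a) = map (inst_o so) (aobjs a)"
      using val[OF terms_of_body[OF that]] by simp
    then show ?thesis using b[OF that] unfolding inst_def time[OF that] by (simp only: )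
  qed
  moreover have "set ys \<subseteq> S" "length ys = length (terms_of r)" using pick by (auto simp: ys_def)
  moreover have "apred (head r) = P" "atime (head r) = None \<longleftrightarrow> off = None" using h by (auto simp: inst_def)
  moreover have "\<forall>c. OConst c \<in> set (terms_of r) \<longrightarrow> val (ys ! idx (terms_of r) (OConst c)) = c"
    using val by auto
  ultimately show ?R by blast
next
  assume R: ?R
  note P = R[THEN conjunct1] R[THEN conjunct2, THEN conjunct1]
  from R[THEN conjunct2, THEN conjunct2] obtain ys where Y: "length ys = length (terms_of r) \<and> set ys \<subseteq> S \<and>
       (\<forall>c. OConst c \<in> set (terms_of r) \<longrightarrow> val (ys ! idx (terms_of r) (OConst c)) = c) \<and>
       map (\<lambda>t. val (ys ! idx (terms_of r) t)) (aobjs (head r)) = os \<and>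
       (\<forall>a\<in>set (body r). der \<Pi> E d (GAtom (apred a) (map (\<lambda>t. val (ys ! idx (terms_of r) t)) (aobjs a))
          (map_option (\<lambda>k. \<tau> + k) (body_off r off a))))" by (rule exE)
  note c = Y[THEN conjunct2, THEN conjunct2, THEN conjunct1, rule_format]
  note h = Y[THEN conjunct2, THEN conjunct2, THEN conjunct2, THEN conjunct1]
  note b = Y[THEN conjunct2, THEN conjunct2, THEN conjunct2, THEN conjunct2, THEN bspec]
  define so where "so x = val (ys ! idx (terms_of r) (OVar x))" for x
  \<comment> \<open>A connected rule has at most one time variable, so a constant substitution is
    enough; the value places the head at \<open>\<tau> + the off\<close>.\<close>
  define st where "st = (\<lambda>_::nat. \<tau> + the off - toff (the (atime (head r))))"
  have so: "inst_o so t = val (ys ! idx (terms_of r) t)" if "t \<in> set (terms_of r)" for t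
  proof (cases t)
    case (OConst u)
    then show ?thesis using c[of u] that by simp
  qed (simp add: so_def)
  have "inst so st (head r) = GAtom P os (map_option (\<lambda>k. \<tau> + k) off)"
  proof -
    have "map (inst_o so) (aobjs (head r)) = os" using h so[OF terms_of_head] by auto
    moreover have "map_option (inst_t st) (atime (head r)) = map_option (\<lambda>k. \<tau> + k) off"
      using P(2) ntp(1) by (cases "atime (head r)"; cases off) (auto simp: atom_no_tpoint_def st_def inst_t_const)
    ultimately show ?thesis using P(1) by (simp add: inst_def)
  qed
  moreover have "der \<Pi> E d (inst so st a)" if a: "a \<in> set (body r)" for a
  proof -
    have "map (inst_o so) (aobjs a) = map (\<lambda>t. val (ys ! idx (terms_of r) t)) (aobjs a)"
      using so[OF terms_of_body[OF a]] by simp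
    moreover have "map_option (inst_t st) (atime a) = map_option (\<lambda>k. \<tau> + k) (body_off r off a)"
      using ntp(2)[OF a] by (cases "atime a") (auto simp: body_off_def atom_no_tpoint_def st_def inst_t_const)
    ultimately show ?thesis using b[OF a] unfolding inst_def by (simp only: )
  qed
  ultimately show ?L by blast
qed

text \<open>What definability of derivations asks of an encoding. Objects are never computed: their
  equality, and equality with a program constant, need to be definable only on positions that carry
  an object.\<close>

locale coded = words +
  fixes isobj :: "'a \<Rightarrow> nat \<Rightarrow> bool" and val :: "'a \<Rightarrow> nat \<Rightarrow> nat" and Dom :: "'a \<Rightarrow> nat set"
    and \<Pi> :: "rule set"
  assumes Def_isobj: "j < m \<Longrightarrow> Def m (\<lambda>i e. isobj i (e j))"
    and Def_val_eq: "j < m \<Longrightarrow> k < m \<Longrightarrow> Def m (\<lambda>i e. isobj i (e j) \<and> isobj i (e k) \<and> val i (e j) = val i (e k))"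
    and Def_val_const: "c \<in> consts_of \<Pi> \<Longrightarrow> j < m \<Longrightarrow> Def m (\<lambda>i e. isobj i (e j) \<and> val i (e j) = c)"
    and Dom: "i \<in> I \<Longrightarrow> Dom i = val i ` {x. x \<le> len i \<and> isobj i x}"
    and consts_Dom: "i \<in> I \<Longrightarrow> consts_of \<Pi> \<subseteq> Dom i"
    and finite_\<Pi>: "finite \<Pi>"
    and wf_\<Pi>: "r \<in> \<Pi> \<Longrightarrow> wf_rule r"
    and connected_\<Pi>: "connected \<Pi>"
    and no_time_points_\<Pi>: "no_time_points \<Pi>"
begin

text \<open>Atoms are represented by a predicate, a list of heads at objects, and a time offset relative to
  a base time.\<close>

definition gat :: "'a \<Rightarrow> (nat \<Rightarrow> nat) \<Rightarrow> int \<Rightarrow> pred \<Rightarrow> nat list \<Rightarrow> int option \<Rightarrow> gatom" where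
  "gat i e \<tau> P xs off = GAtom P (map (\<lambda>x. val i (e x)) xs) (map_option (\<lambda>k. \<tau> + k) off)"

definition allobj :: "'a \<Rightarrow> (nat \<Rightarrow> nat) \<Rightarrow> nat list \<Rightarrow> bool" where
  "allobj i e xs \<longleftrightarrow> (\<forall>x\<in>set xs. isobj i (e x))"

lemma Def_allobj: "set xs \<subseteq> {..<m} \<Longrightarrow> Def m (\<lambda>i e. allobj i e xs)"
  unfolding allobj_def by (intro Def_ball Def_isobj) auto

lemma allobj_upd: "agree m e e' \<Longrightarrow> set xs \<subseteq> {..<m} \<Longrightarrow> allobj i e xs = allobj i e' xs"
  by (force simp: allobj_def agree_def)

text \<open>A rule application is an existential over one head per rule term, with a finite
  disjunction over the rules; the subgoals are instances of the induction hypothesis with more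
  heads. Times need no quantifier, since \<open>body_off\<close> computes the offsets from the
  rules. The first \<open>m0\<close> heads determine the data, the base time and the guard
  \<open>pre\<close>, so the data may themselves be guessed.\<close>

lemma Def_der:
  fixes E :: "'a \<Rightarrow> (nat \<Rightarrow> nat) \<Rightarrow> gatom set" and \<tau> :: "'a \<Rightarrow> (nat \<Rightarrow> nat) \<Rightarrow> int"
  assumes mem: "\<And>m P xs off. m0 \<le> m \<Longrightarrow> set xs \<subseteq> {..<m} \<Longrightarrow>
      Def m (\<lambda>i e. pre i e \<and> allobj i e xs \<and> gat i e (\<tau> i e) P xs off \<in> E i e)"
    and indep: "\<And>i e e'. agree m0 e e' \<Longrightarrow> E i e = E i e' \<and> \<tau> i e = \<tau> i e' \<and> pre i e = pre i e'"
    and pre: "\<And>m. m0 \<le> m \<Longrightarrow> Def m pre"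
    and E: "\<And>i e. i \<in> I \<Longrightarrow> ok i e \<Longrightarrow> pre i e \<Longrightarrow> objs (E i e) \<subseteq> Dom i"
  shows "m0 \<le> m \<Longrightarrow> set xs \<subseteq> {..<m} \<Longrightarrow>
      Def m (\<lambda>i e. pre i e \<and> allobj i e xs \<and> der \<Pi> (E i e) d (gat i e (\<tau> i e) P xs off))"
proof (induction d arbitrary: m xs P off)
  case 0
  then show ?case using mem by simp
next
  case (Suc d)
  \<comment> \<open>Predicate, presence of a time and arity are settled before any head is
    read.\<close>
  let ?R = "{r \<in> \<Pi>. apred (head r) = P \<and> (atime (head r) = None \<longleftrightarrow> off = None) \<and>
    length (aobjs (head r)) = length xs}"
  let ?x = "\<lambda>r e t. e (m + idx (terms_of r) t)"
  let ?B = "\<lambda>r i e a. gat i e (\<tau> i e) (apred a) (map (\<lambda>t. m + idx (terms_of r) t) (aobjs a)) (body_off r off a)"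
  let ?\<phi> = "\<lambda>r i e ys. pre i e \<and> allobj i e xs \<and> (\<forall>y\<in>set ys. isobj i y) \<and>
     (\<forall>t\<in>set (terms_of r). \<forall>c. t = OConst c \<longrightarrow> val i (ys ! idx (terms_of r) t) = c) \<and>
     (\<forall>n<length xs. val i (ys ! idx (terms_of r) (aobjs (head r) ! n)) = val i (e (xs ! n))) \<and>
     (\<forall>a\<in>set (body r). der \<Pi> (E i e) d (GAtom (apred a) (map (\<lambda>t. val i (ys ! idx (terms_of r) t)) (aobjs a))
          (map_option (\<lambda>k. \<tau> i e + k) (body_off r off a))))"
  have rule: "Def m (\<lambda>i e. \<exists>ys. length ys = length (terms_of r) \<and> (\<forall>y\<in>set ys. y \<le> len i) \<and> ?\<phi> r i e ys)"
    if r: "r \<in> ?R" for r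
  proof (rule Def_exs)
    let ?L = "terms_of r" and ?M = "m + length (terms_of r)"
    \<comment> \<open>The same condition with the tuple on heads. The guards \<open>isobj\<close>,
      \<open>pre\<close> and \<open>allobj\<close> are repeated in each conjunct to match the
      guarded form in which the parts are definable.\<close>
    let ?\<chi> = "\<lambda>i e. pre i e \<and> allobj i e xs \<and> allobj i e [m..<?M] \<and>
       (\<forall>t\<in>set ?L. \<forall>c\<in>{c. t = OConst c}. isobj i (?x r e t) \<and> val i (?x r e t) = c) \<and>
       (\<forall>n\<in>{..<length xs}. isobj i (?x r e (aobjs (head r) ! n)) \<and> isobj i (e (xs ! n)) \<and>
           val i (?x r e (aobjs (head r) ! n)) = val i (e (xs ! n))) \<and>
       (\<forall>a\<in>set (body r). pre i e \<and> allobj i e (map (\<lambda>t. m + idx ?L t) (aobjs a)) \<and> der \<Pi> (E i e) d (?B r i e a))"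
    have hd: "aobjs (head r) ! n \<in> set ?L" if "n < length xs" for n
      using that r terms_of_head[of "aobjs (head r) ! n" r] by simp
    have "Def ?M ?\<chi>"
    proof (intro Def_conj)
      show "Def ?M pre" "Def ?M (\<lambda>i e. allobj i e xs)" "Def ?M (\<lambda>i e. allobj i e [m..<?M])"
        using Suc.prems by (auto intro!: pre Def_allobj)
      have const: "c \<in> consts_of \<Pi>" if "OConst c \<in> set ?L" for c
        using that r by (force simp: terms_of_def consts_of_def)
      show "Def ?M (\<lambda>i e. \<forall>t\<in>set ?L. \<forall>c\<in>{c. t = OConst c}. isobj i (?x r e t) \<and> val i (?x r e t) = c)"
      proof (rule Def_ball, simp, rule Def_ball)
        fix t assume t: "t \<in> set ?L"
        show "finite {c. t = OConst c}" by (cases t) auto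
        fix c assume "c \<in> {c. t = OConst c}"
        then show "Def ?M (\<lambda>i e. isobj i (?x r e t) \<and> val i (?x r e t) = c)"
          using t const idx[OF t] by (intro Def_val_const) auto
      qed
      show "Def ?M (\<lambda>i e. \<forall>n\<in>{..<length xs}. isobj i (?x r e (aobjs (head r) ! n)) \<and> isobj i (e (xs ! n)) \<and>
           val i (?x r e (aobjs (head r) ! n)) = val i (e (xs ! n)))"
      proof (rule Def_ball, simp)
        fix n assume n: "n \<in> {..<length xs}"
        then have "xs ! n \<in> set xs" by simp
        then have "xs ! n < m" using Suc.prems(2) by blast
        then show "Def ?M (\<lambda>i e. isobj i (?x r e (aobjs (head r) ! n)) \<and> isobj i (e (xs ! n)) \<and>
           val i (?x r e (aobjs (head r) ! n)) = val i (e (xs ! n)))"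
          using idx[OF hd] n by (intro Def_val_eq) auto
      qed
      show "Def ?M (\<lambda>i e. \<forall>a\<in>set (body r). pre i e \<and> allobj i e (map (\<lambda>t. m + idx ?L t) (aobjs a)) \<and> der \<Pi> (E i e) d (?B r i e a))"
      proof (rule Def_ball, simp)
        fix a assume a: "a \<in> set (body r)"
        have "set (map (\<lambda>t. m + idx ?L t) (aobjs a)) \<subseteq> {..<?M}"
          using idx[OF terms_of_body[OF a]] by auto
        then show "Def ?M (\<lambda>i e. pre i e \<and> allobj i e (map (\<lambda>t. m + idx ?L t) (aobjs a)) \<and> der \<Pi> (E i e) d (?B r i e a))"
          using Suc.prems(1) by (intro Suc.IH) auto
      qed
    qed
    then show "Def ?M (\<lambda>i e. ?\<phi> r i e (map e [m..<?M]))"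
    proof (rule Def_cong)
      fix i and e :: "nat \<Rightarrow> nat"
      have nth: "map e [m..<?M] ! idx ?L t = ?x r e t" if "t \<in> set ?L" for t
        using idx[OF that] by simp
      have B: "?B r i e a = GAtom (apred a) (map (\<lambda>t. val i (map e [m..<?M] ! idx ?L t)) (aobjs a))
          (map_option (\<lambda>k. \<tau> i e + k) (body_off r off a))" if "a \<in> set (body r)" for a
        using nth[OF terms_of_body[OF that]] by (simp add: gat_def)
      have lt: "m + idx ?L t \<in> set [m..<?M]" if "t \<in> set ?L" for t using idx[OF that] by simp
      have xsn: "allobj i e xs \<Longrightarrow> n < length xs \<Longrightarrow> isobj i (e (xs ! n))" for n by (simp add: allobj_def)
      have all: "(\<forall>y\<in>set (map e [m..<?M]). isobj i y) = allobj i e [m..<?M]" by (auto simp: allobj_def)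
      have obj: "isobj i (?x r e t)" if "allobj i e [m..<?M]" "t \<in> set ?L" for t
        using that(1) lt[OF that(2)] unfolding allobj_def by blast
      have body: "allobj i e (map (\<lambda>t. m + idx ?L t) (aobjs a))" if "allobj i e [m..<?M]" "a \<in> set (body r)" for a
        using obj[OF that(1) terms_of_body[OF that(2)]] by (auto simp: allobj_def)
      show "?\<phi> r i e (map e [m..<?M]) = ?\<chi> i e"
      proof (cases "pre i e \<and> allobj i e xs \<and> allobj i e [m..<?M]")
        case True
        then have pre: "pre i e" and xs: "allobj i e xs" and ys: "allobj i e [m..<?M]" by auto
        have 1: "(\<forall>t\<in>set ?L. \<forall>c. t = OConst c \<longrightarrow> val i (map e [m..<?M] ! idx ?L t) = c) =
            (\<forall>t\<in>set ?L. \<forall>c\<in>{c. t = OConst c}. isobj i (?x r e t) \<and> val i (?x r e t) = c)"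
        proof (intro ball_cong refl)
          fix t assume t: "t \<in> set ?L"
          show "(\<forall>c. t = OConst c \<longrightarrow> val i (map e [m..<?M] ! idx ?L t) = c) =
              (\<forall>c\<in>{c. t = OConst c}. isobj i (?x r e t) \<and> val i (?x r e t) = c)"
            unfolding nth[OF t] using obj[OF ys t] by blast
        qed
        have 2: "(\<forall>n<length xs. val i (map e [m..<?M] ! idx ?L (aobjs (head r) ! n)) = val i (e (xs ! n))) =
            (\<forall>n\<in>{..<length xs}. isobj i (?x r e (aobjs (head r) ! n)) \<and> isobj i (e (xs ! n)) \<and>
              val i (?x r e (aobjs (head r) ! n)) = val i (e (xs ! n)))"
          unfolding Ball_def lessThan_iff
          by (intro all_cong1 imp_cong refl) (simp add: nth hd obj[OF ys] xsn[OF xs])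
        have 3: "(\<forall>a\<in>set (body r). der \<Pi> (E i e) d (GAtom (apred a) (map (\<lambda>t. val i (map e [m..<?M] ! idx ?L t)) (aobjs a))
              (map_option (\<lambda>k. \<tau> i e + k) (body_off r off a)))) =
            (\<forall>a\<in>set (body r). pre i e \<and> allobj i e (map (\<lambda>t. m + idx ?L t) (aobjs a)) \<and> der \<Pi> (E i e) d (?B r i e a))"
          by (intro ball_cong refl) (simp only: B pre body[OF ys] simp_thms)
        show ?thesis
          unfolding all 1 2 3 by (simp only: pre xs ys simp_thms)
      next
        case False
        then show ?thesis unfolding all by blast
      qed
    qed
    fix i e e' ys assume ag: "agree m e e'"
    have "agree m0 e e'" using agree_mono[OF ag Suc.prems(1)] .
    then have eq: "E i e = E i e'" "\<tau> i e = \<tau> i e'" "pre i e = pre i e'" using indep by auto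
    have "e (xs ! n) = e' (xs ! n)" if "n < length xs" for n
      using ag Suc.prems(2) nth_mem[OF that] by (auto simp: agree_def)
    then show "?\<phi> r i e ys = ?\<phi> r i e' ys"
      using eq allobj_upd[OF ag Suc.prems(2)] by simp
  qed
  have "Def m (\<lambda>i e. (pre i e \<and> allobj i e xs \<and> gat i e (\<tau> i e) P xs off \<in> E i e) \<or>
     (\<exists>r\<in>?R. \<exists>ys. length ys = length (terms_of r) \<and> (\<forall>y\<in>set ys. y \<le> len i) \<and> ?\<phi> r i e ys))"
    using finite_\<Pi> by (intro Def_disj mem Suc.prems Def_bex rule) auto
  then show ?case
  proof (rule Def_cong)
    fix i e assume i: "i \<in> I" "ok i e"
    let ?S = "{x. x \<le> len i \<and> isobj i x}"
    show "(pre i e \<and> allobj i e xs \<and> der \<Pi> (E i e) (Suc d) (gat i e (\<tau> i e) P xs off)) =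
       ((pre i e \<and> allobj i e xs \<and> gat i e (\<tau> i e) P xs off \<in> E i e) \<or>
     (\<exists>r\<in>?R. \<exists>ys. length ys = length (terms_of r) \<and> (\<forall>y\<in>set ys. y \<le> len i) \<and> ?\<phi> r i e ys))"
    proof (cases "pre i e \<and> allobj i e xs")
      case True
      have rule_iff: "(\<exists>so st. inst so st (head r) = gat i e (\<tau> i e) P xs off \<and> (\<forall>a\<in>set (body r). der \<Pi> (E i e) d (inst so st a)))
        \<longleftrightarrow> r \<in> ?R \<and> (\<exists>ys. length ys = length (terms_of r) \<and> (\<forall>y\<in>set ys. y \<le> len i) \<and> ?\<phi> r i e ys)"
        if r: "r \<in> \<Pi>" for r
      proof -
        \<comment> \<open>Derivable atoms mention relevant objects only, so restricting rule
          variables to positions of the word loses nothing.\<close>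
        have "set (gobjs g) \<subseteq> val i ` ?S" if "der \<Pi> (E i e) d g" for g
          using der_objs[OF wf_\<Pi> that] E[OF i] True consts_Dom[OF i(1)] Dom[OF i(1)] by blast
        moreover have "c \<in> val i ` ?S" if "a \<in> insert (head r) (set (body r))" "OConst c \<in> set (aobjs a)" for c a
          using that r consts_Dom[OF i(1)] Dom[OF i(1)] by (fastforce simp: consts_of_def)
        moreover have "connected_rule r" "atom_no_tpoint (head r)" "\<And>a. a \<in> set (body r) \<Longrightarrow> atom_no_tpoint a"
          using connected_\<Pi> no_time_points_\<Pi> r by (auto simp: connected_def no_time_points_def)
        ultimately have L: "(\<exists>so st. inst so st (head r) = gat i e (\<tau> i e) P xs off \<and> (\<forall>a\<in>set (body r). der \<Pi> (E i e) d (inst so st a)))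
        \<longleftrightarrow> apred (head r) = P \<and> (atime (head r) = None \<longleftrightarrow> off = None) \<and>
     (\<exists>ys. length ys = length (terms_of r) \<and> set ys \<subseteq> ?S \<and>
       (\<forall>c. OConst c \<in> set (terms_of r) \<longrightarrow> val i (ys ! idx (terms_of r) (OConst c)) = c) \<and>
       map (\<lambda>t. val i (ys ! idx (terms_of r) t)) (aobjs (head r)) = map (\<lambda>x. val i (e x)) xs \<and>
       (\<forall>a\<in>set (body r). der \<Pi> (E i e) d (GAtom (apred a) (map (\<lambda>t. val i (ys ! idx (terms_of r) t)) (aobjs a))
          (map_option (\<lambda>k. \<tau> i e + k) (body_off r off a)))))"
          unfolding gat_def by (intro der_rule_iff[OF wf_\<Pi>[OF r]])
        have maps: "map f (aobjs (head r)) = map h xs \<longleftrightarrow> length (aobjs (head r)) = length xs \<and>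
            (\<forall>n<length xs. f (aobjs (head r) ! n) = h (xs ! n))" for f :: "oterm \<Rightarrow> nat" and h :: "nat \<Rightarrow> nat"
          by (auto simp: list_eq_iff_nth_eq)
        have subs: "set ys \<subseteq> ?S \<longleftrightarrow> (\<forall>y\<in>set ys. y \<le> len i) \<and> (\<forall>y\<in>set ys. isobj i y)" for ys by auto
        have cs: "(\<forall>c. OConst c \<in> set (terms_of r) \<longrightarrow> val i (ys ! idx (terms_of r) (OConst c)) = c) \<longleftrightarrow>
          (\<forall>t\<in>set (terms_of r). \<forall>c. t = OConst c \<longrightarrow> val i (ys ! idx (terms_of r) t) = c)" for ys by auto
        show ?thesis
          unfolding L maps subs cs mem_Collect_eq
        proof (rule rearrange[where l = "\<lambda>ys. length ys = length (terms_of r)"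
              and ?s1.0 = "\<lambda>ys. \<forall>y\<in>set ys. y \<le> len i" and ?s2.0 = "\<lambda>ys. \<forall>y\<in>set ys. isobj i y"
              and C = "\<lambda>ys. \<forall>t\<in>set (terms_of r). \<forall>c. t = OConst c \<longrightarrow> val i (ys ! idx (terms_of r) t) = c"
              and N = "\<lambda>ys. \<forall>n<length xs. val i (ys ! idx (terms_of r) (aobjs (head r) ! n)) = val i (e (xs ! n))"])
          show "pre i e" "allobj i e xs" "r \<in> \<Pi>" using True r by auto
        qed
      qed
      have "(\<exists>r\<in>\<Pi>. \<exists>so st. inst so st (head r) = gat i e (\<tau> i e) P xs off \<and> (\<forall>a\<in>set (body r). der \<Pi> (E i e) d (inst so st a)))
        \<longleftrightarrow> (\<exists>r\<in>?R. \<exists>ys. length ys = length (terms_of r) \<and> (\<forall>y\<in>set ys. y \<le> len i) \<and> ?\<phi> r i e ys)"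
        by (rule bex_restrict[OF rule_iff]) auto
      moreover have "pre i e" "allobj i e xs" using True by auto
      ultimately show ?thesis
        unfolding der.simps by (simp only: simp_thms)
    next
      case False
      then show ?thesis by blast
    qed
  qed
qed

end

section \<open>The encoded instance\<close>

declare bin.simps [simp del]

lemma bin_digits: "set (bin n) \<subseteq> {1, 2}"
proof (induction n rule: less_induct)
  case (less n)
  then show ?case using bin.simps[of n] by (cases "n = 0") auto
qed

lemma bin_zero: "bin 0 = []"
  by (simp add: bin.simps)

lemma bin_pos: "n \<noteq> 0 \<Longrightarrow> bin n = (if even n then 1 else 2) # bin (n div 2)"
  by (simp add: bin.simps[of n])

lemma bin_inj: "bin m = bin n \<Longrightarrow> m = n"
proof (induction m arbitrary: n rule: less_induct)
  case (less m)
  show ?case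
  proof (cases "m = 0 \<or> n = 0")
    case True
    then show ?thesis using less.prems bin_pos[of m] bin_pos[of n] bin_zero by (metis list.distinct(1))
  next
    case False
    then have eq: "(if even m then 1 else 2) # bin (m div 2) = (if even n then 1 else 2::nat) # bin (n div 2)"
      using less.prems bin_pos[of m] bin_pos[of n] by metis
    then have "even m \<longleftrightarrow> even n" by (auto split: if_splits)
    moreover have "m div 2 = n div 2" using eq False by (intro less.IH) auto
    ultimately show ?thesis by (rule div2_even_ext_nat[rotated])
  qed
qed

lemma separator_unique:
  "s @ a # r = s' @ a # r' \<Longrightarrow> a \<notin> set s \<Longrightarrow> a \<notin> set s' \<Longrightarrow> s = s' \<and> r = r'"
proof (induction s arbitrary: s')
  case Nil
  then show ?case by (cases s') auto
next
  case (Cons b s)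
  then show ?case by (cases s') auto
qed

lemma bin_no3: "3 \<notin> set (bin n)"
  using bin_digits[of n] by auto

text \<open>The code of predicates is prefix-free: four tokens, each closed by a 3 that does not
  occur inside.\<close>

lemma enc_pred_unique:
  assumes "enc_pred P @ x = enc_pred P' @ y"
  shows "P = P' \<and> x = y"
proof -
  have b: "3 \<notin> set (enc_bool c)" "enc_bool c = enc_bool c' \<Longrightarrow> c = c'" for c c'
    by (auto simp: enc_bool_def split: if_splits)
  have eq: "bin (pname P) @ 3 # (enc_bool (pidb P) @ 3 # (bin (parity P) @ 3 # (enc_bool (ptemp P) @ 3 # x)))
      = bin (pname P') @ 3 # (enc_bool (pidb P') @ 3 # (bin (parity P') @ 3 # (enc_bool (ptemp P') @ 3 # y)))"
    using assms by (simp add: enc_pred_def)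
  note 1 = separator_unique[OF eq bin_no3 bin_no3]
  note 2 = separator_unique[OF 1[THEN conjunct2] b(1) b(1)]
  note 3 = separator_unique[OF 2[THEN conjunct2] bin_no3 bin_no3]
  note 4 = separator_unique[OF 3[THEN conjunct2] b(1) b(1)]
  from 1 2 3 4 show ?thesis
    by (cases P; cases P') (auto dest: bin_inj b(2))
qed

lemma tok_unique:
  assumes "drop p w = s @ 3 # r" "3 \<notin> set s" "drop q w = s' @ 3 # r'" "3 \<notin> set s'"
  shows "tok w p q p' \<longleftrightarrow> s = s' \<and> p' = p + length s + 1"
proof
  assume "tok w p q p'"
  then obtain t u u' where t: "3 \<notin> set t" "drop p w = t @ 3 # u" "drop q w = t @ 3 # u'" "p' = p + length t + 1"
    unfolding tok_def by blast
  have "s = t" using separator_unique[of s 3 r t u] assms t by simp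
  moreover have "s' = t" using separator_unique[of s' 3 r' t u'] assms t by simp
  ultimately show "s = s' \<and> p' = p + length s + 1" using t(4) by simp
next
  assume "s = s' \<and> p' = p + length s + 1"
  then show "tok w p q p'" unfolding tok_def using assms by blast
qed

section \<open>Objects and facts inside an encoded word\<close>

definition obj_enc :: "nat list \<Rightarrow> nat list" where
  "obj_enc s = 6 # s @ [3]"

abbreviation objs_enc :: "nat list \<Rightarrow> nat list" where
  "objs_enc os \<equiv> concat (map (\<lambda>c. obj_enc (bin c)) os)"

definition time_enc :: "int option \<Rightarrow> nat list" where
  "time_enc t = (case t of None \<Rightarrow> [] | Some t \<Rightarrow> 7 # enc_int t @ [3])"

lemma enc_fact_eq:
  "enc_fact g = enc_pred (gpred g) @ objs_enc (gobjs g) @ time_enc (gtime g) @ [8]"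
  by (simp add: enc_fact_def obj_enc_def time_enc_def)

lemma set_enc_pred: "set (enc_pred P) \<subseteq> {1, 2, 3}"
  using bin_digits[of "pname P"] bin_digits[of "parity P"] by (auto simp: enc_pred_def enc_bool_def)

lemma set_enc_int: "set (enc_int z) \<subseteq> {4, 5}"
  by (auto simp: enc_int_def)

lemma set_time_enc: "set (time_enc t) \<subseteq> {3, 4, 5, 7}"
  using set_enc_int by (cases t) (auto simp: time_enc_def)

lemma set_obj_enc: "set (obj_enc (bin c)) \<subseteq> {1, 2, 3, 6}"
  using bin_digits[of c] by (auto simp: obj_enc_def)

lemma set_fact_body:
  "set (enc_pred P @ objs_enc os @ time_enc t) \<subseteq> {1..7}"
  using set_enc_pred[of P] set_time_enc[of t] set_obj_enc by fastforce

lemma enc_pred_Cons: "\<exists>a s. enc_pred P = a # s \<and> a \<noteq> 6"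
proof -
  obtain a s where "enc_pred P = a # s" by (cases "enc_pred P") (auto simp: enc_pred_def)
  with set_enc_pred[of P] show ?thesis by auto
qed

text \<open>This makes positions of the symbol 6 a faithful name space for objects. Being stated
  over all splittings, it is preserved by concatenation.\<close>

definition objs_ok :: "nat list set \<Rightarrow> nat list \<Rightarrow> bool" where
  "objs_ok Os w \<longleftrightarrow> (\<forall>u v. w = u @ 6 # v \<longrightarrow> (\<exists>s r. v = s @ 3 # r \<and> s \<in> Os))"

lemma objs_ok_append: "objs_ok Os a \<Longrightarrow> objs_ok Os b \<Longrightarrow> objs_ok Os (a @ b)"
  unfolding objs_ok_def
proof (intro allI impI)
  assume a: "\<forall>u v. a = u @ 6 # v \<longrightarrow> (\<exists>s r. v = s @ 3 # r \<and> s \<in> Os)"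
    and b: "\<forall>u v. b = u @ 6 # v \<longrightarrow> (\<exists>s r. v = s @ 3 # r \<and> s \<in> Os)"
  fix u v assume "a @ b = u @ 6 # v"
  then obtain us where "a = u @ us \<and> us @ b = 6 # v \<or> a @ us = u \<and> b = us @ 6 # v"
    by (auto simp: append_eq_append_conv2)
  then show "\<exists>s r. v = s @ 3 # r \<and> s \<in> Os"
  proof
    assume *: "a = u @ us \<and> us @ b = 6 # v"
    show ?thesis
    proof (cases us)
      case Nil
      with * b show ?thesis by (metis append_Nil)
    next
      case (Cons x us')
      then have "a = u @ 6 # us'" using * by simp
      with a obtain s r where "us' = s @ 3 # r" "s \<in> Os" by blast
      moreover have "v = us' @ b" using * Cons by simp
      ultimately show ?thesis by (intro exI[of _ s] exI[of _ "r @ b"]) simp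
    qed
  next
    assume "a @ us = u \<and> b = us @ 6 # v"
    with b show ?thesis by blast
  qed
qed

lemma objs_ok_free: "6 \<notin> set w \<Longrightarrow> objs_ok Os w"
  by (auto simp: objs_ok_def)

lemma objs_ok_concat: "(\<And>a. a \<in> set as \<Longrightarrow> objs_ok Os a) \<Longrightarrow> objs_ok Os (concat as)"
  by (induction as) (auto intro: objs_ok_append objs_ok_free)

lemma objs_ok_enc: "s \<in> Os \<Longrightarrow> 6 \<notin> set s \<Longrightarrow> objs_ok Os (obj_enc s)"
  unfolding objs_ok_def
proof (intro allI impI)
  fix u v assume s: "s \<in> Os" "6 \<notin> set s" and eq: "obj_enc s = u @ 6 # v"
  have "u = []"
  proof (rule ccontr)
    assume "u \<noteq> []"
    then obtain u' where "s @ [3] = u' @ 6 # v" using eq by (cases u) (auto simp: obj_enc_def)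
    then have "6 \<in> set (s @ [3])" by simp
    with s show False by simp
  qed
  then have "v = s @ 3 # []" using eq by (simp add: obj_enc_def)
  with s show "\<exists>s r. v = s @ 3 # r \<and> s \<in> Os" by blast
qed

lemma objs_ok_fact: "bin ` set (gobjs g) \<subseteq> Os \<Longrightarrow> objs_ok Os (enc_fact g)"
proof -
  assume *: "bin ` set (gobjs g) \<subseteq> Os"
  have "objs_ok Os (objs_enc (gobjs g))"
  proof (rule objs_ok_concat)
    fix a assume "a \<in> set (map (\<lambda>c. obj_enc (bin c)) (gobjs g))"
    then obtain c where "c \<in> set (gobjs g)" "a = obj_enc (bin c)" by auto
    moreover have "6 \<notin> set (bin c)" using bin_digits[of c] by auto
    ultimately show "objs_ok Os a" using * by (auto intro: objs_ok_enc)
  qed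
  moreover have "6 \<notin> set (enc_pred (gpred g))" using set_enc_pred[of "gpred g"] by auto
  moreover have "6 \<notin> set (time_enc (gtime g) @ [8])" using set_time_enc[of "gtime g"] by auto
  ultimately show ?thesis
    unfolding enc_fact_eq by (intro objs_ok_append) (auto intro: objs_ok_free)
qed

definition contains :: "nat list \<Rightarrow> nat list \<Rightarrow> bool" where
  "contains w s \<longleftrightarrow> (\<exists>u v. w = u @ s @ v)"

lemma contains_trans: "contains w s \<Longrightarrow> contains s t \<Longrightarrow> contains w t"
  unfolding contains_def by (metis append_assoc)

lemma contains_concat: "a \<in> set as \<Longrightarrow> contains (concat as) a"
proof -
  assume "a \<in> set as"
  then obtain ys zs where "as = ys @ a # zs" by (meson split_list)
  then have "concat as = concat ys @ a @ concat zs" by simp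
  then show ?thesis unfolding contains_def by blast
qed

lemma contains_append: "contains a s \<Longrightarrow> contains (a @ b) s" "contains b s \<Longrightarrow> contains (a @ b) s"
  unfolding contains_def by (metis append_assoc)+

lemma append_sep_split:
  assumes "b @ (x::nat) # R = u @ x # v" "x \<notin> set b"
  shows "u = b \<or> (\<exists>u'. u = b @ x # u' \<and> R = u' @ x # v)"
  using assms
proof (induction b arbitrary: u)
  case Nil
  then show ?case by (cases u) auto
next
  case (Cons y b)
  then show ?case by (cases u) auto
qed

text \<open>The symbol 8 occurs nowhere inside a fact or in the suffix, so each occurrence is a
  boundary of facts.\<close>

lemma fact_ends:
  assumes "concat (map enc_fact ds) @ suf = u @ 8 # v" "8 \<notin> set suf"
  shows "\<exists>ds1 ds2. ds = ds1 @ ds2 \<and> u @ [8] = concat (map enc_fact ds1)"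
  using assms(1)
proof (induction ds arbitrary: u)
  case Nil
  then have "8 \<in> set suf" by simp
  with assms(2) show ?case by simp
next
  case (Cons g ds)
  let ?b = "enc_pred (gpred g) @ objs_enc (gobjs g) @ time_enc (gtime g)"
  have g: "enc_fact g = ?b @ [8]" by (simp add: enc_fact_eq)
  have "8 \<notin> set ?b" using set_fact_body by fastforce
  moreover have "?b @ 8 # (concat (map enc_fact ds) @ suf) = u @ 8 # v" using Cons.prems g by simp
  ultimately consider "u = ?b" | u' where "u = ?b @ 8 # u'" "concat (map enc_fact ds) @ suf = u' @ 8 # v"
    using append_sep_split by blast
  then show ?case
  proof cases
    case 1
    then show ?thesis using g by (intro exI[of _ "[g]"] exI[of _ ds]) simp
  next
    case 2
    from Cons.IH[OF 2(2)] obtain ds1 ds2 where "ds = ds1 @ ds2" "u' @ [8] = concat (map enc_fact ds1)" by blast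
    then show ?thesis using g 2(1) by (intro exI[of _ "g # ds1"] exI[of _ ds2]) simp
  qed
qed

text \<open>Reads the argument list that starts at \<open>q\<close> and compares it, object by
  object, with the objects at the positions in the list; the reading ends at
  \<open>q'\<close>.\<close>

fun chain :: "nat list \<Rightarrow> nat \<Rightarrow> nat list \<Rightarrow> nat \<Rightarrow> bool" where
  "chain w q [] q' \<longleftrightarrow> q = q'"
| "chain w q (x # xs) q' \<longleftrightarrow> (\<exists>q1\<le>length w. sy w q = 6 \<and> tok w q x q1 \<and> chain w q1 xs q')"

lemma (in words) Def_chain:
  "q < m \<Longrightarrow> q' < m \<Longrightarrow> set xs \<subseteq> {..<m} \<Longrightarrow> Def m (\<lambda>i e. chain (wd i) (e q) (map e xs) (e q'))"
proof (induction xs arbitrary: q m)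
  case Nil
  then show ?case by (simp add: Def_eq)
next
  case (Cons x xs)
  have map_upd: "map (e(m := y)) xs = map e xs" for e :: "nat \<Rightarrow> nat" and y
    using Cons.prems by (intro map_cong) auto
  have "Def (Suc m) (\<lambda>i e. chain (wd i) (e m) (map e xs) (e q'))"
    by (rule Cons.IH) (use Cons.prems in auto)
  then have "Def m (\<lambda>i e. \<exists>y\<le>len i. sy (wd i) (e q) = 6 \<and> tok (wd i) (e q) (e x) y \<and> chain (wd i) y (map e xs) (e q'))"
    using Cons.prems by (intro Def_ex Def_conj Def_sym Def_tok) (auto simp: map_upd)
  then show ?case by simp
qed

section \<open>The word of an instance and its objects\<close>

type_synonym instance_data = "gatom list \<times> int \<times> int \<times> int"

locale forget_query =
  fixes P :: pred and \<Pi> :: "rule set" and N K b A :: nat and cs :: "nat list"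
  assumes Q: "temporal_query (P, \<Pi>)" and con: "connected \<Pi>" and ntp: "no_time_points \<Pi>"
    and N: "\<And>E d g. gpred g = P \<Longrightarrow> der \<Pi> E d g \<Longrightarrow> der \<Pi> E N g"
    and K: "shift_bound \<Pi> K" and b: "1 \<le> b" "\<And>r. r \<in> \<Pi> \<Longrightarrow> length (body r) \<le> b"
    and A: "arity_bound \<Pi> A" and cs: "set cs = consts_of \<Pi>"
begin

text \<open>The appended word lists the constants of the program and, as words over the new digit 9,
  fresh objects, so that every relevant object is a position of the symbol 6.\<close>

definition F :: nat where "F = b ^ N * A"

definition suf :: "nat list" where
  "suf = objs_enc cs @ concat (map (\<lambda>j. obj_enc (replicate (Suc j) 9)) [0..<F])"

definition ds_of :: "instance_data \<Rightarrow> gatom list" where "ds_of i = fst i"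
definition tin :: "instance_data \<Rightarrow> int" where "tin i = fst (snd i)"
definition tout :: "instance_data \<Rightarrow> int" where "tout i = fst (snd (snd i))"
definition tmem :: "instance_data \<Rightarrow> int" where "tmem i = snd (snd (snd i))"

definition insts :: "instance_data set" where
  "insts = {i. history (tin i) (set (ds_of i))}"

definition enc :: "instance_data \<Rightarrow> nat list" where
  "enc i = enc_instance (ds_of i) (tin i) (tout i) (tmem i)"

definition wd :: "instance_data \<Rightarrow> nat list" where
  "wd i = enc i @ suf"

definition hdr :: "instance_data \<Rightarrow> nat list" where
  "hdr i = enc_int (tin i) @ [3] @ enc_int (tout i) @ [3] @ enc_int (tmem i) @ [3]"

lemma wd_eq: "wd i = hdr i @ concat (map enc_fact (ds_of i)) @ suf"
  by (simp add: wd_def enc_def enc_instance_def hdr_def)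

definition old :: "instance_data \<Rightarrow> nat set" where
  "old i = objs (set (ds_of i)) \<union> consts_of \<Pi>"

definition M :: "instance_data \<Rightarrow> nat" where
  "M i = Max (insert 0 (old i))"

definition fresh :: "instance_data \<Rightarrow> nat set" where
  "fresh i = (\<lambda>j. M i + Suc j) ` {..<F}"

definition Dom :: "instance_data \<Rightarrow> nat set" where
  "Dom i = old i \<union> fresh i"

definition Os :: "instance_data \<Rightarrow> nat list set" where
  "Os i = bin ` old i \<union> (\<lambda>j. replicate (Suc j) 9) ` {..<F}"

text \<open>A block of nines is no binary code and denotes \<open>M i\<close> plus its length, hence
  an object larger than all those of the history and the program.\<close>

definition dec :: "instance_data \<Rightarrow> nat list \<Rightarrow> nat" where
  "dec i s = (if \<exists>c. s = bin c then THE c. s = bin c else M i + length s)"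

definition isobj :: "instance_data \<Rightarrow> nat \<Rightarrow> bool" where
  "isobj i x \<longleftrightarrow> sy (wd i) x = 6"

definition val :: "instance_data \<Rightarrow> nat \<Rightarrow> nat" where
  "val i x = dec i (takeWhile (\<lambda>a. a \<noteq> 3) (drop (Suc x) (wd i)))"

lemma finite_\<Pi>: "finite \<Pi>" and wf_\<Pi>: "r \<in> \<Pi> \<Longrightarrow> wf_rule r"
  using Q by (auto simp: temporal_query_def program_def)

lemma finite_old: "finite (old i)"
  using finite_consts_of[OF finite_\<Pi>] by (auto simp: old_def objs_def)

lemma M_ge: "c \<in> old i \<Longrightarrow> c \<le> M i"
  using finite_old by (simp add: M_def)

lemma fresh_disjoint: "fresh i \<inter> old i = {}"
  using M_ge by (fastforce simp: fresh_def)

lemma dec_bin: "dec i (bin c) = c"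
proof -
  have "(THE c'. bin c = bin c') = c" by (rule the_equality) (auto dest: bin_inj)
  then show ?thesis by (auto simp: dec_def)
qed

lemma dec_fresh: "dec i (replicate (Suc j) 9) = M i + Suc j"
proof -
  have "replicate (Suc j) 9 \<noteq> bin c" for c
  proof
    assume "replicate (Suc j) 9 = bin c"
    then have "9 \<in> set (bin c)" by (metis in_set_replicate nat.simps(3))
    then show False using bin_digits[of c] by auto
  qed
  then show ?thesis by (auto simp: dec_def)
qed

lemma dec_Os: "dec i ` Os i = Dom i"
  by (simp add: Os_def Dom_def fresh_def image_Un image_image dec_bin dec_fresh del: replicate_Suc)

text \<open>Turns equality of objects into equality of tokens, which \<open>tok\<close> can
  test.\<close>

lemma dec_inj: "inj_on (dec i) (Os i)"
proof (rule inj_onI)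
  fix s s' assume *: "s \<in> Os i" "s' \<in> Os i" "dec i s = dec i s'"
  have "\<And>c j. c \<in> old i \<Longrightarrow> c \<noteq> M i + Suc j" using M_ge by fastforce
  with * show "s = s'"
    unfolding Os_def by (auto simp: dec_bin dec_fresh simp del: replicate_Suc; metis)
qed

lemma dec_eq:
  assumes "s \<in> Os i" "c \<in> old i"
  shows "dec i s = c \<longleftrightarrow> s = bin c"
proof
  assume "dec i s = c"
  then have "dec i s = dec i (bin c)" by (simp only: dec_bin)
  moreover have "bin c \<in> Os i" using assms(2) by (simp add: Os_def)
  ultimately show "s = bin c" using inj_onD[OF dec_inj _ assms(1)] by blast
qed (simp only: dec_bin)

lemma Os_no3: "s \<in> Os i \<Longrightarrow> 3 \<notin> set s" and Os_no6: "s \<in> Os i \<Longrightarrow> 6 \<notin> set s"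
  using bin_digits by (fastforce simp: Os_def)+

lemma set_suf: "set suf \<subseteq> {1, 2, 3, 6, 9}"
proof
  fix a assume "a \<in> set suf"
  then consider c where "a \<in> set (obj_enc (bin c))" | j where "a \<in> set (obj_enc (replicate (Suc j) 9))"
    by (auto simp: suf_def simp del: replicate_Suc)
  then show "a \<in> {1, 2, 3, 6, 9}"
  proof cases
    case 1
    then show ?thesis using set_obj_enc by blast
  next
    case 2
    then show ?thesis by (auto simp: obj_enc_def)
  qed
qed

lemma word_wd: "word (wd i)"
proof -
  have "set (enc_fact g) \<subseteq> {1..9}" for g
    using set_fact_body[of "gpred g" "gobjs g" "gtime g"] by (auto simp: enc_fact_eq)
  then have "set (concat (map enc_fact (ds_of i))) \<subseteq> {1..9}" by auto
  moreover have "set (hdr i) \<subseteq> {1..9}" using set_enc_int by (fastforce simp: hdr_def)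
  moreover have "set suf \<subseteq> {1..9}" using set_suf by auto
  ultimately have "set (wd i) \<subseteq> {1..9}" by (simp add: wd_eq)
  then show ?thesis by (fastforce simp: word_def)
qed

sublocale words wd insts
  by unfold_locales (rule word_wd)

lemma objs_ok_wd: "objs_ok (Os i) (wd i)"
proof -
  have "objs_ok (Os i) (hdr i)" using set_enc_int by (intro objs_ok_free) (fastforce simp: hdr_def)
  moreover have "objs_ok (Os i) (concat (map enc_fact (ds_of i)))"
    by (rule objs_ok_concat) (auto simp: Os_def old_def objs_def intro!: objs_ok_fact)
  moreover have "objs_ok (Os i) suf"
  proof -
    have "bin c \<in> Os i" if "c \<in> set cs" for c using that cs by (auto simp: Os_def old_def)
    moreover have "replicate (Suc j) 9 \<in> Os i" if "j < F" for j using that by (auto simp: Os_def)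
    ultimately show ?thesis
      unfolding suf_def
      by (intro objs_ok_append objs_ok_concat) (auto intro!: objs_ok_enc Os_no6 simp del: replicate_Suc)
  qed
  ultimately show ?thesis unfolding wd_eq by (intro objs_ok_append)
qed

lemma isobj_drop:
  assumes "isobj i x"
  obtains s r where "s \<in> Os i" "drop x (wd i) = (6 # s) @ 3 # r" "val i x = dec i s" "3 \<notin> set s"
proof -
  have d: "drop x (wd i) = 6 # drop (Suc x) (wd i)" using assms sy_Suc[of 6] by (simp add: isobj_def)
  then have "wd i = take x (wd i) @ 6 # drop (Suc x) (wd i)" by (metis append_take_drop_id)
  then obtain s r where s: "drop (Suc x) (wd i) = s @ 3 # r" "s \<in> Os i"
    using objs_ok_wd[of i] unfolding objs_ok_def by blast
  have "takeWhile (\<lambda>a. a \<noteq> 3) (s @ 3 # r) = s"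
    using Os_no3[OF s(2)] by (subst takeWhile_append2) auto
  then show ?thesis using that[of s r] s d Os_no3[OF s(2)] by (simp add: val_def)
qed

lemma contains_Os:
  assumes "s \<in> Os i"
  shows "contains (wd i) (obj_enc s)"
proof -
  consider g c where "g \<in> set (ds_of i)" "c \<in> set (gobjs g)" "s = bin c"
    | c where "c \<in> set cs" "s = bin c" | j where "j < F" "s = replicate (Suc j) 9"
    using assms cs by (auto simp: Os_def old_def objs_def simp del: replicate_Suc)
  then show ?thesis
  proof cases
    case 1
    have "contains (concat (map enc_fact (ds_of i))) (enc_fact g)"
      using 1(1) by (intro contains_concat) auto
    moreover have "contains (enc_fact g) (obj_enc s)"
      unfolding enc_fact_eq using 1(2,3) by (intro contains_append(2) contains_append(1) contains_concat) auto
    ultimately have "contains (concat (map enc_fact (ds_of i))) (obj_enc s)" by (rule contains_trans)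
    then show ?thesis unfolding wd_eq by (meson contains_append)
  next
    case 2
    then have "contains (objs_enc cs) (obj_enc s)"
      by (intro contains_concat) auto
    then show ?thesis unfolding wd_eq suf_def by (meson contains_append)
  next
    case 3
    then have "contains (concat (map (\<lambda>j. obj_enc (replicate (Suc j) 9)) [0..<F])) (obj_enc s)"
      by (intro contains_concat) auto
    then show ?thesis unfolding wd_eq suf_def by (meson contains_append)
  qed
qed

text \<open>Objects of the history carry a tag inside their facts; program constants and fresh
  objects owe theirs to the suffix.\<close>

lemma Dom_val: "Dom i = val i ` {x. x \<le> len i \<and> isobj i x}"
proof
  show "Dom i \<subseteq> val i ` {x. x \<le> len i \<and> isobj i x}"
  proof
    fix c assume "c \<in> Dom i"
    then have "c \<in> dec i ` Os i" by (simp only: dec_Os)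
    then obtain s where s: "s \<in> Os i" "dec i s = c" by blast
    obtain u v where uv: "wd i = u @ obj_enc s @ v" using contains_Os[OF s(1)] by (auto simp: contains_def)
    then have d: "drop (length u) (wd i) = (6 # s) @ 3 # v" by (simp add: obj_enc_def)
    then have x: "isobj i (length u)" using sy_Suc[of 6 "wd i" "length u"] drop_sy[OF d, of 0] by (simp add: isobj_def)
    then obtain s' r where "s' \<in> Os i" "drop (length u) (wd i) = (6 # s') @ 3 # r" "val i (length u) = dec i s'" "3 \<notin> set s'"
      by (rule isobj_drop)
    moreover have "s = s'" using separator_unique[of s 3 v s' r] calculation d Os_no3[OF s(1)] by simp
    ultimately show "c \<in> val i ` {x. x \<le> len i \<and> isobj i x}" using x s(2) uv by (intro image_eqI[of _ _ "length u"]) auto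
  qed
  show "val i ` {x. x \<le> len i \<and> isobj i x} \<subseteq> Dom i"
  proof
    fix c assume "c \<in> val i ` {x. x \<le> len i \<and> isobj i x}"
    then obtain x where x: "isobj i x" "c = val i x" by blast
    obtain s r where "s \<in> Os i" "val i x = dec i s" using x(1) by (rule isobj_drop)
    then have "c \<in> dec i ` Os i" using x(2) by blast
    then show "c \<in> Dom i" by (simp only: dec_Os)
  qed
qed

lemma tok_val_eq:
  assumes "isobj i x" "isobj i y"
  shows "(\<exists>z\<le>len i. tok (wd i) x y z) \<longleftrightarrow> val i x = val i y"
proof -
  obtain s r where s: "s \<in> Os i" "drop x (wd i) = (6 # s) @ 3 # r" "val i x = dec i s" "3 \<notin> set s"
    using assms(1) by (rule isobj_drop)
  obtain s' r' where s': "s' \<in> Os i" "drop y (wd i) = (6 # s') @ 3 # r'" "val i y = dec i s'" "3 \<notin> set s'"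
    using assms(2) by (rule isobj_drop)
  have tok: "tok (wd i) x y z \<longleftrightarrow> s = s' \<and> z = x + length (6 # s) + 1" for z
    using tok_unique[OF s(2) _ s'(2), of z] s(4) s'(4) by simp
  have "drop x (wd i) = (6 # s @ [3]) @ r" using s(2) by simp
  from drop_length[OF this] have "x + length (6 # s) + 1 \<le> len i" by simp
  then show ?thesis using tok s(1,3) s'(1,3) dec_inj[of i] by (auto dest: inj_onD)
qed

lemma at_val:
  assumes "isobj i x" "c \<in> old i"
  shows "at (wd i) x (obj_enc (bin c)) \<longleftrightarrow> val i x = c"
proof -
  obtain s r where s: "s \<in> Os i" "drop x (wd i) = (6 # s) @ 3 # r" "val i x = dec i s" "3 \<notin> set s"
    using assms(1) by (rule isobj_drop)
  have "at (wd i) x (obj_enc (bin c)) \<longleftrightarrow> s = bin c"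
    using separator_unique[of s 3 r "bin c"] s(2,4) bin_no3[of c] by (auto simp: at_def obj_enc_def)
  then show ?thesis unfolding s(3) dec_eq[OF s(1) assms(2)] .
qed

lemma obj_enc_nonzero: "0 \<notin> set (obj_enc (bin c))"
  using set_obj_enc[of c] by auto

sublocale coded wd insts isobj val Dom \<Pi>
proof unfold_locales
  show isobj: "Def m (\<lambda>i e. isobj i (e j))" if "j < m" for j m
    unfolding isobj_def using that by (rule Def_sym)
  show "Def m (\<lambda>i e. isobj i (e j) \<and> isobj i (e k) \<and> val i (e j) = val i (e k))" if "j < m" "k < m" for j k m
  proof -
    have "Def m (\<lambda>i e. isobj i (e j) \<and> isobj i (e k) \<and> (\<exists>z\<le>len i. tok (wd i) (e j) (e k) z))"
      using that by (intro Def_conj isobj Def_ex Def_tok) auto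
    then show ?thesis by (rule Def_cong) (use tok_val_eq in blast)
  qed
  show "Def m (\<lambda>i e. isobj i (e j) \<and> val i (e j) = c)" if "c \<in> consts_of \<Pi>" "j < m" for c j m
  proof -
    have "Def m (\<lambda>i e. isobj i (e j) \<and> at (wd i) (e j) (obj_enc (bin c)))"
      using that by (intro Def_conj isobj Def_at obj_enc_nonzero) auto
    moreover have c: "c \<in> old i" for i using that(1) by (simp add: old_def)
    ultimately show ?thesis by (elim Def_cong) (use at_val c in blast)
  qed
  show "Dom i = val i ` {x. x \<le> len i \<and> isobj i x}" for i by (rule Dom_val)
  show "consts_of \<Pi> \<subseteq> Dom i" for i by (auto simp: Dom_def old_def)
qed (use finite_\<Pi> wf_\<Pi> con ntp in auto)

section \<open>Finding a fact in the word\<close>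

lemma chain_iff:
  assumes "drop q (wd i) = objs_enc os @ r" "length xs = length os"
    "\<And>x. x \<in> set xs \<Longrightarrow> isobj i x" "set os \<subseteq> old i"
  shows "chain (wd i) q xs q' \<longleftrightarrow> map (val i) xs = os \<and> q' = q + length (objs_enc os)"
  using assms
proof (induction os arbitrary: q xs)
  case Nil
  then show ?case by auto
next
  case (Cons c os)
  then obtain x ys where xs: "xs = x # ys" by (cases xs) auto
  let ?R = "objs_enc os @ r"
  have d: "drop q (wd i) = (6 # bin c) @ 3 # ?R" using Cons.prems(1) by (simp add: obj_enc_def)
  have sy: "sy (wd i) q = 6" using drop_sy[OF d, of 0] by simp
  obtain s r' where s: "s \<in> Os i" "drop x (wd i) = (6 # s) @ 3 # r'" "val i x = dec i s" "3 \<notin> set s"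
    using Cons.prems(3)[of x] xs by (auto elim: isobj_drop)
  let ?q = "q + length (obj_enc (bin c))"
  have tok: "tok (wd i) q x q1 \<longleftrightarrow> bin c = s \<and> q1 = ?q" for q1
    using tok_unique[OF d _ s(2), of q1] s(4) bin_no3[of c] by (simp add: obj_enc_def)
  have c: "bin c = s \<longleftrightarrow> val i x = c"
    using dec_eq[OF s(1), of c] s(3) Cons.prems(4) by auto
  have "drop q (wd i) = obj_enc (bin c) @ ?R" using d by (simp add: obj_enc_def)
  from drop_length[OF this] have len: "?q \<le> len i" by (simp add: obj_enc_def)
  have "drop ?q (wd i) = drop (length (obj_enc (bin c))) (drop q (wd i))" by (simp add: add.commute)
  also have "\<dots> = ?R" using d by (simp add: obj_enc_def)
  finally have "chain (wd i) ?q ys q' \<longleftrightarrow> map (val i) ys = os \<and> q' = ?q + length (objs_enc os)"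
    using Cons.prems xs by (intro Cons.IH) auto
  then show ?case using sy tok c len xs by auto
qed

text \<open>The position behind the last fact qualifies as well, so that no fact has to be known to
  follow.\<close>

definition start :: "instance_data \<Rightarrow> nat \<Rightarrow> bool" where
  "start i p \<longleftrightarrow> p = length (hdr i) \<or> (\<exists>q\<le>len i. p = Suc q \<and> sy (wd i) q = 8)"

lemma start_iff:
  "start i p \<longleftrightarrow> (\<exists>ds1 ds2. ds_of i = ds1 @ ds2 \<and> p = length (hdr i @ concat (map enc_fact ds1)))"
proof
  assume "start i p"
  then consider "p = length (hdr i)" | q where "p = Suc q" "sy (wd i) q = 8" unfolding start_def by blast
  then show "\<exists>ds1 ds2. ds_of i = ds1 @ ds2 \<and> p = length (hdr i @ concat (map enc_fact ds1))"
  proof cases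
    case 1
    then show ?thesis by (intro exI[of _ "[]"] exI[of _ "ds_of i"]) simp
  next
    case 2
    have "drop q (wd i) = 8 # drop (Suc q) (wd i)" using sy_Suc[of 8] 2(2) by simp
    then have w: "hdr i @ concat (map enc_fact (ds_of i)) @ suf = take q (wd i) @ 8 # drop (Suc q) (wd i)"
      unfolding wd_eq[symmetric] by (metis append_take_drop_id)
    have q: "q < len i" using 2(2) by (auto simp: sy_def split: if_splits)
    \<comment> \<open>Forces the 8 in question to lie behind the header, where
      \<open>fact_ends\<close> applies.\<close>
    have h8: "8 \<notin> set (hdr i)" using set_enc_int by (fastforce simp: hdr_def)
    from w obtain us where "hdr i = take q (wd i) @ us \<and> us @ concat (map enc_fact (ds_of i)) @ suf = 8 # drop (Suc q) (wd i) \<or>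
        hdr i @ us = take q (wd i) \<and> concat (map enc_fact (ds_of i)) @ suf = us @ 8 # drop (Suc q) (wd i)"
      by (auto simp: append_eq_append_conv2)
    then obtain us where us: "take q (wd i) = hdr i @ us" "concat (map enc_fact (ds_of i)) @ suf = us @ 8 # drop (Suc q) (wd i)"
    proof (elim disjE conjE)
      assume *: "hdr i = take q (wd i) @ us" "us @ concat (map enc_fact (ds_of i)) @ suf = 8 # drop (Suc q) (wd i)"
      then have "us = []" using h8 by (cases us) auto
      with * that[of "[]"] show ?thesis by simp
    next
      assume "hdr i @ us = take q (wd i)" "concat (map enc_fact (ds_of i)) @ suf = us @ 8 # drop (Suc q) (wd i)"
      then show ?thesis by (intro that[of us]) (rule sym)
    qed
    have "8 \<notin> set suf" using set_suf by auto
    from fact_ends[OF us(2) this] obtain ds1 ds2 where ds: "ds_of i = ds1 @ ds2" "us @ [8] = concat (map enc_fact ds1)" by blast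
    have "q = length (hdr i) + length us" using us(1) q by (metis length_append length_take min.absorb4)
    then have "p = length (hdr i @ us @ [8])" using 2(1) by simp
    with ds show ?thesis by auto
  qed
next
  assume "\<exists>ds1 ds2. ds_of i = ds1 @ ds2 \<and> p = length (hdr i @ concat (map enc_fact ds1))"
  then obtain ds1 ds2 where ds: "ds_of i = ds1 @ ds2" "p = length (hdr i @ concat (map enc_fact ds1))" by blast
  show "start i p"
  proof (cases ds1 rule: rev_cases)
    case Nil
    then show ?thesis using ds by (simp add: start_def)
  next
    case (snoc ds g)
    let ?b = "enc_pred (gpred g) @ objs_enc (gobjs g) @ time_enc (gtime g)"
    let ?u = "hdr i @ concat (map enc_fact ds) @ ?b"
    have w: "wd i = ?u @ 8 # (concat (map enc_fact ds2) @ suf)" using ds snoc by (simp add: wd_eq enc_fact_eq)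
    have "sy (wd i) (length ?u) = 8" unfolding w sy_def by (simp add: nth_append)
    moreover have "p = Suc (length ?u)" using ds snoc by (simp add: enc_fact_eq)
    moreover have "length ?u \<le> len i" unfolding w by simp
    ultimately show ?thesis unfolding start_def by blast
  qed
qed

text \<open>Membership as a search: a start, the predicate code, the chain of arguments, then the
  numeral. The test \<open>Qt\<close> on its position and its meaning \<open>T\<close> are
  parameters, so that the full and the restricted history share one argument.\<close>

lemma fact_iff:
  assumes i: "i \<in> insts" and xs: "\<And>x. x \<in> set xs \<Longrightarrow> isobj i x" "length xs = parity R"
    and T: "\<And>q t. time_at (wd i) q t \<Longrightarrow> Qt q \<longleftrightarrow> T t"
  shows "(\<exists>p\<le>len i. start i p \<and> at (wd i) p (enc_pred R) \<and> (\<exists>q\<le>len i. q = p + length (enc_pred R) \<and>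
      (\<exists>q'\<le>len i. chain (wd i) q xs q' \<and> (ptemp R \<longrightarrow> (\<exists>q2\<le>len i. q2 = Suc q' \<and> Qt q2))))) \<longleftrightarrow>
    (\<exists>g\<in>set (ds_of i). gpred g = R \<and> gobjs g = map (val i) xs \<and> (\<forall>t. gtime g = Some t \<longrightarrow> T t))"
    (is "?L \<longleftrightarrow> ?R")
proof -
  have wf: "wf_gatom g" if "g \<in> set (ds_of i)" for g
    using i that by (auto simp: insts_def history_def dataset_def)
  have drops: "drop (p + length (enc_pred (gpred g))) (wd i) = objs_enc (gobjs g) @
       (time_enc (gtime g) @ 8 # rest)" (is ?thesis1)
    and tails: "\<And>z. drop (p + length (enc_pred (gpred g)) + length (objs_enc (gobjs g))) (wd i) =
       time_enc (gtime g) @ 8 # rest" (is "PROP ?thesis2")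
    if "drop p (wd i) = enc_fact g @ rest" for p g rest
  proof -
    have "drop (length (enc_pred (gpred g))) (drop p (wd i)) = objs_enc (gobjs g) @
       (time_enc (gtime g) @ 8 # rest)" using that by (simp add: enc_fact_eq)
    then show 1: ?thesis1 by (simp add: add.commute)
    have "drop (length (objs_enc (gobjs g))) (drop (p + length (enc_pred (gpred g))) (wd i)) =
       time_enc (gtime g) @ 8 # rest" unfolding 1 by simp
    then show "PROP ?thesis2" by (simp add: add.commute)
  qed
  have old: "set (gobjs g) \<subseteq> old i" if "g \<in> set (ds_of i)" for g
    using that by (auto simp: old_def objs_def)
  have time: "time_at (wd i) (Suc q') t" if "drop q' (wd i) = time_enc (Some t) @ 8 # rest" for q' t rest
  proof -
    have "drop (Suc q') (wd i) = tl (drop q' (wd i))" by (simp add: drop_Suc tl_drop)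
    then show ?thesis using that by (simp add: time_enc_def time_at_def)
  qed
  show ?thesis
  proof
    assume ?L
    then obtain p q' where p: "start i p" "at (wd i) p (enc_pred R)" "chain (wd i) (p + length (enc_pred R)) xs q'"
      "ptemp R \<Longrightarrow> Qt (Suc q')" by blast
    from p(1) obtain ds1 ds2 where ds: "ds_of i = ds1 @ ds2" "p = length (hdr i @ concat (map enc_fact ds1))"
      unfolding start_iff by blast
    have d: "drop p (wd i) = concat (map enc_fact ds2) @ suf" unfolding wd_eq ds by simp
    obtain x where x: "drop p (wd i) = enc_pred R @ x" using p(2) by (auto simp: at_def)
    \<comment> \<open>Behind the last fact comes the suffix, which is empty or begins with the
      object tag 6; no predicate code does.\<close>
    have "ds2 \<noteq> []"
    proof
      assume "ds2 = []"
      then have suf: "suf = enc_pred R @ x" using d x by simp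
      have "suf = [] \<or> (\<exists>r. suf = 6 # r)"
        unfolding suf_def by (cases cs; cases F) (auto simp: obj_enc_def upt_rec[of 0])
      with suf enc_pred_Cons[of R] show False by auto
    qed
    then obtain g ds3 where ds2: "ds2 = g # ds3" by (cases ds2) auto
    have g: "g \<in> set (ds_of i)" using ds(1) ds2 by simp
    let ?r = "concat (map enc_fact ds3) @ suf"
    have dg: "drop p (wd i) = enc_fact g @ ?r" using d ds2 by simp
    have R: "gpred g = R" using enc_pred_unique[of "gpred g" _ R x] dg x by (simp add: enc_fact_eq)
    have "length xs = length (gobjs g)" using wf[OF g] xs(2) R by (simp add: wf_gatom_def)
    from chain_iff[OF drops[OF dg] this xs(1) old[OF g], of q'] p(3) R
    have c: "map (val i) xs = gobjs g" "q' = p + length (enc_pred (gpred g)) + length (objs_enc (gobjs g))"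
      by auto
    have "T t" if t: "gtime g = Some t" for t
    proof -
      have "ptemp R" using wf[OF g] R t by (simp add: wf_gatom_def)
      moreover have "time_at (wd i) (Suc q') t" using tails[OF dg] c(2) t by (intro time) auto
      ultimately show ?thesis using p(4) T by blast
    qed
    with g R c(1) show ?R by metis
  next
    assume ?R
    then obtain g where g: "g \<in> set (ds_of i)" "gpred g = R" "gobjs g = map (val i) xs" "\<And>t. gtime g = Some t \<Longrightarrow> T t" by blast
    obtain ds1 ds2 where ds: "ds_of i = ds1 @ g # ds2" using g(1) by (meson split_list)
    let ?p = "length (hdr i @ concat (map enc_fact ds1))" and ?r = "concat (map enc_fact ds2) @ suf"
    let ?C = "objs_enc (gobjs g)"
    let ?q = "?p + length (enc_pred R)"
    let ?q' = "?q + length ?C"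
    have start: "start i ?p" unfolding start_iff using ds by blast
    have dg: "drop ?p (wd i) = enc_fact g @ ?r" unfolding wd_eq ds by simp
    have at: "at (wd i) ?p (enc_pred R)" unfolding at_def dg enc_fact_eq g(2) by simp
    have chain: "chain (wd i) ?q xs ?q'"
      using chain_iff[OF drops[OF dg] _ xs(1) old[OF g(1)], of xs ?q'] g(2,3) by simp
    have lens: "?q' + length (time_enc (gtime g)) < len i" unfolding wd_eq ds by (simp add: enc_fact_eq g(2))
    have "\<exists>q2\<le>len i. q2 = Suc ?q' \<and> Qt q2" if "ptemp R"
    proof -
      obtain t where t: "gtime g = Some t" using wf[OF g(1)] g(2) \<open>ptemp R\<close> by (auto simp: wf_gatom_def)
      have "time_at (wd i) (Suc ?q') t" using tails[OF dg] g(2) t by (intro time) auto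
      then show ?thesis using T g(4)[OF t] lens by auto
    qed
    moreover have "?p \<le> len i" "?q \<le> len i" "?q' \<le> len i" using lens by auto
    ultimately show ?L using start at chain by blast
  qed
qed

end

section \<open>Definability of forgetting\<close>

text \<open>Closes a formula by guessing all its \<open>l\<close> heads at once. Heads from
  \<open>l\<close> on are not read and are set to 0.\<close>

lemma (in words) Def_env:
  assumes \<Phi>: "Def l \<Phi>"
  shows "Def 0 (\<lambda>i e. \<exists>e'. ok i e' \<and> \<Phi> i e')"
proof -
  let ?env = "\<lambda>ys j. if j < l then ys ! j else (0::nat)"
  have "Def (0 + l) (\<lambda>i e. \<Phi> i (?env (map e [0..<0 + l])))"
  proof (rule Def_cong)
    show "Def (0 + l) \<Phi>" using \<Phi> by simp
    fix i e assume "i \<in> I" "ok i e"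
    moreover have "ok i (?env (map e [0..<0 + l]))" using ok_le[OF \<open>ok i e\<close>] by (simp add: ok_def)
    moreover have "agree l (?env (map e [0..<0 + l])) e" by (simp add: agree_def)
    ultimately show "\<Phi> i (?env (map e [0..<0 + l])) = \<Phi> i e"
      using \<Phi> unfolding Def_def ind_def by blast
  qed
  then have "Def 0 (\<lambda>i e. \<exists>ys. length ys = l \<and> (\<forall>y\<in>set ys. y \<le> len i) \<and> \<Phi> i (?env ys))"
    by (rule Def_exs) simp
  then show ?thesis
  proof (rule Def_cong)
    fix i assume i: "i \<in> I"
    show "(\<exists>e'. ok i e' \<and> \<Phi> i e') = (\<exists>ys. length ys = l \<and> (\<forall>y\<in>set ys. y \<le> len i) \<and> \<Phi> i (?env ys))"
    proof
      assume "\<exists>e'. ok i e' \<and> \<Phi> i e'"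
      then obtain e' where e': "ok i e'" "\<Phi> i e'" by blast
      let ?ys = "map e' [0..<l]"
      have "ok i (?env ?ys)" using ok_le[OF e'(1)] by (simp add: ok_def)
      moreover have "agree l e' (?env ?ys)" by (simp add: agree_def)
      ultimately have "\<Phi> i (?env ?ys)" using \<Phi> i e' unfolding Def_def ind_def by blast
      then show "\<exists>ys. length ys = l \<and> (\<forall>y\<in>set ys. y \<le> len i) \<and> \<Phi> i (?env ys)"
        using ok_le[OF e'(1)] by (intro exI[of _ ?ys]) auto
    next
      assume "\<exists>ys. length ys = l \<and> (\<forall>y\<in>set ys. y \<le> len i) \<and> \<Phi> i (?env ys)"
      then obtain ys where "length ys = l" "\<forall>y\<in>set ys. y \<le> len i" "\<Phi> i (?env ys)" by blast
      then show "\<exists>e'. ok i e' \<and> \<Phi> i e'" by (intro exI[of _ "?env ys"]) (auto simp: ok_def)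
    qed
  qed
qed

abbreviation pv :: "pred \<times> int \<times> nat list \<Rightarrow> pred" where "pv v \<equiv> fst v"
abbreviation kv :: "pred \<times> int \<times> nat list \<Rightarrow> int" where "kv v \<equiv> fst (snd v)"
abbreviation xv :: "pred \<times> int \<times> nat list \<Rightarrow> nat list" where "xv v \<equiv> snd (snd v)"

text \<open>A layout assigns consecutive heads to the objects of the atoms of a guessed update.\<close>

fun layout :: "nat \<Rightarrow> (pred \<times> int) list \<Rightarrow> (pred \<times> int \<times> nat list) list" where
  "layout m [] = []"
| "layout m (s # S) = (fst s, snd s, [m..<m + parity (fst s)]) # layout (m + parity (fst s)) S"

definition width :: "(pred \<times> int) list \<Rightarrow> nat" where
  "width S = (\<Sum>s\<leftarrow>S. parity (fst s))"

lemma layout_props: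
  "v \<in> set (layout m S) \<Longrightarrow> set (xv v) \<subseteq> {m..<m + width S} \<and> length (xv v) = parity (pv v) \<and> (pv v, kv v) \<in> set S"
proof (induction S arbitrary: m)
  case (Cons s S)
  then consider "v = (fst s, snd s, [m..<m + parity (fst s)])" | "v \<in> set (layout (m + parity (fst s)) S)" by auto
  then show ?case
  proof cases
    case 2
    from Cons.IH[OF this] show ?thesis by (auto simp: width_def)
  qed (auto simp: width_def)
qed simp

lemma length_layout: "length (layout m S) = length S"
  by (induction S arbitrary: m) auto

text \<open>Serves to realise a given update by heads: \<open>f\<close> reads the object under a
  head, and \<open>h\<close> is the time offset of a fact.\<close>

lemma layout_atoms:
  assumes "\<And>u. u \<in> set us \<Longrightarrow> length (gobjs u) = parity (gpred u)"
    and "\<And>j. j < length (concat (map gobjs us)) \<Longrightarrow> f (m + j) = concat (map gobjs us) ! j"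
  shows "map (\<lambda>v. GAtom (pv v) (map f (xv v)) (Some (c + kv v))) (layout m (map (\<lambda>u. (gpred u, h u)) us)) =
    map (\<lambda>u. GAtom (gpred u) (gobjs u) (Some (c + h u))) us"
  using assms
proof (induction us arbitrary: m)
  case (Cons u us)
  let ?a = "parity (gpred u)"
  have len: "length (gobjs u) = ?a" using Cons.prems(1) by simp
  have "map f [m..<m + ?a] = gobjs u"
  proof (rule nth_equalityI)
    fix j assume "j < length (map f [m..<m + ?a])"
    then show "map f [m..<m + ?a] ! j = gobjs u ! j" using Cons.prems(2)[of j] len by (simp add: nth_append)
  qed (use len in simp)
  moreover have "map (\<lambda>v. GAtom (pv v) (map f (xv v)) (Some (c + kv v))) (layout (m + ?a) (map (\<lambda>u. (gpred u, h u)) us)) =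
    map (\<lambda>u. GAtom (gpred u) (gobjs u) (Some (c + h u))) us"
  proof (rule Cons.IH)
    fix j assume "j < length (concat (map gobjs us))"
    then show "f (m + ?a + j) = concat (map gobjs us) ! j"
      using Cons.prems(2)[of "?a + j"] len by (simp add: nth_append add.assoc)
  qed (use Cons.prems(1) in auto)
  ultimately show ?case by simp
qed simp

lemma map_upd: "set (xs :: nat list) \<subseteq> {..<m} \<Longrightarrow> m \<le> j \<Longrightarrow> map (e(j := y)) xs = map e xs"
proof -
  assume "set xs \<subseteq> {..<m}" "m \<le> j"
  then have "j \<notin> set xs" by auto
  then show ?thesis by simp
qed

section \<open>Header, times and membership in the data\<close>

context forget_query
begin

definition posout :: "instance_data \<Rightarrow> nat" where
  "posout i = length (enc_int (tin i)) + 1"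

definition posmem :: "instance_data \<Rightarrow> nat" where
  "posmem i = posout i + length (enc_int (tout i)) + 1"

lemma header_drops:
  "\<exists>r. drop 0 (wd i) = enc_int (tin i) @ 3 # r"
  "\<exists>r. drop (posout i) (wd i) = enc_int (tout i) @ 3 # r"
  "\<exists>r. drop (posmem i) (wd i) = enc_int (tmem i) @ 3 # r"
  by (simp_all add: wd_eq hdr_def posout_def posmem_def)

lemma enc_int_no3: "3 \<notin> set (enc_int z)"
  using set_enc_int[of z] by auto

text \<open>Comparing a token with itself always succeeds and locates its end, which is how one
  header field leads to the next.\<close>

lemma tok_header:
  "tok (wd i) 0 0 p \<longleftrightarrow> p = posout i"
  "tok (wd i) (posout i) (posout i) p \<longleftrightarrow> p = posmem i"
  "tok (wd i) (posmem i) (posmem i) p \<longleftrightarrow> p = length (hdr i)"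
proof -
  have *: "tok (wd i) q q p \<longleftrightarrow> p = q + length (enc_int z) + 1" if "\<exists>r. drop q (wd i) = enc_int z @ 3 # r" for q z
    using that tok_unique[of q "wd i" "enc_int z" _ q "enc_int z" _ p] enc_int_no3[of z] by auto
  show "tok (wd i) 0 0 p \<longleftrightarrow> p = posout i"
    using *[OF header_drops(1)] by (simp add: posout_def)
  show "tok (wd i) (posout i) (posout i) p \<longleftrightarrow> p = posmem i"
    using *[OF header_drops(2)] by (simp add: posmem_def)
  show "tok (wd i) (posmem i) (posmem i) p \<longleftrightarrow> p = length (hdr i)"
    using *[OF header_drops(3)] by (simp add: posmem_def posout_def hdr_def add.assoc)
qed

lemma time_at_header:
  "time_at (wd i) 0 (tin i)" "time_at (wd i) (posout i) (tout i)" "time_at (wd i) (posmem i) (tmem i)"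
  using header_drops by (auto simp: time_at_def)

lemma pos_le: "posout i \<le> len i" "posmem i \<le> len i"
  by (simp_all add: wd_eq hdr_def posout_def posmem_def)

lemma Def_next:
  assumes "\<And>m j. j < m \<Longrightarrow> Def m (\<lambda>i e. e j = p i)" "\<And>i. p i \<le> len i"
    and "\<And>i q. tok (wd i) (p i) (p i) q \<longleftrightarrow> q = p' i"
  shows "j < m \<Longrightarrow> Def m (\<lambda>i e. e j = p' i)"
proof -
  assume j: "j < m"
  have "Def m (\<lambda>i e. \<exists>z\<le>len i. z = p i \<and> tok (wd i) z z (e j))"
    using j by (intro Def_ex Def_conj assms(1) Def_tok) auto
  then show ?thesis
  proof (rule Def_cong)
    fix i and e :: "nat \<Rightarrow> nat"
    show "(e j = p' i) = (\<exists>z\<le>len i. z = p i \<and> tok (wd i) z z (e j))"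
      using assms(2)[of i] assms(3)[of i "e j"] by auto
  qed
qed

lemma Def_posout: "j < m \<Longrightarrow> Def m (\<lambda>i e. e j = posout i)"
  by (rule Def_next[of "\<lambda>i. 0"]) (auto intro: Def_zero simp: tok_header)

lemma Def_posmem: "j < m \<Longrightarrow> Def m (\<lambda>i e. e j = posmem i)"
  by (rule Def_next[of posout]) (auto intro: Def_posout simp: tok_header pos_le)

lemma Def_hdr: "j < m \<Longrightarrow> Def m (\<lambda>i e. e j = length (hdr i))"
  by (rule Def_next[of posmem]) (auto intro: Def_posmem simp: tok_header pos_le)

lemma Def_start: "j < m \<Longrightarrow> Def m (\<lambda>i e. start i (e j))"
  unfolding start_def by (intro Def_disj Def_hdr Def_ex Def_conj Def_Suc Def_sym) auto

definition istime :: "instance_data \<Rightarrow> nat \<Rightarrow> bool" where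
  "istime i x \<longleftrightarrow> time_le 0 (wd i) x x"

definition tz :: "instance_data \<Rightarrow> nat \<Rightarrow> int" where
  "tz i x = (THE z. time_at (wd i) x z)"

lemma tz_eq: "time_at (wd i) x z \<Longrightarrow> tz i x = z"
  unfolding tz_def by (rule the_equality) (auto dest: time_at_unique)

lemma istime_iff: "istime i x \<longleftrightarrow> time_at (wd i) x (tz i x)"
  unfolding istime_def time_le_def by (auto dest: tz_eq)

lemma time_le_iff: "time_at (wd i) x z \<Longrightarrow> time_at (wd i) y z' \<Longrightarrow> time_le c (wd i) x y \<longleftrightarrow> z \<le> z' + c"
  unfolding time_le_def by (auto dest: time_at_unique)

definition data :: "bool \<Rightarrow> instance_data \<Rightarrow> gatom set" where
  "data forgetting i = (if forgetting then restrict_after (set (ds_of i)) (tmem i) else set (ds_of i))"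

text \<open>Two inequalities express that the time at \<open>q\<close> is the reference time plus
  \<open>c\<close>. The last conjunct realises the restricted history: the fact must be later than
  the forgetting time.\<close>

definition Qt :: "bool \<Rightarrow> int \<Rightarrow> instance_data \<Rightarrow> nat \<Rightarrow> nat \<Rightarrow> bool" where
  "Qt forgetting c i x q \<longleftrightarrow> time_le c (wd i) q x \<and> time_le (- c) (wd i) x q \<and>
     (forgetting \<longrightarrow> (\<exists>\<mu>\<le>len i. \<mu> = posmem i \<and> \<not> time_le 0 (wd i) q \<mu>))"

lemma Qt_iff:
  "time_at (wd i) q t \<Longrightarrow> istime i x \<Longrightarrow> Qt forgetting c i x q \<longleftrightarrow> t = tz i x + c \<and> (forgetting \<longrightarrow> tmem i < t)"
  using pos_le(2)[of i] time_at_header(3)[of i]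
  by (auto simp: Qt_def istime_iff time_le_iff)

text \<open>An atom of the wrong arity or sort lies in no dataset, and the formula is constantly
  false. All other atoms meet the requirements of \<open>fact_iff\<close>.\<close>

lemma Def_data:
  assumes m: "0 < m" "set xs \<subseteq> {..<m}"
  shows "Def m (\<lambda>i e. istime i (e 0) \<and> allobj i e xs \<and> gat i e (tz i (e 0) + k0) R xs off \<in> data forgetting i)"
proof (cases "length xs = parity R \<and> (ptemp R \<longleftrightarrow> off \<noteq> None)")
  case False
  have "Def m (\<lambda>i e. False)" by (rule Def_const)
  then show ?thesis
  proof (rule Def_cong)
    fix i e assume i: "i \<in> insts"
    have "wf_gatom g" if "g \<in> data forgetting i" for g
      using i that by (auto simp: insts_def history_def dataset_def data_def restrict_after_def split: if_splits)
    from this[of "gat i e (tz i (e 0) + k0) R xs off"] False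
    show "(istime i (e 0) \<and> allobj i e xs \<and> gat i e (tz i (e 0) + k0) R xs off \<in> data forgetting i) = False"
      by (auto simp: wf_gatom_def gat_def)
  qed
next
  case True
  let ?g = "\<lambda>i e. gat i e (tz i (e 0) + k0) R xs off"
  \<comment> \<open>For a rigid atom the 0 is a filler; the time test is then guarded by
    \<open>ptemp R\<close> and never made.\<close>
  let ?c = "k0 + (case off of None \<Rightarrow> 0 | Some k \<Rightarrow> k)"
  let ?B = "\<lambda>i e q'. ptemp R \<longrightarrow> (\<exists>q2\<le>len i. q2 = Suc q' \<and> Qt forgetting ?c i (e 0) q2)"
  let ?C = "\<lambda>i e q. \<exists>q'\<le>len i. chain (wd i) q (map e xs) q' \<and> ?B i e q'"
  let ?L = "\<lambda>i e. \<exists>p\<le>len i. start i p \<and> at (wd i) p (enc_pred R) \<and>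
     (\<exists>q\<le>len i. q = p + length (enc_pred R) \<and> ?C i e q)"
  have Qt: "Def m' (\<lambda>i e. Qt forgetting ?c i (e 0) (e j))" if "0 < m'" "j < m'" for m' j
    unfolding Qt_def using that
    by (intro Def_conj Def_imp Def_const Def_time_le Def_ex Def_posmem Def_not) auto
  have B: "Def m' (\<lambda>i e. ?B i e (e j))" if "0 < m'" "j < m'" for m' j
    using that by (intro Def_imp Def_const Def_ex Def_conj Def_Suc Qt) auto
  have C: "Def m' (\<lambda>i e. ?C i e (e j))" if "m \<le> m'" "j < m'" for m' j
  proof (rule Def_ex)
    show "Def (Suc m') (\<lambda>i e. chain (wd i) (e j) (map e xs) (e m') \<and> ?B i e (e m'))"
      using that m by (intro Def_conj Def_chain B) auto
    fix i x and e :: "nat \<Rightarrow> nat"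
    have "map (e(m' := x)) xs = map e xs" using m(2) that(1) by (rule map_upd)
    moreover have "(e(m' := x)) j = e j" "(e(m' := x)) 0 = e 0" using that m by auto
    ultimately show "(chain (wd i) ((e(m' := x)) j) (map (e(m' := x)) xs) x \<and> ?B i (e(m' := x)) x) =
        (chain (wd i) (e j) (map e xs) x \<and> ?B i e x)" by (simp only:)
  qed
  have enc0: "0 \<notin> set (enc_pred R)" using set_enc_pred[of R] by auto
  have L: "Def m ?L"
  proof (rule Def_ex)
    have "Def (Suc m) (\<lambda>i e. \<exists>q\<le>len i. q = e m + length (enc_pred R) \<and> ?C i e q)"
    proof (rule Def_ex)
      show "Def (Suc (Suc m)) (\<lambda>i e. e (Suc m) = e m + length (enc_pred R) \<and> ?C i e (e (Suc m)))"
        by (intro Def_conj Def_plus_const C) auto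
      fix i x and e :: "nat \<Rightarrow> nat"
      have "map (e(Suc m := x)) xs = map e xs" using m(2) by (intro map_upd[of xs m]) auto
      moreover have "(e(Suc m := x)) m = e m" "(e(Suc m := x)) 0 = e 0" by auto
      ultimately show "(x = (e(Suc m := x)) m + length (enc_pred R) \<and> ?C i (e(Suc m := x)) x) =
        (x = e m + length (enc_pred R) \<and> ?C i e x)" by (simp only:)
    qed
    then show "Def (Suc m) (\<lambda>i e. start i (e m) \<and> at (wd i) (e m) (enc_pred R) \<and>
        (\<exists>q\<le>len i. q = e m + length (enc_pred R) \<and> ?C i e q))"
      by (intro Def_conj Def_start Def_at enc0) auto
    fix i x and e :: "nat \<Rightarrow> nat"
    have "map (e(m := x)) xs = map e xs" using m(2) by (intro map_upd[of xs m]) auto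
    moreover have "(e(m := x)) 0 = e 0" using m by auto
    ultimately show "(start i x \<and> at (wd i) x (enc_pred R) \<and>
        (\<exists>q\<le>len i. q = x + length (enc_pred R) \<and> ?C i (e(m := x)) q)) = (start i x \<and> at (wd i) x (enc_pred R) \<and>
        (\<exists>q\<le>len i. q = x + length (enc_pred R) \<and> ?C i e q))" by (simp only:)
  qed
  have "Def m (\<lambda>i e. istime i (e 0) \<and> allobj i e xs \<and> ?L i e)"
    unfolding istime_def using m by (intro Def_conj Def_time_le Def_allobj L) auto
  then show ?thesis
  proof (rule Def_cong)
    fix i e assume i: "i \<in> insts"
    show "(istime i (e 0) \<and> allobj i e xs \<and> ?g i e \<in> data forgetting i) =
      (istime i (e 0) \<and> allobj i e xs \<and> ?L i e)"
    proof (cases "istime i (e 0) \<and> allobj i e xs")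
      case pre: True
      define T where "T t \<longleftrightarrow> t = tz i (e 0) + ?c \<and> (forgetting \<longrightarrow> tmem i < t)" for t
      have "?L i e \<longleftrightarrow> (\<exists>g\<in>set (ds_of i). gpred g = R \<and> gobjs g = map (val i) (map e xs) \<and> (\<forall>t. gtime g = Some t \<longrightarrow> T t))"
        using pre True Qt_iff[of i _ _ "e 0"]
        by (intro fact_iff[OF i]) (auto simp: T_def allobj_def)
      also have "\<dots> \<longleftrightarrow> ?g i e \<in> data forgetting i"
      proof
        assume "\<exists>g\<in>set (ds_of i). gpred g = R \<and> gobjs g = map (val i) (map e xs) \<and> (\<forall>t. gtime g = Some t \<longrightarrow> T t)"
        then obtain g where g: "g \<in> set (ds_of i)" "gpred g = R" "gobjs g = map (val i) (map e xs)"
          "\<And>t. gtime g = Some t \<Longrightarrow> T t" by blast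
        have "wf_gatom g" using i g(1) by (auto simp: insts_def history_def dataset_def)
        then have t: "gtime g = None \<longleftrightarrow> off = None" using g(2) True by (auto simp: wf_gatom_def)
        have "gtime g = map_option (\<lambda>k. tz i (e 0) + k0 + k) off"
          using t g(4) by (cases off; cases "gtime g") (auto simp: T_def)
        then have eq: "?g i e = g"
          using g(2,3) by (cases g) (auto simp: gat_def)
        have "forgetting \<Longrightarrow> g \<in> restrict_after (set (ds_of i)) (tmem i)"
          using g(1,4) by (cases "gtime g") (auto simp: restrict_after_def T_def)
        then show "?g i e \<in> data forgetting i"
          unfolding eq data_def using g(1) by auto
      next
        assume *: "?g i e \<in> data forgetting i"
        then have "?g i e \<in> set (ds_of i)"
          by (auto simp: data_def restrict_after_def split: if_splits)
        moreover have "T t" if "gtime (?g i e) = Some t" for t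
          using that * by (cases off) (auto simp: T_def gat_def data_def restrict_after_def)
        ultimately show "\<exists>g\<in>set (ds_of i). gpred g = R \<and> gobjs g = map (val i) (map e xs) \<and> (\<forall>t. gtime g = Some t \<longrightarrow> T t)"
          by (intro bexI[of _ "?g i e"]) (auto simp: gat_def)
      qed
      finally show ?thesis by blast
    qed blast
  qed
qed

text \<open>Head 0 stands on the reference numeral. The query time is its value plus
  \<open>k0\<close>, and each update fact is \<open>kv v\<close> away from the query time.\<close>

definition upd :: "int \<Rightarrow> (pred \<times> int \<times> nat list) list \<Rightarrow> instance_data \<Rightarrow> (nat \<Rightarrow> nat) \<Rightarrow> gatom list" where
  "upd k0 vs i e = map (\<lambda>v. GAtom (pv v) (map (\<lambda>x. val i (e x)) (xv v)) (Some (tz i (e 0) + k0 + kv v))) vs"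

definition pre :: "(pred \<times> int \<times> nat list) list \<Rightarrow> instance_data \<Rightarrow> (nat \<Rightarrow> nat) \<Rightarrow> bool" where
  "pre vs i e \<longleftrightarrow> istime i (e 0) \<and> (\<forall>v\<in>set vs. allobj i e (xv v))"

lemma Def_pre:
  assumes "0 < m" "\<And>v. v \<in> set vs \<Longrightarrow> set (xv v) \<subseteq> {..<m}"
  shows "Def m (pre vs)"
proof -
  have "Def m (\<lambda>i e. istime i (e 0) \<and> (\<forall>v\<in>set vs. allobj i e (xv v)))"
    unfolding istime_def using assms by (intro Def_conj Def_time_le Def_ball Def_allobj) auto
  then show ?thesis by (rule Def_cong) (simp add: pre_def)
qed

text \<open>Guessed facts are known up to their objects, so membership among them is a finite
  disjunction of object equalities.\<close>

lemma Def_mem: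
  assumes m: "0 < m" "\<And>v. v \<in> set vs \<Longrightarrow> set (xv v) \<subseteq> {..<m}" "set xs \<subseteq> {..<m}"
  shows "Def m (\<lambda>i e. pre vs i e \<and> allobj i e xs \<and>
    gat i e (tz i (e 0) + k0) R xs off \<in> data forgetting i \<union> set (upd k0 vs i e))"
proof -
  let ?g = "\<lambda>i e. gat i e (tz i (e 0) + k0) R xs off"
  let ?same = "\<lambda>i e v. \<forall>n\<in>{..<length xs}. isobj i (e (xs ! n)) \<and> isobj i (e (xv v ! n)) \<and> val i (e (xs ! n)) = val i (e (xv v ! n))"
  let ?V = "{v \<in> set vs. pv v = R \<and> off = Some (kv v) \<and> length (xv v) = length xs}"
  have lt: "xs ! n < m" if "n < length xs" for n
    using m(3) nth_mem[OF that] by blast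
  have ltv: "xv v ! n < m" if "v \<in> ?V" "n < length xs" for v n
  proof -
    have "xv v ! n \<in> set (xv v)" using that by (intro nth_mem) simp
    then show ?thesis using m(2)[of v] that(1) by auto
  qed
  have "Def m (\<lambda>i e. pre vs i e \<and> ((istime i (e 0) \<and> allobj i e xs \<and> ?g i e \<in> data forgetting i) \<or>
     allobj i e xs \<and> (\<exists>v\<in>?V. ?same i e v)))"
    using m lt ltv by (intro Def_conj Def_pre Def_disj Def_data Def_allobj Def_bex Def_ball Def_val_eq) auto
  then show ?thesis
  proof (rule Def_cong)
    fix i e assume i: "i \<in> insts"
    show "(pre vs i e \<and> allobj i e xs \<and> ?g i e \<in> data forgetting i \<union> set (upd k0 vs i e)) =
      (pre vs i e \<and> ((istime i (e 0) \<and> allobj i e xs \<and> ?g i e \<in> data forgetting i) \<or>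
     allobj i e xs \<and> (\<exists>v\<in>?V. ?same i e v)))"
    proof (cases "pre vs i e \<and> allobj i e xs")
      case True
      have obj: "isobj i (e (xs ! n))" if "n < length xs" for n
        using True nth_mem[OF that] by (auto simp: allobj_def)
      have objv: "isobj i (e (xv v ! n))" if "v \<in> ?V" "n < length xs" for v n
        using True that nth_mem[of n "xv v"] by (auto simp: pre_def allobj_def)
      have "?g i e = GAtom (pv v) (map (\<lambda>x. val i (e x)) (xv v)) (Some (tz i (e 0) + k0 + kv v)) \<longleftrightarrow>
        v \<in> ?V \<and> (?same i e v)"
        if v: "v \<in> set vs" for v
      proof -
        have "?g i e = GAtom (pv v) (map (\<lambda>x. val i (e x)) (xv v)) (Some (tz i (e 0) + k0 + kv v)) \<longleftrightarrow>
          v \<in> ?V \<and> (\<forall>n<length xs. val i (e (xs ! n)) = val i (e (xv v ! n)))"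
          using v by (cases off) (auto simp: gat_def list_eq_iff_nth_eq)
        then show ?thesis using obj objv[of v] by auto
      qed
      then have "?g i e \<in> set (upd k0 vs i e) \<longleftrightarrow>
        (\<exists>v\<in>?V. ?same i e v)"
        unfolding upd_def set_map image_iff by (intro bex_restrict) auto
      then show ?thesis using True by (auto simp: pre_def)
    qed blast
  qed
qed

section \<open>Guessed violations\<close>

lemma fact_time:
  assumes "f \<in> set (ds_of i)" "gtime f = Some t"
  shows "\<exists>x\<le>len i. time_at (wd i) x t"
proof -
  obtain ds1 ds2 where ds: "ds_of i = ds1 @ f # ds2" using assms(1) by (meson split_list)
  let ?u = "hdr i @ concat (map enc_fact ds1) @ enc_pred (gpred f) @ objs_enc (gobjs f) @ [7]"
  have w: "wd i = ?u @ enc_int t @ 3 # (8 # concat (map enc_fact ds2) @ suf)"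
    unfolding wd_eq ds by (simp add: enc_fact_eq time_enc_def assms(2))
  have "drop (length ?u) (wd i) = enc_int t @ 3 # (8 # concat (map enc_fact ds2) @ suf)" unfolding w by simp
  then have "time_at (wd i) (length ?u) t" unfolding time_at_def by blast
  moreover have "length ?u \<le> len i" unfolding w by simp
  ultimately show ?thesis by blast
qed

text \<open>What can be fixed about an update before the instance is known: predicates and offsets
  from the query time. Their finiteness turns this part of the guess into a finite
  disjunction.\<close>

definition shapes :: "(pred \<times> int) list set" where
  "shapes = {S. set S \<subseteq> {R \<in> preds_of \<Pi>. \<not> pidb R \<and> ptemp R} \<times> {- int (K * N)..int (K * N)} \<and> length S \<le> b ^ N}"

lemma finite_shapes: "finite shapes"
  unfolding shapes_def using finite_\<Pi> by (intro finite_lists_length_le) (auto simp: preds_of_def)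

definition vars :: "(pred \<times> int) list \<Rightarrow> (pred \<times> int \<times> nat list) list" where
  "vars S = layout (1 + parity P) S"

definition qvars :: "nat list" where
  "qvars = [1..<1 + parity P]"

text \<open>Position 0 holds the numeral of the input time, so the second condition places each
  guessed fact after it. The last one negates a guarded derivation, the form delivered by
  \<open>Def_der\<close>; as the guards hold by the preceding conjunct, it amounts to
  non-derivability.\<close>

definition violation :: "int \<Rightarrow> (pred \<times> int) list \<Rightarrow> instance_data \<Rightarrow> (nat \<Rightarrow> nat) \<Rightarrow> bool" where
  "violation k0 S i e \<longleftrightarrow>
     time_le k0 (wd i) (posout i) (e 0) \<and>
     (\<forall>v\<in>set (vars S). \<not> time_le (- (k0 + kv v)) (wd i) (e 0) 0) \<and>
     (pre (vars S) i e \<and> allobj i e qvars \<and>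
       der \<Pi> (data False i \<union> set (upd k0 (vars S) i e)) N (gat i e (tz i (e 0) + k0) P qvars (Some 0))) \<and>
     \<not> (pre (vars S) i e \<and> allobj i e qvars \<and>
       der \<Pi> (data True i \<union> set (upd k0 (vars S) i e)) N (gat i e (tz i (e 0) + k0) P qvars (Some 0)))"

lemma Def_violation: "Def (1 + parity P + width S) (violation k0 S)"
proof -
  let ?d = "\<lambda>f i e. pre (vars S) i e \<and> allobj i e qvars \<and>
       der \<Pi> (data f i \<union> set (upd k0 (vars S) i e)) N (gat i e (tz i (e 0) + k0) P qvars (Some 0))"
  let ?m = "1 + parity P + width S"
  have vs: "set (xv v) \<subseteq> {..<?m}" if "v \<in> set (vars S)" for v
    using layout_props[of v "1 + parity P" S] that by (auto simp: vars_def)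
  have "Def ?m (\<lambda>i e. \<exists>z\<le>len i. z = posout i \<and> time_le k0 (wd i) z (e 0))"
    by (intro Def_ex Def_conj Def_posout Def_time_le) auto
  then have 1: "Def ?m (\<lambda>i e. time_le k0 (wd i) (posout i) (e 0))"
    by (rule Def_cong) (use pos_le(1) in auto)
  have "Def ?m (\<lambda>i e. \<forall>v\<in>set (vars S). \<exists>z\<le>len i. z = 0 \<and> \<not> time_le (- (k0 + kv v)) (wd i) (e 0) z)"
    by (intro Def_ball Def_ex Def_conj Def_zero Def_not Def_time_le) auto
  then have 2: "Def ?m (\<lambda>i e. \<forall>v\<in>set (vars S). \<not> time_le (- (k0 + kv v)) (wd i) (e 0) 0)"
    by (rule Def_cong) auto
  \<comment> \<open>Data and guessed facts read the first \<open>?m\<close> heads only; the rule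
    terms of the derivation use heads beyond them.\<close>
  have 3: "Def ?m (?d f)" for f
  proof (rule Def_der[where ?m0.0 = ?m and \<tau> = "\<lambda>i e. tz i (e 0) + k0" and E = "\<lambda>i e. data f i \<union> set (upd k0 (vars S) i e)"])
    show "Def m (\<lambda>i e. pre (vars S) i e \<and> allobj i e xs \<and> gat i e (tz i (e 0) + k0) R xs off \<in>
        data f i \<union> set (upd k0 (vars S) i e))" if "?m \<le> m" "set xs \<subseteq> {..<m}" for m R xs off
      using that vs by (intro Def_mem) fastforce+
    show "data f i \<union> set (upd k0 (vars S) i e) = data f i \<union> set (upd k0 (vars S) i e') \<and>
        tz i (e 0) + k0 = tz i (e' 0) + k0 \<and> pre (vars S) i e = pre (vars S) i e'" if ag: "agree ?m e e'" for i e e'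
    proof -
      have e0: "e 0 = e' 0" using ag by (simp add: agree_def)
      have ex: "e x = e' x" if "v \<in> set (vars S)" "x \<in> set (xv v)" for v x
        using ag vs[OF that(1)] that(2) by (auto simp: agree_def)
      have "upd k0 (vars S) i e = upd k0 (vars S) i e'"
        unfolding upd_def using e0 ex by (intro map_cong) auto
      moreover have "pre (vars S) i e = pre (vars S) i e'"
        unfolding pre_def allobj_def using e0 ex by simp
      ultimately show ?thesis using e0 by simp
    qed
    show "Def m (pre (vars S))" if "?m \<le> m" for m
      using that vs by (intro Def_pre) fastforce+
    show "objs (data f i \<union> set (upd k0 (vars S) i e)) \<subseteq> Dom i" if i: "i \<in> insts" "ok i e" "pre (vars S) i e" for i e
    proof -
      have "objs (data f i) \<subseteq> Dom i" by (auto simp: data_def restrict_after_def objs_def Dom_def old_def)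
      moreover have "objs (set (upd k0 (vars S) i e)) \<subseteq> Dom i"
        using i(3) ok_le[OF i(2)] unfolding Dom_val by (fastforce simp: upd_def objs_def pre_def allobj_def)
      ultimately show ?thesis by (auto simp: objs_def)
    qed
    show "set qvars \<subseteq> {..<?m}" by (auto simp: qvars_def)
  qed simp
  have "Def ?m (\<lambda>i e. time_le k0 (wd i) (posout i) (e 0) \<and>
     (\<forall>v\<in>set (vars S). \<not> time_le (- (k0 + kv v)) (wd i) (e 0) 0) \<and>
     ?d False i e \<and>
     \<not> ?d True i e)"
    by (intro Def_conj Def_not 1 2 3)
  then show ?thesis by (rule Def_cong) (simp only: violation_def)
qed

text \<open>Translates the bounded violations of \<open>forget_witness\<close> into head positions
  and back: a reference numeral, the answer tuple and the update objects are the guess, offsets and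
  predicates a finite choice.\<close>

lemma forget_iff:
  assumes i: "i \<in> insts"
  shows "\<not> forget (P, \<Pi>) (set (ds_of i)) (tin i) (tout i) (tmem i) \<longleftrightarrow>
    (\<exists>k0\<in>{- int (K * N)..int (K * N)}. \<exists>S\<in>shapes. \<exists>e. ok i e \<and> violation k0 S i e)"
    (is "?L \<longleftrightarrow> ?R")
proof -
  let ?D = "set (ds_of i)"
  \<comment> \<open>Any numeral of the word may serve as reference, those of the header included;
    \<open>forget_witness\<close> admits every predicate that holds close to the facts.\<close>
  define near where "near \<tau> \<longleftrightarrow> (\<exists>x\<le>len i. \<exists>k0\<in>{- int (K * N)..int (K * N)}. istime i x \<and> \<tau> = tz i x + k0)" for \<tau>
  have hist: "history (tin i) ?D" using i by (simp add: insts_def)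
  have near: "near \<tau>" if f: "f \<in> ?D" "gtime f = Some t" "\<bar>t - \<tau>\<bar> \<le> int (K * N)" for f t \<tau>
  proof -
    obtain x where x: "x \<le> len i" "time_at (wd i) x t" using fact_time[OF f(1,2)] by blast
    then have "istime i x" "tz i x = t" using tz_eq by (auto simp: istime_iff)
    then show ?thesis unfolding near_def using x(1) f(3)
      by (intro exI[of _ x] conjI bexI[of _ "\<tau> - t"]) auto
  qed
  have card: "b ^ N * A \<le> card (fresh i)"
    unfolding fresh_def F_def by (subst card_image) (auto simp: inj_on_def)
  have Dom: "objs ?D \<union> consts_of \<Pi> \<union> fresh i = Dom i" by (simp add: Dom_def old_def)
  have fresh: "finite (fresh i)" "fresh i \<inter> (objs ?D \<union> consts_of \<Pi>) = {}"
    using fresh_disjoint[of i] by (simp_all add: fresh_def old_def)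
  have W: "?L \<longleftrightarrow> (\<exists>\<tau> os us. tout i \<le> \<tau> \<and> near \<tau> \<and> length us \<le> b ^ N \<and>
      (\<forall>u\<in>set us. update_atom \<Pi> (Dom i) (tin i) \<tau> (K * N) u) \<and>
      set os \<subseteq> Dom i \<and> length os = parity P \<and>
      der \<Pi> (?D \<union> set us) N (GAtom P os (Some \<tau>)) \<and>
      \<not> der \<Pi> (restrict_after ?D (tmem i) \<union> set us) N (GAtom P os (Some \<tau>)))"
    unfolding Dom[symmetric]
  proof (rule forget_witness[OF Q con ntp _ K b(1) _ A hist _ fresh(1) card fresh(2)])
    show "der \<Pi> E N g" if "gpred g = P" "der \<Pi> E d g" for E d g using that by (rule N)
    show "length (body r) \<le> b" if "r \<in> \<Pi>" for r using that by (rule b(2))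
    show "near \<tau>" if "f \<in> ?D" "gtime f = Some t" "\<bar>t - \<tau>\<bar> \<le> int (K * N)" for f t \<tau>
      using that by (rule near)
  qed
  show ?thesis
  proof
    assume ?L
    then obtain \<tau> os us where out: "tout i \<le> \<tau>" and near: "near \<tau>" and lus: "length us \<le> b ^ N"
      and us: "\<And>u. u \<in> set us \<Longrightarrow> update_atom \<Pi> (Dom i) (tin i) \<tau> (K * N) u"
      and os: "set os \<subseteq> Dom i" "length os = parity P"
      and pos: "der \<Pi> (?D \<union> set us) N (GAtom P os (Some \<tau>))"
      and neg: "\<not> der \<Pi> (restrict_after ?D (tmem i) \<union> set us) N (GAtom P os (Some \<tau>))"
      unfolding W by blast
    from near obtain x k0 where x: "x \<le> len i" "k0 \<in> {- int (K * N)..int (K * N)}" "istime i x" "\<tau> = tz i x + k0"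
      unfolding near_def by blast
    \<comment> \<open>Update times are measured from the query time, which keeps them inside the
      fixed interval of \<open>shapes\<close>.\<close>
    define h where "h u = the (gtime u) - \<tau>" for u
    define S where "S = map (\<lambda>u. (gpred u, h u)) us"
    have gt: "gtime u = Some (\<tau> + h u)" "tin i < \<tau> + h u" "\<bar>h u\<bar> \<le> int (K * N)" if "u \<in> set us" for u
      using us[OF that] by (auto simp: update_atom_def h_def)
    have len_u: "length (gobjs u) = parity (gpred u)" "set (gobjs u) \<subseteq> Dom i" if "u \<in> set us" for u
      using us[OF that] by (auto simp: update_atom_def wf_gatom_def)
    have S: "S \<in> shapes"
      using us lus gt(3) unfolding shapes_def S_def by (fastforce simp: update_atom_def wf_gatom_def)
    define cs where "cs = os @ concat (map gobjs us)"
    have cs_Dom: "set cs \<subseteq> Dom i" using os(1) len_u(2) by (auto simp: cs_def)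
    define pick where "pick c = (SOME y. y \<le> len i \<and> isobj i y \<and> val i y = c)" for c
    have pick: "pick c \<le> len i \<and> isobj i (pick c) \<and> val i (pick c) = c" if "c \<in> Dom i" for c
      unfolding pick_def by (rule someI_ex) (use that Dom_val[of i] in auto)
    \<comment> \<open>Head 0 holds the reference numeral and head \<open>Suc j\<close> the
      \<open>j\<close>-th object of the answer followed by those of the update, in the order that
      \<open>qvars\<close> and \<open>layout\<close> expect. The remaining heads rest at 0.\<close>
    define e where "e j = (if j = 0 then x else if j - 1 < length cs then pick (cs ! (j - 1)) else 0)" for j
    have e0: "e 0 = x" by (simp add: e_def)
    have cs_nth: "cs ! j \<in> Dom i" if "j < length cs" for j using cs_Dom nth_mem[OF that] by blast
    have ej: "isobj i (e (Suc j))" "val i (e (Suc j)) = cs ! j" if "j < length cs" for j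
      using that pick[OF cs_nth[OF that]] by (auto simp: e_def)
    have ok: "ok i e" unfolding ok_def e_def using x(1) pick[OF cs_nth] by auto
    have width: "length cs = parity P + width S"
    proof -
      have "length (concat (map gobjs us)) = width S"
        using len_u(1) unfolding S_def width_def length_concat by (simp add: comp_def cong: map_cong)
      then show ?thesis by (simp add: cs_def os(2))
    qed
    have obj: "isobj i (e j)" if "1 \<le> j" "j < 1 + parity P + width S" for j
      using that ej(1)[of "j - 1"] width by (cases j) auto
    have vals: "map (\<lambda>x. val i (e x)) qvars = os"
      unfolding qvars_def
    proof (rule nth_equalityI)
      fix j assume "j < length (map (\<lambda>x. val i (e x)) [1..<1 + parity P])"
      then show "map (\<lambda>x. val i (e x)) [1..<1 + parity P] ! j = os ! j"
        using ej(2)[of j] os(2) by (simp add: cs_def nth_append del: upt_Suc)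
    qed (simp add: os(2) del: upt_Suc)
    have upd: "upd k0 (vars S) i e = us"
    proof -
      have "upd k0 (vars S) i e = map (\<lambda>u. GAtom (gpred u) (gobjs u) (Some (\<tau> + h u))) us"
        unfolding upd_def vars_def S_def e0 x(4)[symmetric]
        by (rule layout_atoms[OF len_u(1)]) (use ej(2) os(2) in \<open>auto simp: cs_def nth_append\<close>)
      also have "\<dots> = us"
      proof (rule map_idI)
        fix u assume "u \<in> set us"
        from gt(1)[OF this] show "GAtom (gpred u) (gobjs u) (Some (\<tau> + h u)) = u" by (cases u) simp
      qed
      finally show ?thesis .
    qed
    have vlay: "set (xv v) \<subseteq> {1 + parity P..<1 + parity P + width S}" "\<exists>u\<in>set us. kv v = h u" if "v \<in> set (vars S)" for v
      using layout_props[of v "1 + parity P" S] that by (auto simp: vars_def S_def)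
    have pre: "pre (vars S) i e"
      unfolding pre_def allobj_def using x(3) e0 vlay(1) obj by fastforce
    have q: "allobj i e qvars" unfolding allobj_def qvars_def using obj by auto
    have tx: "time_at (wd i) (e 0) (tz i x)" using x(3) e0 by (simp add: istime_iff)
    have gat: "gat i e (tz i (e 0) + k0) P qvars (Some 0) = GAtom P os (Some \<tau>)"
      using vals x(4) e0 by (simp add: gat_def)
    have "time_le k0 (wd i) (posout i) (e 0)"
      using time_le_iff[OF time_at_header(2) tx] out x(4) by simp
    moreover have "\<not> time_le (- (k0 + kv v)) (wd i) (e 0) 0" if v: "v \<in> set (vars S)" for v
    proof -
      obtain u where "u \<in> set us" "kv v = h u" using vlay(2)[OF v] by blast
      then show ?thesis using time_le_iff[OF tx time_at_header(1)] gt(2)[of u] x(4) by simp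
    qed
    ultimately have "violation k0 S i e"
      unfolding violation_def gat upd using pre q pos neg by (simp add: data_def)
    then show ?R using x(2) S ok by blast
  next
    assume ?R
    then obtain k0 S e where k0: "k0 \<in> {- int (K * N)..int (K * N)}" and S: "S \<in> shapes" and ok: "ok i e"
      and v: "violation k0 S i e" by blast
    let ?\<tau> = "tz i (e 0) + k0" and ?os = "map (\<lambda>x. val i (e x)) qvars" and ?us = "upd k0 (vars S) i e"
    have pre: "pre (vars S) i e" and q: "allobj i e qvars" using v by (auto simp: violation_def)
    have tx: "time_at (wd i) (e 0) (tz i (e 0))" using pre by (simp add: pre_def istime_iff)
    have "tout i \<le> ?\<tau>" using v time_le_iff[OF time_at_header(2) tx] by (simp add: violation_def)
    moreover have "near ?\<tau>" unfolding near_def using k0 ok_le[OF ok, of 0] pre by (auto simp: pre_def)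
    moreover have "length ?us \<le> b ^ N" using S by (simp add: upd_def vars_def length_layout shapes_def)
    moreover have "update_atom \<Pi> (Dom i) (tin i) ?\<tau> (K * N) u" if "u \<in> set ?us" for u
    proof -
      obtain v' where v': "v' \<in> set (vars S)" "u = GAtom (pv v') (map (\<lambda>x. val i (e x)) (xv v')) (Some (?\<tau> + kv v'))"
        using \<open>u \<in> set ?us\<close> unfolding upd_def set_map image_iff by blast
      have lay: "length (xv v') = parity (pv v')" "(pv v', kv v') \<in> set S"
        using layout_props[of v' "1 + parity P" S] v'(1) by (auto simp: vars_def)
      then have "pv v' \<in> {R \<in> preds_of \<Pi>. \<not> pidb R \<and> ptemp R} \<and> kv v' \<in> {- int (K * N)..int (K * N)}"
        using S unfolding shapes_def by blast
      then have "pv v' \<in> preds_of \<Pi>" "\<not> pidb (pv v')" "ptemp (pv v')" "\<bar>kv v'\<bar> \<le> int (K * N)" by auto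
      moreover have "\<not> time_le (- (k0 + kv v')) (wd i) (e 0) 0" using v v'(1) by (simp add: violation_def)
      then have "tin i < ?\<tau> + kv v'" using time_le_iff[OF tx time_at_header(1)] by simp
      moreover have "set (gobjs u) \<subseteq> Dom i"
        using pre v' ok_le[OF ok] unfolding Dom_val by (auto simp: pre_def allobj_def)
      ultimately show ?thesis using v'(2) lay(1) by (auto simp: update_atom_def wf_gatom_def)
    qed
    moreover have "set ?os \<subseteq> Dom i" using q ok_le[OF ok] unfolding Dom_val by (auto simp: allobj_def)
    moreover have "length ?os = parity P" by (simp add: qvars_def)
    moreover have "gat i e ?\<tau> P qvars (Some 0) = GAtom P ?os (Some ?\<tau>)" by (simp add: gat_def)
    then have "der \<Pi> (?D \<union> set ?us) N (GAtom P ?os (Some ?\<tau>))"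
      "\<not> der \<Pi> (restrict_after ?D (tmem i) \<union> set ?us) N (GAtom P ?os (Some ?\<tau>))"
      using v pre q by (auto simp: violation_def data_def)
    ultimately show ?L unfolding W by blast
  qed
qed

lemma Def_forget: "Def 0 (\<lambda>i e. forget (P, \<Pi>) (set (ds_of i)) (tin i) (tout i) (tmem i))"
proof -
  have "Def 0 (\<lambda>i e. \<not> (\<exists>k0\<in>{- int (K * N)..int (K * N)}. \<exists>S\<in>shapes. \<exists>e. ok i e \<and> violation k0 S i e))"
    by (intro Def_not Def_bex Def_env[OF Def_violation] finite_shapes) auto
  then show ?thesis by (rule Def_cong) (use forget_iff in blast)
qed

end

theorem theorem9:
  fixes Q :: query
  assumes "temporal_query Q"
    and "nonrecursive (snd Q)"
    and "connected (snd Q)"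
    and "no_time_points (snd Q)"
  shows "\<exists>M c k. wf_tm M \<and> 9 \<le> tm_nsym M \<and>
           (\<forall>ds \<tau>in \<tau>out \<tau>mem. history \<tau>in (set ds) \<and> \<tau>mem \<le> \<tau>out \<and> \<tau>out \<le> \<tau>in \<longrightarrow>
              decides_within M (enc_instance ds \<tau>in \<tau>out \<tau>mem)
                (c * length (enc_instance ds \<tau>in \<tau>out \<tau>mem) ^ k + c)
                (forget Q (set ds) \<tau>in \<tau>out \<tau>mem))"
proof -
  obtain P \<Pi> where Q_eq: "Q = (P, \<Pi>)" by (cases Q)
  have fin: "finite \<Pi>" using assms(1) Q_eq by (simp add: temporal_query_def program_def)
  \<comment> \<open>These bounds are fixed before the machine and depend on the query alone, which
    is the meaning of data complexity.\<close>
  obtain N where N: "\<And>E d g. gpred g = P \<Longrightarrow> der \<Pi> E d g \<Longrightarrow> der \<Pi> E N g"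
    using nonrecursive_depth[OF fin, of P] assms(2) Q_eq by auto
  obtain K where K: "shift_bound \<Pi> K" using shift_bound_ex[OF fin] by blast
  obtain b where b: "1 \<le> b" "\<And>r. r \<in> \<Pi> \<Longrightarrow> length (body r) \<le> b" using body_bound_ex[OF fin] by blast
  obtain A where A: "arity_bound \<Pi> A" using arity_bound_ex[OF fin] by blast
  obtain cs where cs: "set cs = consts_of \<Pi>" using finite_list[OF finite_consts_of[OF fin]] by blast
  interpret forget_query P \<Pi> N K b A cs
    using assms(1,3,4) N K b A cs by unfold_locales (auto simp: Q_eq)
  have "wd = (\<lambda>i. enc i @ suf)" by (rule ext) (rule wd_def)
  then obtain M c k where M: "wf_tm M" "9 \<le> tm_nsym M"
    "\<And>i. i \<in> insts \<Longrightarrow> decides_within M (enc i) (c * length (enc i) ^ k + c)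
       (forget (P, \<Pi>) (set (ds_of i)) (tin i) (tout i) (tmem i))"
    using words_decidable[of enc suf insts "\<lambda>i e. forget (P, \<Pi>) (set (ds_of i)) (tin i) (tout i) (tmem i)"]
      words_axioms Def_forget by auto
  show ?thesis
  proof (intro exI conjI allI impI)
    fix ds \<tau>in \<tau>out \<tau>mem
    assume "history \<tau>in (set ds) \<and> \<tau>mem \<le> \<tau>out \<and> \<tau>out \<le> \<tau>in"
    then show "decides_within M (enc_instance ds \<tau>in \<tau>out \<tau>mem)
        (c * length (enc_instance ds \<tau>in \<tau>out \<tau>mem) ^ k + c) (forget Q (set ds) \<tau>in \<tau>out \<tau>mem)"
      using M(3)[of "(ds, \<tau>in, \<tau>out, \<tau>mem)"]
      by (simp add: insts_def enc_def ds_of_def tin_def tout_def tmem_def Q_eq)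
  qed (use M in auto)
qed

end
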